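(* Let $\delta,\epsilon$ be constants with $0\le\delta<1$, $0<\epsilon\le\frac12$ and $\delta>2\epsilon$. Then $\mathsf{BP}_{\epsilon}\mathsf{CL}_{\delta}\mathsf{P}=\mathsf{BPP}$.
   Context: A catalytic Turing machine has a read-only input tape, a write-only output tape, a read-write work tape and a read-write catalytic tape which initially holds an arbitrary string $\tau$. A randomized such machine with $c$ catalytic bits additionally has read-only, read-once access to a uniformly random string $r\in\{0,1\}^{2^c}$. For functions $s,c$ of the input length $n$, a language $L$ is in $\mathsf{BP}_{\epsilon}\mathsf{CSPACE}_{\delta}[s,c]$ (for $0\le\delta<1$, $0<\epsilon\le\frac12$) if there is a randomized catalytic machine $M$ with $s$ bits of work space and $c$ bits of catalytic space such that for every input $x\in\{0,1\}^n$ and every initial catalytic content $\tau\in\{0,1\}^c$: $M$ always halts, outputs $L(x)$ with probability at least $\frac12+\epsilon$ over $r$, and halts with exactly $\tau$ on its catalytic tape with probability at least $1-\delta$ over $r$. $\mathsf{BP}_{\epsilon}\mathsf{CL}_{\delta}\mathsf{P}$ is the class of languages decided in this sense by such machines with $s=k\log n$, $c=n^k$ for some constant $k$, which additionally always halt within $n^k$ steps (on every input, initial tape and random string). *)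

theory Defs
  imports Complex_Main "HOL-Library.Log_Nat"
begin

text \<open>Tape alphabet of work / catalytic tapes is {0,1} (bool).  The input tape is
read-only and holds the input between two end markers (None); positions
0 and n+1 are end markers, position i (1..n) holds the i-th input bit.
The work tape has exactly s cells, the catalytic tape exactly c cells.
The random string r is accessed read-once: in a step the machine may
declare (via coin) that it consumes the next random bit; the random head
then advances and never returns.  The output (a single bit, since we decide
languages) is given by halting in the accepting or rejecting state.\<close>

datatype move = MLeft | MStay | MRight

record rmachine =
  nstates :: nat
  start :: nat
  acc :: nat
  rej :: nat
  coin :: "nat \<Rightarrow> bool option \<Rightarrow> bool \<Rightarrow> bool \<Rightarrow> bool"
  delta :: "nat \<Rightarrow> bool option \<Rightarrow> bool \<Rightarrow> bool \<Rightarrow> bool \<Rightarrow>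
              nat \<times> bool \<times> bool \<times> move \<times> move \<times> move"
  \<comment> \<open>delta q inputsymbol workbit catbit randombit =
      (new state, work bit written, cat bit written, input move, work move, cat move)\<close>

definition wf_machine :: "rmachine \<Rightarrow> bool" where
  "wf_machine M \<longleftrightarrow> start M < nstates M \<and> acc M < nstates M \<and> rej M < nstates M
     \<and> acc M \<noteq> rej M
     \<and> (\<forall>q a w c b. q < nstates M \<longrightarrow> fst (delta M q a w c b) < nstates M)"

record config =
  cstate :: nat
  ihead :: nat
  wtape :: "bool list"
  whead :: nat
  ctape :: "bool list"
  chead :: nat
  rhead :: nat

definition do_move :: "move \<Rightarrow> nat \<Rightarrow> nat \<Rightarrow> nat" where
  "do_move m h bound = (case m of MLeft \<Rightarrow> h - 1 | MStay \<Rightarrow> h | MRight \<Rightarrow> min (h + 1) bound)"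

definition read_cell :: "bool list \<Rightarrow> nat \<Rightarrow> bool" where
  "read_cell t h = (if h < length t then t ! h else False)"

definition input_sym :: "bool list \<Rightarrow> nat \<Rightarrow> bool option" where
  "input_sym x h = (if 1 \<le> h \<and> h \<le> length x then Some (x ! (h - 1)) else None)"

definition halted :: "rmachine \<Rightarrow> config \<Rightarrow> bool" where
  "halted M cf \<longleftrightarrow> cstate cf = acc M \<or> cstate cf = rej M"

definition step :: "rmachine \<Rightarrow> bool list \<Rightarrow> bool list \<Rightarrow> config \<Rightarrow> config" where
  "step M x r cf =
    (if halted M cf then cf else
     (let q = cstate cf;
          a = input_sym x (ihead cf);
          w = read_cell (wtape cf) (whead cf);
          c = read_cell (ctape cf) (chead cf);
          b = coin M q a w c;
          rb = (b \<and> read_cell r (rhead cf));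
          (q', ww, cw, mi, mw, mc) = delta M q a w c rb
      in \<lparr> cstate = q',
           ihead = do_move mi (ihead cf) (length x + 1),
           wtape = (wtape cf)[whead cf := ww],
           whead = do_move mw (whead cf) (length (wtape cf) - 1),
           ctape = (ctape cf)[chead cf := cw],
           chead = do_move mc (chead cf) (length (ctape cf) - 1),
           rhead = (if b then rhead cf + 1 else rhead cf) \<rparr>))"

definition init_config :: "rmachine \<Rightarrow> nat \<Rightarrow> bool list \<Rightarrow> config" where
  "init_config M s \<tau> = \<lparr> cstate = start M, ihead = 0, wtape = replicate s False, whead = 0,
                        ctape = \<tau>, chead = 0, rhead = 0 \<rparr>"

definition run :: "rmachine \<Rightarrow> bool list \<Rightarrow> nat \<Rightarrow> bool list \<Rightarrow> bool list \<Rightarrow> nat \<Rightarrow> config" where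
  "run M x s \<tau> r t = (step M x r ^^ t) (init_config M s \<tau>)"

definition halts_within :: "rmachine \<Rightarrow> bool list \<Rightarrow> nat \<Rightarrow> bool list \<Rightarrow> bool list \<Rightarrow> nat \<Rightarrow> bool" where
  "halts_within M x s \<tau> r T \<longleftrightarrow> (\<exists>t\<le>T. halted M (run M x s \<tau> r t))"

definition prob_rand :: "nat \<Rightarrow> (bool list \<Rightarrow> bool) \<Rightarrow> real" where
  "prob_rand m P = real (card {r. length r = m \<and> P r}) / 2 ^ m"

text \<open>Languages are sets of binary strings.  Polynomial bounds n^k are taken as (n+2)^k and
k log n as k * floorlog 2 (n+2) (the bit length of n+2), to avoid degenerate bounds for n \<le> 1.\<close>

definition BPCLP :: "real \<Rightarrow> real \<Rightarrow> bool list set set" where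
  "BPCLP \<epsilon> \<delta> = {L. \<exists>M k. wf_machine M \<and>
     (\<forall>x. let n = length x; s = k * floorlog 2 (n + 2); c = (n + 2) ^ k;
               T = (n + 2) ^ k; m = 2 ^ c in
       \<forall>\<tau>. length \<tau> = c \<longrightarrow>
         (\<forall>r. length r = m \<longrightarrow> halts_within M x s \<tau> r T) \<and>
         prob_rand m (\<lambda>r. (cstate (run M x s \<tau> r T) = acc M) = (x \<in> L)) \<ge> 1/2 + \<epsilon> \<and>
         prob_rand m (\<lambda>r. ctape (run M x s \<tau> r T) = \<tau>) \<ge> 1 - \<delta>)}"

definition BPP :: "bool list set set" where
  "BPP = {L. \<exists>M k. wf_machine M \<and>
     (\<forall>x. let n = length x; p = (n + 2) ^ k in
       (\<forall>r. length r = p \<longrightarrow> halts_within M x p [] r p) \<and>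
       prob_rand p (\<lambda>r. (cstate (run M x p [] r p) = acc M) = (x \<in> L)) \<ge> 2/3)}"

end

theory Submission
  imports Defs
begin

text \<open>A catalytic machine in polynomial time cannot use the length of its catalytic tape, so a
  machine with one long blank tape can simulate it: the logarithmically many work cells are marked
  out by counting the input in binary, both tapes are stored on one, and the error is reduced by a
  majority vote over independent trials.

  Conversely, let \<open>q\<close> be a dyadic number with \<open>2 * \<epsilon> < q \<le> \<delta>\<close>. With probability \<open>q\<close> a catalytic
  machine may destroy its tape: it wipes a polynomially long part of it, timed by a counter in the
  work space, and runs there a machine with error \<open>1/2 - \<epsilon> / q\<close>. Otherwise it guesses the answer.
  The total error is \<open>q * (1/2 - \<epsilon> / q) + (1 - q) / 2 = 1/2 - \<epsilon>\<close>.

  Runs are represented by binary trees that branch at coin flips. The relation \<open>reach S ok n c D\<close>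
  says that within \<open>n\<close> steps, through configurations satisfying \<open>ok\<close>, the configuration \<open>c\<close>
  evolves into the tree \<open>D\<close> of configurations; it composes along sequences of program phases and
  along simulations.\<close>

section \<open>Coin trees\<close>

text \<open>What makes a simulation delicate is the right end of a tape: moves beyond the last cell
  are clamped, so a machine can feel where a tape stops. The catalytic tape has as many cells as
  there are steps, so its end cannot influence the answer. The work tape is short and its end can be
  felt, so the simulator has to reproduce its exact length; an upper bound would not do. In the
  converse direction the old catalytic content is arbitrary and nothing on that tape marks its left
  end, so neither the length to be wiped nor the way back can be recorded there. The clock supplies
  both. It has to count polynomially far on logarithmically many cells, which is achieved by a large
  constant base. Each run ends after boundedly many flips, so its probabilities are dyadic; this is
  why \<open>q\<close> is chosen dyadic. The condition \<delta> > 2\<epsilon> leaves room for such a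
  \<open>q\<close> with 1/2 - \<epsilon>/q positive. Amplification cannot reach error 0, but any
  positive constant error costs a constant number of trials, which fit into finitely many states and
  tracks.\<close>

datatype 'a tree = Leaf 'a | Flip "'a tree" "'a tree"

primrec bindt :: "'a tree \<Rightarrow> ('a \<Rightarrow> 'b tree) \<Rightarrow> 'b tree" where
  "bindt (Leaf a) k = k a"
| "bindt (Flip s t) k = Flip (bindt s k) (bindt t k)"

primrec expect :: "('a \<Rightarrow> real) \<Rightarrow> 'a tree \<Rightarrow> real" where
  "expect f (Leaf a) = f a"
| "expect f (Flip s t) = (expect f s + expect f t) / 2"

text \<open>A step of a machine consumes at most one random bit, so its tree has at most one flip.
  The rules of \<open>reach\<close> cover exactly these trees.\<close>

fun shallow :: "'a tree \<Rightarrow> bool" where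
  "shallow (Leaf _) = True"
| "shallow (Flip (Leaf _) (Leaf _)) = True"
| "shallow _ = False"

lemma shallow_map [simp]: "shallow (map_tree f t) = shallow t"
  by (induction t rule: shallow.induct) auto

lemma bindt_Leaf [simp]: "bindt t Leaf = t"
  by (induction t) auto

lemma bindt_Leaf_map: "bindt t (\<lambda>a. Leaf (f a)) = map_tree f t"
  by (induction t) auto

lemma set_bindt [simp]: "set_tree (bindt t k) = (\<Union>a\<in>set_tree t. set_tree (k a))"
  by (induction t) auto

lemma expect_bindt: "expect f (bindt t k) = expect (\<lambda>a. expect f (k a)) t"
  by (induction t) auto

lemma expect_map: "expect f (map_tree g t) = expect (\<lambda>a. f (g a)) t"
  by (induction t) auto

lemma expect_mono: "(\<And>a. a \<in> set_tree t \<Longrightarrow> f a \<le> g a) \<Longrightarrow> expect f t \<le> expect g t"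
  by (induction t) (auto intro!: divide_right_mono add_mono)

lemma expect_cong: "(\<And>a. a \<in> set_tree t \<Longrightarrow> f a = g a) \<Longrightarrow> expect f t = expect g t"
  by (induction t) auto

lemma expect_affine: "expect (\<lambda>a. u * f a + v) t = u * expect f t + v"
  by (induction t) (auto simp: field_simps)

lemma expect_compl: "expect (\<lambda>a. 1 - f a) t = 1 - expect f t"
  using expect_affine[of "-1" f 1 t] by (simp add: algebra_simps)

lemma expect_nonneg: "(\<And>a. a \<in> set_tree t \<Longrightarrow> 0 \<le> f a) \<Longrightarrow> 0 \<le> expect f t"
  by (induction t) (auto simp: add_nonneg_nonneg)

text \<open>A leaf at depth \<open>d\<close> carries the positive weight \<open>1 / 2 ^ d\<close>.
  Hence an event of probability zero occurs at no leaf, which turns a statement about probabilities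
  into one about all runs.\<close>

lemma expect_pos:
  "(\<And>a. 0 \<le> f a) \<Longrightarrow> b \<in> set_tree t \<Longrightarrow> 0 < f b \<Longrightarrow> 0 < expect f t"
proof (induction t)
  case (Flip s t)
  have "0 \<le> expect f s" "0 \<le> expect f t"
    using Flip.prems(1) by (auto intro: expect_nonneg)
  moreover have "0 < expect f s \<or> 0 < expect f t"
    using Flip by auto
  ultimately show ?case by auto
qed simp

lemma expect_const [simp]: "expect (\<lambda>_. w) t = w"
  by (induction t) auto

lemma expect_rel: "rel_tree (\<lambda>a b. f a = g b) s t \<Longrightarrow> expect f s = expect g t"
  by (induction rule: tree.rel_induct) auto

lemma rel_tree_bindt:
  "rel_tree R s t \<Longrightarrow> (\<And>a b. R a b \<Longrightarrow> rel_tree P (k a) (l b)) \<Longrightarrow> rel_tree P (bindt s k) (bindt t l)"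
  by (induction rule: tree.rel_induct) auto

text \<open>\<open>ok\<close> is required only of configurations from which a step is made, not of
  the leaves. As \<open>reach_stop\<close> allows every \<open>n\<close>, the number of steps is an
  upper bound, and branches may stop at different times.\<close>

inductive reach :: "('c \<Rightarrow> 'c tree) \<Rightarrow> ('c \<Rightarrow> bool) \<Rightarrow> nat \<Rightarrow> 'c \<Rightarrow> 'c tree \<Rightarrow> bool"
  for S ok where
  reach_stop: "reach S ok n c (Leaf c)"
| reach_det: "S c = Leaf c' \<Longrightarrow> ok c \<Longrightarrow> reach S ok n c' D \<Longrightarrow> reach S ok (Suc n) c D"
| reach_flip: "S c = Flip (Leaf a) (Leaf b) \<Longrightarrow> ok c \<Longrightarrow> reach S ok n a D \<Longrightarrow> reach S ok n b E
    \<Longrightarrow> reach S ok (Suc n) c (Flip D E)"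

lemma reach_mono: "reach S ok n c D \<Longrightarrow> n \<le> m \<Longrightarrow> reach S ok m c D"
proof (induction arbitrary: m rule: reach.induct)
  case (reach_det c c' n D)
  then obtain m' where "m = Suc m'" "n \<le> m'" by (cases m) auto
  with reach_det show ?case by (auto intro!: reach.reach_det)
next
  case (reach_flip c a b n D E)
  then obtain m' where "m = Suc m'" "n \<le> m'" by (cases m) auto
  with reach_flip show ?case by (auto intro!: reach.reach_flip)
qed (rule reach_stop)

lemma reach_weaken: "reach S ok n c D \<Longrightarrow> (\<And>c. ok c \<Longrightarrow> ok' c) \<Longrightarrow> reach S ok' n c D"
  by (induction rule: reach.induct) (auto intro: reach.intros)

text \<open>The continuation depends on the label \<open>a\<close> rather than on the configuration
  \<open>\<phi> a\<close>. In simulations the label is the chosen action, and different actions may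
  lead to the same configuration.\<close>

lemma reach_bind_map:
  assumes "reach S ok n c T" "T = map_tree \<phi> t"
    and "\<And>a. a \<in> set_tree t \<Longrightarrow> reach S ok m (\<phi> a) (F a)"
  shows "reach S ok (n + m) c (bindt t F)"
  using assms
proof (induction arbitrary: t rule: reach.induct)
  case (reach_stop n c)
  then show ?case by (cases t) (auto intro: reach_mono)
next
  case (reach_det c c' n D)
  then show ?case by (auto intro: reach.reach_det)
next
  case (reach_flip c a b n D E)
  then obtain u v where "t = Flip u v" "D = map_tree \<phi> u" "E = map_tree \<phi> v"
    by (cases t) auto
  with reach_flip show ?case by (auto intro!: reach.reach_flip)
qed

lemma reach_bind:
  "reach S ok n c D \<Longrightarrow> (\<And>c'. c' \<in> set_tree D \<Longrightarrow> reach S ok m c' (E c'))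
    \<Longrightarrow> reach S ok (n + m) c (bindt D E)"
  by (rule reach_bind_map[where \<phi> = "\<lambda>c. c"]) (auto simp: tree.map_ident)

lemma reach_seq:
  "reach S ok n c (Leaf c') \<Longrightarrow> reach S ok m c' D \<Longrightarrow> reach S ok (n + m) c D"
  using reach_bind[of S ok n c "Leaf c'" m "\<lambda>_. D"] by auto

lemma shallow_cases:
  assumes "shallow t"
  obtains a where "t = Leaf a" | a b where "t = Flip (Leaf a) (Leaf b)"
  using assms by (cases t rule: shallow.cases) auto

lemma reach_one: "ok c \<Longrightarrow> shallow (S c) \<Longrightarrow> reach S ok (Suc n) c (S c)"
  by (elim shallow_cases) (auto intro: reach.intros)

text \<open>Each step of \<open>S\<close> is replaced by at most \<open>K\<close> steps of
  \<open>S'\<close>, so the delay multiplies the running time. The invariant \<open>I\<close>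
  carries what the simulation of a single step relies on.\<close>

lemma reach_lift:
  assumes "reach S ok n c D" and "I c"
    and inv: "\<And>c c'. I c \<Longrightarrow> ok c \<Longrightarrow> c' \<in> set_tree (S c) \<Longrightarrow> I c'"
    and sim: "\<And>c. I c \<Longrightarrow> ok c \<Longrightarrow> reach S' ok' K (\<phi> c) (map_tree \<phi> (S c))"
  shows "reach S' ok' (K * n) (\<phi> c) (map_tree \<phi> D)"
  using assms(1,2)
proof (induction rule: reach.induct)
  case (reach_det c c' n D)
  then have "reach S' ok' K (\<phi> c) (Leaf (\<phi> c'))" "reach S' ok' (K * n) (\<phi> c') (map_tree \<phi> D)"
    using sim[of c] inv[of c c'] by auto
  then show ?case
    by (auto dest: reach_seq)
next
  case (reach_flip c a b n D E)
  then have r: "reach S' ok' (K * n) (\<phi> a) (map_tree \<phi> D)" "reach S' ok' (K * n) (\<phi> b) (map_tree \<phi> E)"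
    using inv[of c a] inv[of c b] by auto
  \<comment> \<open>\<open>\<phi> a\<close> and \<open>\<phi> b\<close> may coincide, so Booleans
    label the two branches and select the continuation.\<close>
  have "reach S' ok' K (\<phi> c) (map_tree (\<lambda>u. if u then \<phi> a else \<phi> b) (Flip (Leaf True) (Leaf False)))"
    using sim[of c] reach_flip by auto
  from reach_bind_map[OF this refl, of "K * n" "\<lambda>u. map_tree \<phi> (if u then D else E)"] r
  show ?case by auto
qed (auto intro: reach_stop)

lemma reach_inv:
  assumes "reach S ok n c D" and "I c"
    and "\<And>c c'. I c \<Longrightarrow> c' \<in> set_tree (S c) \<Longrightarrow> I c'" and "c' \<in> set_tree D"
  shows "I c'"
  using assms(1,2,4)
  by (induction rule: reach.induct) (use assms(3) in fastforce)+

primrec unfold :: "('c \<Rightarrow> 'c tree) \<Rightarrow> nat \<Rightarrow> 'c \<Rightarrow> 'c tree" where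
  "unfold S 0 c = Leaf c"
| "unfold S (Suc n) c = bindt (S c) (unfold S n)"

lemma unfold_halted: "S c = Leaf c \<Longrightarrow> unfold S n c = Leaf c"
  by (induction n) auto

text \<open>Halted leaves are fixed by \<open>S\<close>, so the steps left over in the bound
  \<open>n\<close> do not change the tree.\<close>

lemma reach_unfold_eq:
  "reach S ok n c D \<Longrightarrow> (\<And>l. l \<in> set_tree D \<Longrightarrow> S l = Leaf l) \<Longrightarrow> unfold S n c = D"
  by (induction rule: reach.induct) (auto simp: unfold_halted)

lemma reach_unfold: "(\<And>c. shallow (S c)) \<Longrightarrow> reach S (\<lambda>_. True) n c (unfold S n c)"
proof (induction n arbitrary: c)
  case (Suc n)
  from Suc.prems[of c] show ?case
    by (elim shallow_cases) (use Suc in \<open>auto intro: reach.intros\<close>)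
qed (simp add: reach_stop)

section \<open>Runs of the concrete machines as coin trees\<close>

definition cur_coin :: "rmachine \<Rightarrow> bool list \<Rightarrow> config \<Rightarrow> bool" where
  "cur_coin M x cf = coin M (cstate cf) (input_sym x (ihead cf))
     (read_cell (wtape cf) (whead cf)) (read_cell (ctape cf) (chead cf))"

text \<open>\<open>rhead\<close> is reset to 0 because the tree branches over the random bits: once
  they are represented by branches, the position in the random string carries no
  information.\<close>

definition apply_act ::
  "bool list \<Rightarrow> config \<Rightarrow> nat \<times> bool \<times> bool \<times> move \<times> move \<times> move \<Rightarrow> config" where
  "apply_act x cf = (\<lambda>(q', ww, cw, mi, mw, mc).
     \<lparr> cstate = q',
       ihead = do_move mi (ihead cf) (length x + 1),
       wtape = (wtape cf)[whead cf := ww],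
       whead = do_move mw (whead cf) (length (wtape cf) - 1),
       ctape = (ctape cf)[chead cf := cw],
       chead = do_move mc (chead cf) (length (ctape cf) - 1),
       rhead = 0 \<rparr>)"

definition cnext :: "rmachine \<Rightarrow> bool list \<Rightarrow> config \<Rightarrow> bool \<Rightarrow> config" where
  "cnext M x cf rb = apply_act x cf (delta M (cstate cf) (input_sym x (ihead cf))
     (read_cell (wtape cf) (whead cf)) (read_cell (ctape cf) (chead cf)) rb)"

definition cstep :: "rmachine \<Rightarrow> bool list \<Rightarrow> config \<Rightarrow> config tree" where
  "cstep M x cf = (if halted M cf then Leaf cf
     else if cur_coin M x cf then Flip (Leaf (cnext M x cf True)) (Leaf (cnext M x cf False))
     else Leaf (cnext M x cf False))"

lemma shallow_cstep [simp]: "shallow (cstep M x cf)"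
  by (simp add: cstep_def)

abbreviation strip :: "config \<Rightarrow> config" where
  "strip cf \<equiv> cf\<lparr>rhead := 0\<rparr>"

lemma strip_simps [simp]:
  "cur_coin M x (strip cf) = cur_coin M x cf"
  "cnext M x (strip cf) rb = cnext M x cf rb"
  "halted M (strip cf) = halted M cf"
  "strip (cnext M x cf rb) = cnext M x cf rb"
  by (auto simp: cur_coin_def cnext_def halted_def apply_act_def split: prod.splits)

lemma step_eq_cnext:
  "step M x r cf = (if halted M cf then cf else
     (cnext M x cf (cur_coin M x cf \<and> read_cell r (rhead cf)))
       \<lparr>rhead := (if cur_coin M x cf then rhead cf + 1 else rhead cf)\<rparr>)"
  by (auto simp: step_def cnext_def cur_coin_def apply_act_def Let_def split: prod.splits)

section \<open>Counting random strings by means of coin trees\<close>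

lemma card_split_first:
  "card {bs :: bool list. length bs = Suc l \<and> Q bs} =
   card {bs. length bs = l \<and> Q (True # bs)} + card {bs. length bs = l \<and> Q (False # bs)}"
proof -
  have fin: "finite {bs :: bool list. length bs = l \<and> R bs}" for R
    by (rule finite_subset[OF _ finite_lists_length_eq[of UNIV l]]) auto
  have "{bs :: bool list. length bs = Suc l \<and> Q bs} =
     Cons True ` {bs. length bs = l \<and> Q (True # bs)} \<union> Cons False ` {bs. length bs = l \<and> Q (False # bs)}"
    (is "?A = ?B")
  proof
    show "?A \<subseteq> ?B"
    proof
      fix bs assume "bs \<in> ?A"
      then show "bs \<in> ?B"
        by (cases bs; cases "hd bs") auto
    qed
  qed auto
  moreover have "card (Cons b ` {bs. length bs = l \<and> Q (b # bs)}) = card {bs. length bs = l \<and> Q (b # bs)}" for b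
    by (rule card_image) auto
  moreover have "Cons True ` A \<inter> Cons False ` B = {}" for A B :: "bool list set"
    by auto
  ultimately show ?thesis
    by (simp only: card_Un_disjoint fin finite_imageI)
qed

lemma card_bool_lists: "card {bs :: bool list. length bs = l} = 2 ^ l"
  using card_lists_length_eq[of "UNIV :: bool set" l] by simp

text \<open>A coin step fixes the next of the \<open>l\<close> unread bits and so halves the
  strings, just as a flip averages its subtrees. The consumed prefix \<open>pre\<close> changes
  along the induction; \<open>t \<le> l\<close> guarantees that a step never reads beyond the end of
  the random string.\<close>

lemma card_runs:
  assumes "t \<le> l" "length pre = rhead cf"
  shows "real (card {bs. length bs = l \<and> P (strip ((step M x (pre @ bs) ^^ t) cf))}) =
     2 ^ l * expect (\<lambda>c. of_bool (P c)) (unfold (cstep M x) t (strip cf))"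
  using assms
proof (induction t arbitrary: l pre cf)
  case 0
  then show ?case using card_bool_lists[of l] by auto
next
  case (Suc t)
  have unf: "(step M x r ^^ Suc t) cf = (step M x r ^^ t) (step M x r cf)" for r
    by (simp add: funpow_swap1)
  consider "halted M cf" | "\<not> halted M cf" "\<not> cur_coin M x cf" | "\<not> halted M cf" "cur_coin M x cf"
    by blast
  then show ?case
  proof cases
    case 1
    then have s: "step M x r cf = cf" for r by (simp add: step_def)
    have "(step M x r ^^ n) cf = cf" for r n
      by (induction n) (auto simp: s)
    then show ?thesis
      using 1 card_bool_lists[of l] by (simp add: unf s cstep_def unfold_halted del: funpow.simps)
  next
    case 2
    then have s: "step M x r cf = (cnext M x cf False)\<lparr>rhead := rhead cf\<rparr>" for r
      by (simp add: step_eq_cnext)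
    show ?thesis
      using 2 Suc.prems Suc.IH[of l pre "(cnext M x cf False)\<lparr>rhead := rhead cf\<rparr>"]
      by (simp add: unf s cstep_def del: funpow.simps)
  next
    case 3
    then obtain l' where l: "l = Suc l'" "t \<le> l'" using Suc.prems by (cases l) auto
    have s: "step M x (pre @ b # bs) cf = (cnext M x cf b)\<lparr>rhead := rhead cf + 1\<rparr>" for b bs
      using 3 Suc.prems by (simp add: step_eq_cnext read_cell_def nth_append)
    have IH: "real (card {bs. length bs = l' \<and> P (strip ((step M x (pre @ b # bs) ^^ t) ((cnext M x cf b)\<lparr>rhead := rhead cf + 1\<rparr>)))}) =
        2 ^ l' * expect (\<lambda>c. of_bool (P c)) (unfold (cstep M x) t (cnext M x cf b))" for b
      using Suc.IH[of l' "pre @ [b]" "(cnext M x cf b)\<lparr>rhead := rhead cf + 1\<rparr>"] l Suc.prems by simp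
    have c: "cstep M x (strip cf) = Flip (Leaf (cnext M x cf True)) (Leaf (cnext M x cf False))"
      using 3 by (simp add: cstep_def)
    show ?thesis
      using IH[of True] IH[of False]
      by (simp add: unf card_split_first l s c algebra_simps del: funpow.simps)
  qed
qed

lemma prob_rand_run:
  assumes "t \<le> m"
  shows "prob_rand m (\<lambda>r. P (strip (run M x s \<tau> r t))) =
    expect (\<lambda>c. of_bool (P c)) (unfold (cstep M x) t (init_config M s \<tau>))"
  using card_runs[of t m "[]" "init_config M s \<tau>" P M x] assms
  by (simp add: prob_rand_def run_def init_config_def)

text \<open>A bit beyond the end of \<open>r\<close> is read as \<open>False\<close>, which is one
  of the two branches, so strings of every length follow the tree.\<close>

lemma run_in_unfold:
  "strip ((step M x r ^^ t) cf) \<in> set_tree (unfold (cstep M x) t (strip cf))"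
proof (induction t arbitrary: cf)
  case (Suc t)
  have "(step M x r ^^ Suc t) cf = (step M x r ^^ t) (step M x r cf)"
    by (simp add: funpow_swap1)
  moreover have "strip (step M x r cf) \<in> set_tree (cstep M x (strip cf))"
    by (simp add: step_eq_cnext cstep_def)
       (metis strip_simps(4))
  ultimately show ?case
    using Suc[of "step M x r cf"] by (auto simp del: funpow.simps)
qed simp

lemma halts_within_iff: "halts_within M x s \<tau> r T \<longleftrightarrow> halted M (run M x s \<tau> r T)"
proof
  assume "halts_within M x s \<tau> r T"
  then obtain t where t: "t \<le> T" "halted M (run M x s \<tau> r t)"
    by (auto simp: halts_within_def)
  have "halted M (run M x s \<tau> r (t + d))" for d
    by (induction d) (use t in \<open>auto simp: run_def step_def\<close>)
  from this[of "T - t"] t show "halted M (run M x s \<tau> r T)" by simp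
qed (auto simp: halts_within_def)

text \<open>From left to right, the probability of not having halted is zero, so by
  \<open>expect_pos\<close> no leaf is unhalted. From right to left, every run ends at some
  leaf.\<close>

lemma halts_within_all_iff:
  assumes "T \<le> m"
  shows "(\<forall>r. length r = m \<longrightarrow> halts_within M x s \<tau> r T) \<longleftrightarrow>
    (\<forall>l\<in>set_tree (unfold (cstep M x) T (init_config M s \<tau>)). halted M l)"
proof
  assume "\<forall>r. length r = m \<longrightarrow> halts_within M x s \<tau> r T"
  then have "{r. length r = m \<and> \<not> halted M (strip (run M x s \<tau> r T))} = {}"
    by (auto simp: halts_within_iff)
  then have "prob_rand m (\<lambda>r. \<not> halted M (strip (run M x s \<tau> r T))) = 0"
    unfolding prob_rand_def by (simp only: card.empty)
  then have "expect (\<lambda>c. of_bool (\<not> halted M c)) (unfold (cstep M x) T (init_config M s \<tau>)) = 0"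
    using prob_rand_run[OF assms, of "\<lambda>c. \<not> halted M c"] by simp
  then show "\<forall>l\<in>set_tree (unfold (cstep M x) T (init_config M s \<tau>)). halted M l"
    using expect_pos[of "\<lambda>c. of_bool (\<not> halted M c)"] by fastforce
next
  assume "\<forall>l\<in>set_tree (unfold (cstep M x) T (init_config M s \<tau>)). halted M l"
  moreover have "strip (run M x s \<tau> r T) \<in> set_tree (unfold (cstep M x) T (init_config M s \<tau>))" for r
    using run_in_unfold[where M = M and x = x and r = r and t = T and cf = "init_config M s \<tau>"] by (simp add: run_def init_config_def)
  ultimately show "\<forall>r. length r = m \<longrightarrow> halts_within M x s \<tau> r T"
    by (metis halts_within_iff strip_simps(3))
qed

section \<open>Two-tape machines with unbounded tapes\<close>

type_synonym ('q, 'g) action = "'q \<times> 'g \<times> bool \<times> move \<times> move \<times> move"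

text \<open>Coins are part of \<open>act\<close>, which returns a tree of actions. The first tape
  has an arbitrary alphabet and is the one that constructions reshape; the second is binary and
  stands for the catalytic tape or stays blank.\<close>

record ('q, 'g) mach =
  ini :: 'q
  out :: "'q \<Rightarrow> bool option"
  act :: "'q \<Rightarrow> bool option \<Rightarrow> 'g \<Rightarrow> bool \<Rightarrow> ('q, 'g) action tree"

datatype ('q, 'g) cfg =
  Cfg (st: 'q) (ip: nat) (tp: "nat \<Rightarrow> 'g") (hd1: nat) (aux: "nat \<Rightarrow> bool") (hd2: nat)

lemma UNIV_move: "(UNIV :: move set) = {MLeft, MStay, MRight}"
  using move.exhaust by blast

instance move :: finite
  by standard (simp add: UNIV_move)

fun mv :: "move \<Rightarrow> nat \<Rightarrow> nat" where
  "mv MLeft h = h - 1"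
| "mv MStay h = h"
| "mv MRight h = Suc h"

fun perform :: "bool list \<Rightarrow> ('q, 'g) cfg \<Rightarrow> ('p, 'g) action \<Rightarrow> ('p, 'g) cfg" where
  "perform x (Cfg q i f h g j) (q', a, b, mi, m1, m2) =
     Cfg q' (do_move mi i (length x + 1)) (f(h := a)) (mv m1 h) (g(j := b)) (mv m2 j)"

fun mstep :: "('q, 'g) mach \<Rightarrow> bool list \<Rightarrow> ('q, 'g) cfg \<Rightarrow> ('q, 'g) cfg tree" where
  "mstep M x (Cfg q i f h g j) = (if out M q \<noteq> None then Leaf (Cfg q i f h g j)
     else map_tree (perform x (Cfg q i f h g j)) (act M q (input_sym x i) (f h) (g j)))"

declare mstep.simps [simp del]

lemma reach_act:
  assumes "out M q = None"
    and "ok (Cfg q i f h g j)"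
    and "map_tree (perform x (Cfg q i f h g j)) (act M q (input_sym x i) (f h) (g j)) = Leaf c'"
    and "reach (mstep M x) ok n c' D"
  shows "reach (mstep M x) ok (Suc n) (Cfg q i f h g j) D"
  using assms by (auto intro!: reach_det simp: mstep.simps)

lemmas reach_act1 = reach_act[OF _ _ _ reach_stop]

lemma do_move_simps [simp]:
  "do_move MLeft h b = h - 1" "do_move MStay h b = h" "do_move MRight h b = min (Suc h) b"
  by (auto simp: do_move_def)

text \<open>The state types of the constructions contain numbers and lists and are infinite, so
  finiteness is expressed by finite sets closed under transitions. The closure concerns only states
  that have not halted.\<close>

definition fin_mach :: "('q, 'g) mach \<Rightarrow> 'q set \<Rightarrow> 'g set \<Rightarrow> bool" where
  "fin_mach M Q G \<longleftrightarrow> finite Q \<and> finite G \<and> ini M \<in> Q \<and>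
     (\<forall>q\<in>Q. \<forall>a. \<forall>g\<in>G. \<forall>b. out M q = None \<longrightarrow> shallow (act M q a g b) \<and>
        (\<forall>(q', g', _)\<in>set_tree (act M q a g b). q' \<in> Q \<and> g' \<in> G))"

lemma fin_machD:
  assumes "fin_mach M Q G"
  shows "finite Q" "finite G" "ini M \<in> Q"
    and "q \<in> Q \<Longrightarrow> g \<in> G \<Longrightarrow> out M q = None \<Longrightarrow> shallow (act M q a g b)"
    and "q \<in> Q \<Longrightarrow> g \<in> G \<Longrightarrow> out M q = None \<Longrightarrow> (q', g', r) \<in> set_tree (act M q a g b) \<Longrightarrow> q' \<in> Q \<and> g' \<in> G"
proof -
  show "finite Q" "finite G" "ini M \<in> Q"
    using assms by (auto simp: fin_mach_def)
  assume *: "q \<in> Q" "g \<in> G" "out M q = None"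
  then show "shallow (act M q a g b)"
    using assms by (auto simp: fin_mach_def)
  assume "(q', g', r) \<in> set_tree (act M q a g b)"
  moreover have "\<forall>(q', g', _)\<in>set_tree (act M q a g b). q' \<in> Q \<and> g' \<in> G"
    using assms * by (auto simp: fin_mach_def)
  ultimately show "q' \<in> Q \<and> g' \<in> G" by blast
qed

definition good_cfg :: "'q set \<Rightarrow> 'g set \<Rightarrow> ('q, 'g) cfg \<Rightarrow> bool" where
  "good_cfg Q G c \<longleftrightarrow> st c \<in> Q \<and> (\<forall>p. tp c p \<in> G)"

lemma good_cfg_mstep:
  assumes "fin_mach M Q G" "good_cfg Q G c" "c' \<in> set_tree (mstep M x c)"
  shows "good_cfg Q G c'"
proof (cases c)
  case c: (Cfg q i f h g j)
  show ?thesis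
  proof (cases "out M q")
    case None
    then obtain r where r: "r \<in> set_tree (act M q (input_sym x i) (f h) (g j))" "c' = perform x c r"
      using assms(3) c by (auto simp: mstep.simps tree.set_map)
    obtain q' g' s where "r = (q', g', s)" by (cases r)
    moreover from this have "q' \<in> Q \<and> g' \<in> G"
      using fin_machD(5)[OF assms(1), of q "f h"] None r(1) assms(2) c by (auto simp: good_cfg_def)
    ultimately show ?thesis
      using r(2) assms(2) c by (cases s) (auto simp: good_cfg_def)
  qed (use assms c in \<open>auto simp: mstep.simps\<close>)
qed

lemma shallow_mstep: "fin_mach M Q G \<Longrightarrow> good_cfg Q G c \<Longrightarrow> shallow (mstep M x c)"
  by (cases c) (auto simp: mstep.simps good_cfg_def fin_machD)

text \<open>Only transitions that read \<open>False\<close> on the second tape are constrained: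
  started on a blank second tape, the machine stays on its first cell and never writes a
  one.\<close>

definition single :: "('q, 'g) mach \<Rightarrow> bool" where
  "single M \<longleftrightarrow> (\<forall>q a g. \<forall>(q', g', b', mi, m1, m2)\<in>set_tree (act M q a g False). b' = False \<and> m2 = MStay)"

lemma singleD:
  assumes "single M" "(q', g', b', mi, m1, m2) \<in> set_tree (act M q a g False)"
  shows "\<not> b' \<and> m2 = MStay"
  using assms(1)[unfolded single_def, rule_format, OF assms(2)] by simp

lemma singleI:
  assumes "\<And>q a g q' g' b' mi m1 m2. (q', g', b', mi, m1, m2) \<in> set_tree (act M q a g False)
    \<Longrightarrow> \<not> b' \<and> m2 = MStay"
  shows "single M"
  unfolding single_def
proof (intro allI ballI)
  fix q a g r
  assume r: "r \<in> set_tree (act M q a g False)"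
  obtain q' g' b' mi m1 m2 where "r = (q', g', b', mi, m1, m2)" by (cases r)
  with assms[of q' g' b' mi m1 m2 q a g] r
  show "case r of (q', g', b', mi, m1, m2) \<Rightarrow> b' = False \<and> m2 = MStay" by simp
qed

lemma mv_le: "mv m h \<le> Suc h"
  by (cases m) auto

lemma hd_mstep:
  "c' \<in> set_tree (mstep M x c) \<Longrightarrow> hd1 c' \<le> Suc (hd1 c) \<and> hd2 c' \<le> Suc (hd2 c)"
  by (cases c) (auto simp: mstep.simps tree.set_map mv_le split: if_splits)

text \<open>A head advances by at most one cell per step, so a time bound is also a space bound.
  Configurations that still make a step are strictly below \<open>H\<close>; a leaf may be at
  \<open>H\<close>.\<close>

lemma reach_heads:
  "reach (mstep M x) ok n c D \<Longrightarrow> hd1 c + n \<le> H \<Longrightarrow> hd2 c + n \<le> H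
    \<Longrightarrow> reach (mstep M x) (\<lambda>c. ok c \<and> hd1 c < H \<and> hd2 c < H) n c D \<and>
        (\<forall>l\<in>set_tree D. hd1 l \<le> H \<and> hd2 l \<le> H)"
proof (induction rule: reach.induct)
  case (reach_det c c' n D)
  have "hd1 c' \<le> Suc (hd1 c) \<and> hd2 c' \<le> Suc (hd2 c)"
    by (rule hd_mstep[where M = M and x = x]) (simp add: reach_det.hyps)
  with reach_det show ?case by (auto intro!: reach.reach_det[of "mstep M x", OF reach_det.hyps(1)])
next
  case (reach_flip c a b n D E)
  have "hd1 a \<le> Suc (hd1 c) \<and> hd2 a \<le> Suc (hd2 c)" "hd1 b \<le> Suc (hd1 c) \<and> hd2 b \<le> Suc (hd2 c)"
    by (rule hd_mstep[where M = M and x = x], simp add: reach_flip.hyps)+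
  with reach_flip show ?case by (auto intro!: reach.reach_flip[of "mstep M x", OF reach_flip.hyps(1)])
qed (auto intro: reach_stop)

lemma ip_mstep:
  "ip c \<le> length x + 1 \<Longrightarrow> c' \<in> set_tree (mstep M x c) \<Longrightarrow> ip c' \<le> length x + 1"
  by (cases c) (auto simp: mstep.simps tree.set_map do_move_def split: if_splits move.splits)

definition solves ::
  "('q, 'g) mach \<Rightarrow> (nat \<Rightarrow> nat \<Rightarrow> 'g) \<Rightarrow> (nat \<Rightarrow> nat) \<Rightarrow> bool list set \<Rightarrow> real \<Rightarrow> bool" where
  "solves M f0 T L w \<longleftrightarrow> (\<forall>x. \<exists>D.
     reach (mstep M x) (\<lambda>_. True) (T (length x)) (Cfg (ini M) 0 (f0 (length x)) 0 (\<lambda>_. False) 0) D \<and>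
     (\<forall>l\<in>set_tree D. out M (st l) \<noteq> None) \<and>
     expect (\<lambda>l. of_bool (out M (st l) \<noteq> Some (x \<in> L))) D \<le> w)"

section \<open>Polynomial bounds\<close>

definition poly :: "(nat \<Rightarrow> nat) \<Rightarrow> bool" where
  "poly T \<longleftrightarrow> (\<exists>k. \<forall>n. T n \<le> (n + 2) ^ k)"

lemma poly_le: "poly T \<Longrightarrow> (\<And>n. U n \<le> T n) \<Longrightarrow> poly U"
  unfolding poly_def using le_trans by blast

lemma poly_mult: "poly T \<Longrightarrow> poly U \<Longrightarrow> poly (\<lambda>n. T n * U n)"
  unfolding poly_def
proof (elim exE)
  fix k l assume "\<forall>n. T n \<le> (n + 2) ^ k" "\<forall>n. U n \<le> (n + 2) ^ l"
  then show "\<exists>k. \<forall>n. T n * U n \<le> (n + 2) ^ k"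
    by (auto intro!: exI[of _ "k + l"] mult_le_mono simp: power_add)
qed

lemma poly_const: "poly (\<lambda>_. a)"
  unfolding poly_def
proof (intro exI allI)
  fix n
  have "a \<le> 2 ^ a" by (simp add: less_imp_le)
  also have "\<dots> \<le> (n + 2) ^ a" by (rule power_mono) auto
  finally show "a \<le> (n + 2) ^ a" .
qed

lemma poly_id: "poly (\<lambda>n. n)"
  unfolding poly_def by (rule exI[of _ 1]) simp

text \<open>\<open>T + U \<le> (1 + T) * (1 + U)\<close> reduces sums to products. Adding 1 raises
  the exponent by one, since the base \<open>n + 2\<close> is at least 2.\<close>

lemma poly_add:
  assumes "poly T" "poly U"
  shows "poly (\<lambda>n. T n + U n)"
proof (rule poly_le)
  have "poly (\<lambda>n. 1 + T n)" if "poly T" for T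
  proof -
    obtain k where k: "\<And>n. T n \<le> (n + 2) ^ k" using \<open>poly T\<close> by (auto simp: poly_def)
    have "1 + T n \<le> (n + 2) ^ Suc k" for n
    proof -
      have "1 \<le> (n + 2) ^ k" by simp
      then have "1 + T n \<le> 2 * (n + 2) ^ k" using k[of n] by linarith
      also have "\<dots> \<le> (n + 2) ^ Suc k" by simp
      finally show ?thesis .
    qed
    then show ?thesis unfolding poly_def by blast
  qed
  from poly_mult[OF this[OF assms(1)] this[OF assms(2)]]
  show "poly (\<lambda>n. (1 + T n) * (1 + U n))" .
qed simp

lemma poly_power: "poly T \<Longrightarrow> poly (\<lambda>n. T n ^ k)"
proof (induction k)
  case 0
  show ?case by (simp only: power_0) (rule poly_const)
next
  case (Suc k)
  show ?case unfolding power_Suc by (rule poly_mult[OF Suc.prems Suc.IH[OF Suc.prems]])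
qed

lemma poly_Suc: "poly T \<Longrightarrow> poly (\<lambda>n. Suc (T n))"
  unfolding Suc_eq_plus1 by (rule poly_add, assumption, rule poly_const)

lemmas poly_intros = poly_add poly_mult poly_const poly_id poly_power poly_Suc

section \<open>Binary encoding of the first tape\<close>

text \<open>One simulated step reads a block of \<open>D\<close> bits to the right, performs the
  transition on its last bit, writes the remaining bits backwards and moves the head by one block.
  The states hold the bits read so far, the bits still to be written and the number of moves
  left.\<close>

datatype 'q enc_st = ERd 'q "bool list" | EWr 'q "bool list" move | EMv 'q move nat

fun enc_act ::
  "('q, 'g) mach \<Rightarrow> nat \<Rightarrow> ('g \<Rightarrow> bool list) \<Rightarrow> (bool list \<Rightarrow> 'g) \<Rightarrow>
   'q enc_st \<Rightarrow> bool option \<Rightarrow> bool \<Rightarrow> bool \<Rightarrow> ('q enc_st, bool) action tree" where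
  "enc_act M D e d (ERd q bs) a w b =
     (if Suc (length bs) < D then Leaf (ERd q (bs @ [w]), w, b, MStay, MRight, MStay)
      else map_tree (\<lambda>(q', g', b', mi, m1, m2). (EWr q' (butlast (e g')) m1, last (e g'), b', mi, MLeft, m2))
             (act M q a (d (bs @ [w])) b))"
| "enc_act M D e d (EWr q bs m) a w b =
     Leaf (if length bs \<le> 1 then EMv q m D else EWr q (butlast bs) m, last bs, b, MStay,
           if length bs \<le> 1 then MStay else MLeft, MStay)"
| "enc_act M D e d (EMv q m n) a w b =
     Leaf (if n \<le> 1 then ERd q [] else EMv q m (n - 1), w, b, MStay, m, MStay)"

text \<open>Halting is visible only with an empty buffer, that is, at the start of a block, where
  the configuration is the code of a simulated one.\<close>

fun enc_out :: "('q, 'g) mach \<Rightarrow> 'q enc_st \<Rightarrow> bool option" where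
  "enc_out M (ERd q []) = out M q"
| "enc_out M _ = None"

text \<open>The tape in the middle of writing the word \<open>w\<close> at address \<open>a\<close>
  from right to left: offsets from \<open>r\<close> on are done.\<close>

definition patch :: "(nat \<Rightarrow> bool) \<Rightarrow> nat \<Rightarrow> nat \<Rightarrow> bool list \<Rightarrow> nat \<Rightarrow> bool" where
  "patch T a r w p = (if a + r \<le> p \<and> p < a + length w then w ! (p - a) else T p)"

lemma patch_Suc: "r < length w \<Longrightarrow> (patch T a (Suc r) w)(a + r := w ! r) = patch T a r w"
  by (auto simp: patch_def fun_eq_iff)

text \<open>\<open>D \<ge> 2\<close> keeps \<open>butlast (e g')\<close> nonempty, so that the
  writing phase has a bit to write. The code of the blank consists of zeros so that the empty binary
  tape encodes the empty tape.\<close>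

locale encoding =
  fixes M :: "('q, 'g) mach" and Q :: "'q set" and G :: "'g set" and blank :: 'g
    and D :: nat and e :: "'g \<Rightarrow> bool list"
  assumes fin: "fin_mach M Q G" and blank: "blank \<in> G" and D: "2 \<le> D"
    and len: "g \<in> G \<Longrightarrow> length (e g) = D" and inj: "inj_on e G"
    and e_blank: "e blank = replicate D False"
begin

text \<open>Words that are no codes decode to the blank. Thus \<open>emach\<close> stays in a finite
  state set on every binary tape content, not only on codes.\<close>

definition dec :: "bool list \<Rightarrow> 'g" where
  "dec bs = (if bs \<in> e ` G then inv_into G e bs else blank)"

lemma dec_in: "dec bs \<in> G"
  by (auto simp: dec_def blank intro: inv_into_into)

lemma dec_e: "g \<in> G \<Longrightarrow> dec (e g) = g"
  using inj by (auto simp: dec_def)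

definition emach :: "('q enc_st, bool) mach" where
  "emach = \<lparr>ini = ERd (ini M) [], out = enc_out M, act = enc_act M D e dec\<rparr>"

definition enc_tape :: "(nat \<Rightarrow> 'g) \<Rightarrow> nat \<Rightarrow> bool" where
  "enc_tape f p = e (f (p div D)) ! (p mod D)"

fun enc_cfg :: "('q, 'g) cfg \<Rightarrow> ('q enc_st, bool) cfg" where
  "enc_cfg (Cfg q i f h g j) = Cfg (ERd q []) i (enc_tape f) (D * h) g j"

lemma emach_simps [simp]:
  "ini emach = ERd (ini M) []" "out emach = enc_out M" "act emach = enc_act M D e dec"
  by (auto simp: emach_def)

lemma enc_tape_block: "r < D \<Longrightarrow> enc_tape f (D * h + r) = e (f h) ! r"
  using D by (simp add: enc_tape_def)

lemma read_block:
  assumes "out M q = None" "\<And>p. f p \<in> G" "D * (h + 1) \<le> B" "r < D"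
  shows "reach (mstep emach x) (\<lambda>c. hd1 c \<le> B) r
    (Cfg (ERd q []) i (enc_tape f) (D * h) g j)
    (Leaf (Cfg (ERd q (take r (e (f h)))) i (enc_tape f) (D * h + r) g j))"
  using assms(4)
proof (induction r)
  case (Suc r)
  have l: "length (e (f h)) = D" using assms(2) len by blast
  have "enc_out M (ERd q (take r (e (f h)))) = None"
    using assms(1) by (cases "take r (e (f h))") auto
  moreover have "take (Suc r) (e (f h)) = take r (e (f h)) @ [enc_tape f (D * h + r)]"
    using Suc.prems l by (simp add: enc_tape_block take_Suc_conv_app_nth)
  ultimately have "reach (mstep emach x) (\<lambda>c. hd1 c \<le> B) 1
      (Cfg (ERd q (take r (e (f h)))) i (enc_tape f) (D * h + r) g j)
      (Leaf (Cfg (ERd q (take (Suc r) (e (f h)))) i (enc_tape f) (D * h + Suc r) g j))"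
    unfolding One_nat_def
    by (intro reach_act1) (use Suc.prems assms(3) in \<open>simp_all add: l\<close>)
  from reach_seq[OF Suc.IH this] Suc.prems show ?case by simp
qed (simp add: reach_stop)

lemma write_block:
  assumes w: "length w = D" and "D * (h + 1) \<le> B" "0 < r" "r \<le> D"
  shows "reach (mstep emach x) (\<lambda>c. hd1 c \<le> B) r
    (Cfg (EWr q (take r w) m) i (patch T (D * h) r w) (D * h + r - 1) g j)
    (Leaf (Cfg (EMv q m D) i (patch T (D * h) 0 w) (D * h) g j))"
  using assms(3,4)
proof (induction r)
  case (Suc r)
  have l: "last (take (Suc r) w) = w ! r"
    using Suc.prems assms(1) by (simp add: take_Suc_conv_app_nth)
  have b: "butlast (take (Suc r) w) = take r w"
    using Suc.prems assms(1) by (simp add: butlast_take)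
  have tape: "(patch T (D * h) (Suc r) w)(D * h + r := w ! r) = patch T (D * h) r w"
    by (rule patch_Suc) (use Suc.prems w in simp)
  have len: "length (take (Suc r) w) = Suc r" using Suc.prems w by simp
  have act: "act emach (EWr q (take (Suc r) w) m) a v c =
     Leaf (if r = 0 then EMv q m D else EWr q (take r w) m, w ! r, c, MStay, if r = 0 then MStay else MLeft, MStay)" for a v c
    using l b len by (simp del: length_take take_Suc)
  show ?case
  proof (cases "r = 0")
    case True
    then show ?thesis
      by (intro reach_act1) (use assms(2) tape act True in \<open>simp_all del: emach_simps(3)\<close>)
  next
    case False
    show ?thesis
      by (rule reach_act[OF _ _ _ Suc.IH])
         (use False Suc.prems assms(2) tape in \<open>simp_all add: act del: emach_simps(3)\<close>)
  qed
qed simp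

lemma move_block:
  assumes "0 < n" "p + (if m = MRight then n else 0) \<le> B"
  shows "reach (mstep emach x) (\<lambda>c. hd1 c \<le> B) n (Cfg (EMv q m n) i f p g j)
    (Leaf (Cfg (ERd q []) i f ((mv m ^^ n) p) g j))"
  using assms
proof (induction n arbitrary: p)
  case (Suc n)
  have fw: "(mv m ^^ Suc n) p = (mv m ^^ n) (mv m p)" by (simp add: funpow_swap1)
  have p: "mv m p + (if m = MRight then n else 0) \<le> B"
    using Suc.prems by (cases m) auto
  show ?case
  proof (cases "n = 0")
    case True
    then show ?thesis
      by (intro reach_act1) (use Suc.prems in auto)
  next
    case False
    then show ?thesis
      unfolding fw
      by (intro reach_act[OF _ _ _ Suc.IH[OF _ p]]) (use Suc.prems in auto)
  qed
qed simp

text \<open>At block 0 a left move of \<open>D\<close> cells stays at 0, in accordance with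
  truncated subtraction: \<open>D * h - D = D * (h - 1)\<close>.\<close>

lemma mv_power: "(mv m ^^ D) (D * h) = D * mv m h"
proof (cases m)
  case MLeft
  have "(mv MLeft ^^ n) p = p - n" for n p by (induction n) auto
  with MLeft show ?thesis by (simp add: diff_mult_distrib2)
next
  case MStay
  have "(mv MStay ^^ n) p = p" for n p by (induction n) auto
  with MStay show ?thesis by simp
next
  case MRight
  have "(mv MRight ^^ n) p = p + n" for n p by (induction n) auto
  with MRight show ?thesis by simp
qed

lemma enc_tape_update:
  assumes "g' \<in> G"
  shows "patch (enc_tape f) (D * h) 0 (e g') = enc_tape (f(h := g'))"
proof
  fix p
  have "D * h \<le> p \<and> p < D * h + D \<longleftrightarrow> p div D = h"
    using D by (metis Suc_1 add.commute div_nat_eqI dividend_less_times_div less_le_trans mult.commute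
        mult_Suc_right times_div_less_eq_dividend zero_less_Suc)
  moreover have "p mod D = p - D * h" if "p div D = h"
    using that by (auto simp: minus_mult_div_eq_mod)
  ultimately show "patch (enc_tape f) (D * h) 0 (e g') p = enc_tape (f(h := g')) p"
    using len[OF assms] by (auto simp: enc_tape_def patch_def)
qed

lemma enc_after_transition:
  assumes "g' \<in> G" "D * (h + 1) \<le> B"
  shows "reach (mstep emach x) (\<lambda>c. hd1 c \<le> B) (2 * D)
     (Cfg (EWr q' (butlast (e g')) m) i ((enc_tape f)(D * h + (D - 1) := last (e g'))) (D * h + (D - 1) - 1) g j)
     (Leaf (Cfg (ERd q' []) i (enc_tape (f(h := g'))) (D * mv m h) g j))"
proof -
  have l: "length (e g') = D" using assms len by blast
  have ne: "e g' \<noteq> []" using l D by auto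
  have "last (e g') = e g' ! (D - 1)" using ne l by (simp add: last_conv_nth)
  then have t: "(enc_tape f)(D * h + (D - 1) := last (e g')) = patch (enc_tape f) (D * h) (D - 1) (e g')"
    using patch_Suc[of "D - 1" "e g'" "enc_tape f" "D * h"] D l by (auto simp: patch_def fun_eq_iff)
  have "butlast (e g') = take (D - 1) (e g')" using l by (simp add: butlast_conv_take)
  then have 1: "reach (mstep emach x) (\<lambda>c. hd1 c \<le> B) (D - 1)
     (Cfg (EWr q' (butlast (e g')) m) i ((enc_tape f)(D * h + (D - 1) := last (e g'))) (D * h + (D - 1) - 1) g j)
     (Leaf (Cfg (EMv q' m D) i (enc_tape (f(h := g'))) (D * h) g j))"
    using write_block[OF l assms(2), of "D - 1" x q' m i "enc_tape f" g j] D
    unfolding t enc_tape_update[OF assms(1)] by simp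
  have 2: "reach (mstep emach x) (\<lambda>c. hd1 c \<le> B) D (Cfg (EMv q' m D) i (enc_tape (f(h := g'))) (D * h) g j)
     (Leaf (Cfg (ERd q' []) i (enc_tape (f(h := g'))) (D * mv m h) g j))"
    using move_block[of D "D * h" m B] assms D by (simp add: mv_power)
  show ?thesis
    by (rule reach_mono[OF reach_seq[OF 1 2]]) (use D in simp)
qed

text \<open>The cost is \<open>D - 1\<close> reads, the transition, \<open>D - 1\<close> writes and
  \<open>D\<close> moves, together below \<open>3 * D\<close>. The bound
  \<open>D * (hd1 c + 1)\<close> admits the block to the right, where a right move ends.\<close>

lemma enc_sim:
  assumes "good_cfg Q G c" "D * (hd1 c + 1) \<le> B"
  shows "reach (mstep emach x) (\<lambda>c. hd1 c \<le> B) (3 * D) (enc_cfg c) (map_tree enc_cfg (mstep M x c))"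
proof (cases c)
  case c: (Cfg q i f h g j)
  show ?thesis
  proof (cases "out M q")
    case (Some b)
    then show ?thesis by (simp add: c mstep.simps reach_stop)
  next
    case None
    have G: "\<And>p. f p \<in> G" "q \<in> Q" using assms(1) c by (auto simp: good_cfg_def)
    have l: "length (e (f h)) = D" using G len by blast
    have B: "D * (h + 1) \<le> B" using assms(2) c by simp
    define t where "t = act M q (input_sym x i) (f h) (g j)"
    define mid where "mid = Cfg (ERd q (take (D - 1) (e (f h)))) i (enc_tape f) (D * h + (D - 1)) g j"
    have full: "take (D - 1) (e (f h)) @ [e (f h) ! (D - 1)] = e (f h)"
      using l D take_Suc_conv_app_nth[of "D - 1" "e (f h)"] by simp
    have "enc_out M (ERd q (take (D - 1) (e (f h)))) = None"
      using None by (cases "take (D - 1) (e (f h))") auto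
    moreover have "dec (e (f h)) = f h" using G dec_e by blast
    ultimately have mid: "mstep emach x mid = map_tree (perform x mid)
        (map_tree (\<lambda>(q', g', b', mi, m1, m2). (EWr q' (butlast (e g')) m1, last (e g'), b', mi, MLeft, m2)) t)"
      using D l full enc_tape_block[of "D - 1" f h] by (simp add: mid_def mstep.simps t_def)
    have sh: "shallow t" unfolding t_def by (rule fin_machD(4)[OF fin]) (use G None in auto)
    have 1: "reach (mstep emach x) (\<lambda>c. hd1 c \<le> B) (D - 1) (enc_cfg c) (Leaf mid)"
      unfolding mid_def c enc_cfg.simps by (rule read_block) (use None G B D in auto)
    have 2: "reach (mstep emach x) (\<lambda>c. hd1 c \<le> B) 1 mid (mstep emach x mid)"
      unfolding One_nat_def 
    proof (rule reach_one)
      show "shallow (mstep emach x mid)" unfolding mid by (simp add: sh)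
      show "hd1 mid \<le> B" using B D by (simp add: mid_def)
    qed
    have 3: "reach (mstep emach x) (\<lambda>c. hd1 c \<le> B) (2 * D)
       (perform x mid (case r of (q', g', b', mi, m1, m2) \<Rightarrow> (EWr q' (butlast (e g')) m1, last (e g'), b', mi, MLeft, m2)))
       (Leaf (enc_cfg (perform x c r)))" if "r \<in> set_tree t" for r
    proof -
      obtain q' g' b' mi m1 m2 where r: "r = (q', g', b', mi, m1, m2)" by (cases r)
      have "q' \<in> Q \<and> g' \<in> G"
        using fin_machD(5)[OF fin, of q "f h"] G None that r unfolding t_def by blast
      then show ?thesis
        using enc_after_transition[of g' h B x q' m1 _ f _ _] B D
        by (simp add: r mid_def c)
    qed
    have "reach (mstep emach x) (\<lambda>c. hd1 c \<le> B) (1 + 2 * D) mid (bindt t (\<lambda>r. Leaf (enc_cfg (perform x c r))))"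
      by (rule reach_bind_map[OF 2]) (use 3 in \<open>auto simp: mid tree.map_comp comp_def\<close>)
    moreover have "bindt t (\<lambda>r. Leaf (enc_cfg (perform x c r))) = map_tree enc_cfg (mstep M x c)"
      using None by (simp add: c mstep.simps t_def[symmetric] tree.map_comp bindt_Leaf_map comp_def)
    ultimately show ?thesis
      using reach_mono[OF reach_seq[OF 1], of "1 + 2 * D" "map_tree enc_cfg (mstep M x c)" "3 * D"] D by simp
  qed
qed

lemma enc_reach:
  assumes "reach (mstep M x) ok n c T" "good_cfg Q G c" "\<And>c. ok c \<Longrightarrow> D * (hd1 c + 1) \<le> B"
  shows "reach (mstep emach x) (\<lambda>c. hd1 c \<le> B) (3 * D * n) (enc_cfg c) (map_tree enc_cfg T)"
  by (rule reach_lift[where I = "good_cfg Q G", OF assms(1,2)])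
     (auto intro: good_cfg_mstep[OF fin] enc_sim assms(3))

lemma enc_init: "enc_cfg (Cfg (ini M) i (\<lambda>_. blank) 0 g j) = Cfg (ini emach) i (\<lambda>_. False) 0 g j"
  using D by (auto simp: enc_tape_def e_blank fun_eq_iff)

lemma enc_cfg_out [simp]: "out emach (st (enc_cfg c)) = out M (st c)" "aux (enc_cfg c) = aux c"
  by (cases c; simp)+

lemma single_emach: "single M \<Longrightarrow> single emach"
proof (rule singleI)
  fix q a w q' w' b' mi m1 m2
  assume *: "single M" "(q', w', b', mi, m1, m2) \<in> set_tree (act emach q a w False)"
  show "\<not> b' \<and> m2 = MStay"
    by (cases q) (use * in \<open>auto simp: tree.set_map split: if_splits dest: singleD\<close>)
qed

lemma fin_emach: "\<exists>Q'. fin_mach emach Q' UNIV"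
proof
  define W where "W = {bs :: bool list. length bs \<le> D}"
  have W: "finite W"
    unfolding W_def using finite_lists_length_le[of "UNIV :: bool set" D] by simp
  \<comment> \<open>With a nonempty buffer \<open>emach\<close> counts as running, so the transition
    of \<open>M\<close> is applied. \<open>fin_mach\<close> controls that transition only if
    \<open>M\<close> has not halted, hence the condition on \<open>ERd\<close>.\<close>
  define Q' where "Q' = (\<lambda>(q, bs). ERd q bs) ` {(q, bs) \<in> Q \<times> W. bs = [] \<or> out M q = None} \<union> (\<lambda>(q, bs, m). EWr q bs m) ` (Q \<times> W \<times> UNIV)
     \<union> (\<lambda>(q, m, n). EMv q m n) ` (Q \<times> UNIV \<times> {..D})"
  have mem: "ERd q bs \<in> Q' \<longleftrightarrow> q \<in> Q \<and> length bs \<le> D \<and> (bs = [] \<or> out M q = None)" "EWr q bs m \<in> Q' \<longleftrightarrow> q \<in> Q \<and> length bs \<le> D"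
    "EMv q m n \<in> Q' \<longleftrightarrow> q \<in> Q \<and> n \<le> D" for q bs m n
    unfolding Q'_def W_def by (auto simp: image_iff)
  have "shallow (act emach q a w b) \<and> (\<forall>(q', _)\<in>set_tree (act emach q a w b). q' \<in> Q')"
    if "q \<in> Q'" "out emach q = None" for q a w b
  proof (cases q)
    case (ERd p bs)
    show ?thesis
    proof (cases "Suc (length bs) < D")
      case False
      then have p: "p \<in> Q" "out M p = None" using that ERd D by (cases bs; auto simp: mem)+
      have "(q', g', r) \<in> set_tree (act M p a (dec (bs @ [w])) b) \<Longrightarrow> q' \<in> Q \<and> g' \<in> G" for q' g' r
        by (rule fin_machD(5)[OF fin p(1) dec_in p(2)])
      then show ?thesis
        using False fin_machD(4)[OF fin p(1) dec_in p(2)] ERd len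
        by (auto simp: mem tree.set_map)
    qed (use that ERd in \<open>auto simp: mem\<close>)
  qed (use that in \<open>auto simp: mem\<close>)
  moreover have "finite Q'"
  proof -
    have "finite {(q, bs) \<in> Q \<times> W. bs = [] \<or> out M q = None}"
      by (rule finite_subset[of _ "Q \<times> W"]) (use W fin_machD(1)[OF fin] in auto)
    then show ?thesis
      unfolding Q'_def
      by (intro finite_UnI finite_imageI finite_cartesian_product W fin_machD(1)[OF fin]) auto
  qed
  moreover have "ini emach \<in> Q'" using fin_machD(3)[OF fin] by (simp add: mem)
  ultimately show "fin_mach emach Q' UNIV"
    unfolding fin_mach_def by (simp add: case_prod_beta)
qed

end

text \<open>Symbols are coded by words with a single one, the blank by zeros. The summand 2 in the
  length provides \<open>2 \<le> D\<close>.\<close>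

lemma ex_encoding:
  fixes M :: "('q, 'g) mach"
  assumes "fin_mach M Q G" "blank \<in> G"
  shows "\<exists>D e. encoding M Q G blank D e"
proof -
  have "finite G" using assms(1) by (rule fin_machD)
  then obtain f :: "'g \<Rightarrow> nat" where f: "bij_betw f G {0..<card G}"
    using ex_bij_betw_finite_nat by blast
  define D where "D = card G + 2"
  define e where "e g = (if g = blank then replicate D False else (replicate D False)[f g := True])" for g
  have lt: "f g < D" if "g \<in> G" for g
    using bij_betw_apply[OF f that] by (simp add: D_def)
  have nth: "e g ! i \<longleftrightarrow> g \<noteq> blank \<and> i = f g" if "g \<in> G" "i < D" for g i
    using that lt by (cases "i = f g") (auto simp: e_def)
  have "inj_on e G"
  proof (rule inj_onI)
    fix g g' assume *: "g \<in> G" "g' \<in> G" "e g = e g'"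
    then have "(g \<noteq> blank \<and> i = f g) = (g' \<noteq> blank \<and> i = f g')" if "i < D" for i
      using nth that by metis
    from this[of "f g"] this[of "f g'"] lt * have "g = g' \<or> f g = f g'" by auto
    then show "g = g'" using f * by (auto simp: bij_betw_def inj_on_def)
  qed
  moreover have "length (e g) = D" for g by (simp add: e_def)
  moreover have "2 \<le> D" by (simp add: D_def)
  moreover have "e blank = replicate D False" by (simp add: e_def)
  ultimately have "encoding M Q G blank D e"
    using assms by unfold_locales auto
  then show ?thesis by blast
qed

section \<open>From two-tape machines to the concrete classes\<close>

fun pick :: "bool \<Rightarrow> 'a tree \<Rightarrow> 'a" where
  "pick b (Leaf r) = r"
| "pick b (Flip s t) = (if b then pick b s else pick b t)"

locale concretize =
  fixes N :: "('q, bool) mach" and Q :: "'q set" and f :: "'q \<Rightarrow> nat"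
  assumes fin: "fin_mach N Q UNIV" and f: "bij_betw f Q {0..<card Q}"
begin

text \<open>All accepting states are merged into 0 and all rejecting ones into 1, because a concrete
  machine has one state of each kind. \<open>decode\<close> inverts this on running states.\<close>

definition code :: "'q \<Rightarrow> nat" where
  "code q = (case out N q of Some True \<Rightarrow> 0 | Some False \<Rightarrow> 1 | None \<Rightarrow> f q + 2)"

definition decode :: "nat \<Rightarrow> 'q" where
  "decode n = inv_into Q f (n - 2)"

definition live :: "nat \<Rightarrow> bool" where
  "live n \<longleftrightarrow> 2 \<le> n \<and> n < card Q + 2 \<and> out N (decode n) = None"

definition cmach :: rmachine where
  "cmach = \<lparr>nstates = card Q + 2, start = code (ini N), acc = 0, rej = 1,
     coin = (\<lambda>n a w c. live n \<and> (\<exists>s t. act N (decode n) a w c = Flip s t)),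
     delta = (\<lambda>n a w c b. if live n
        then (case pick b (act N (decode n) a w c) of (q', r) \<Rightarrow> (code q', r))
        else (0, w, c, MStay, MStay, MStay))\<rparr>"

fun conc :: "nat \<Rightarrow> nat \<Rightarrow> ('q, bool) cfg \<Rightarrow> config" where
  "conc s c (Cfg q i t h g j) = \<lparr>cstate = code q, ihead = i, wtape = map t [0..<s], whead = h,
     ctape = map g [0..<c], chead = j, rhead = 0\<rparr>"

lemma code_live: "q \<in> Q \<Longrightarrow> out N q = None \<Longrightarrow> live (code q) \<and> decode (code q) = q"
proof -
  assume q: "q \<in> Q" "out N q = None"
  then have "f q < card Q" "inv_into Q f (f q) = q"
    using f bij_betw_apply[OF f] by (auto simp: bij_betw_def)
  with q show ?thesis by (simp add: code_def live_def decode_def)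
qed

lemma code_less: "q \<in> Q \<Longrightarrow> code q < card Q + 2"
  using bij_betw_apply[OF f] by (auto simp: code_def split: option.splits bool.splits)

lemma decode_in: "live n \<Longrightarrow> decode n \<in> Q"
  using bij_betw_imp_surj_on[OF f] by (auto simp: live_def decode_def intro!: inv_into_into)

lemma pick_in: "pick b t \<in> set_tree t"
  by (induction t) auto

lemma wf_cmach: "wf_machine cmach"
proof -
  have "fst (delta cmach n a w c b) < card Q + 2" for n a w c b
  proof (cases "live n")
    case True
    obtain q' r where r: "pick b (act N (decode n) a w c) = (q', r)"
      by (cases "pick b (act N (decode n) a w c)")
    obtain g' r' where r': "r = (g', r')" by (cases r)
    have "(q', g', r') \<in> set_tree (act N (decode n) a w c)"
      using pick_in[of b "act N (decode n) a w c"] r r' by simp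
    then have "q' \<in> Q"
      using fin_machD(5)[OF fin decode_in[OF True], of w q' g' r' a c] True by (auto simp: live_def)
    from code_less[OF this] show ?thesis using True r by (simp add: cmach_def)
  qed (simp add: cmach_def)
  then show ?thesis
    using code_less[OF fin_machD(3)[OF fin]] by (auto simp: wf_machine_def cmach_def)
qed

lemma halted_conc: "halted cmach (conc s c C) \<longleftrightarrow> out N (st C) \<noteq> None"
  by (cases C) (auto simp: halted_def cmach_def code_def split: option.splits bool.splits)

lemma read_map: "h < s \<Longrightarrow> read_cell (map t [0..<s]) h = t h"
  by (simp add: read_cell_def)

lemma map_update: "(map t [0..<s])[h := a] = map (t(h := a)) [0..<s]"
  by (rule nth_equalityI) (auto simp: nth_list_update)

lemma do_move_mv: "h + 1 < s \<Longrightarrow> do_move m h (s - 1) = mv m h"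
  by (cases m) auto

text \<open>Cutting off the tapes commutes with a step while the heads are away from the last cell,
  where clamping would show. If \<open>c = 0\<close>, reads yield \<open>False\<close> and the head
  is stuck at 0; a \<open>single\<close> machine behaves in the same way on a blank tape.\<close>

lemma cstep_conc:
  assumes q: "st C \<in> Q" and h: "hd1 C + 1 < s"
    and j: "if c = 0 then single N \<and> hd2 C = 0 \<and> \<not> aux C 0 else hd2 C + 1 < c"
  shows "cstep cmach x (conc s c C) = map_tree (conc s c) (mstep N x C)"
proof (cases C)
  case C: (Cfg q i t h g j)
  show ?thesis
  proof (cases "out N q")
    case (Some b)
    then show ?thesis
      using halted_conc[of s c C] by (simp add: cstep_def C mstep.simps)
  next
    case None
    have nh: "\<not> halted cmach (conc s c C)" using halted_conc[of s c C] None C by simp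
    have lv: "live (code q)" "decode (code q) = q" using code_live q None C by auto
    have rc: "read_cell (map g [0..<c]) j = g j"
      using j C by (cases "c = 0") (auto simp: read_map read_cell_def)
    have rw: "read_cell (map t [0..<s]) h = t h" using h C by (simp add: read_map)
    define T where "T = act N q (input_sym x i) (t h) (g j)"
    have sh: "shallow T"
      unfolding T_def by (rule fin_machD(4)[OF fin]) (use q C None in auto)
    have coin: "cur_coin cmach x (conc s c C) = (\<exists>u v. T = Flip u v)"
      by (simp add: cur_coin_def C rc rw cmach_def lv T_def)
    have nxt: "cnext cmach x (conc s c C) b = conc s c (perform x C (pick b T))" for b
    proof -
      obtain q' w' b' mi m1 m2 where r: "pick b T = (q', w', b', mi, m1, m2)"
        by (cases "pick b T")
      have "(q', w', b', mi, m1, m2) \<in> set_tree T" using pick_in[of b T] r by simp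
      then have "m2 = MStay" if "c = 0"
        using singleD[of N q' w' b' mi m1 m2 q "input_sym x i" "t h"] that j C by (auto simp: T_def)
      then have "do_move m2 j (c - 1) = mv m2 j"
        using j C do_move_mv[of j c m2] by (cases "c = 0") auto
      moreover have "do_move m1 h (s - 1) = mv m1 h"
        by (rule do_move_mv) (use h C in simp)
      ultimately show ?thesis
        by (simp add: cnext_def apply_act_def C rc rw cmach_def lv r T_def[symmetric] map_update)
    qed
    from sh show ?thesis
    proof (cases rule: shallow_cases)
      case (1 a)
      then show ?thesis using nh coin nxt None
        by (simp add: cstep_def C mstep.simps T_def[symmetric])
    next
      case (2 a b)
      then show ?thesis using nh coin nxt[of True] nxt[of False] None
        by (simp add: cstep_def C mstep.simps T_def[symmetric])
    qed
  qed
qed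

lemma reach_conc:
  assumes r: "reach (mstep N x) ok n C D" and "st C \<in> Q"
    and h: "\<And>C. ok C \<Longrightarrow> hd1 C + 1 < s"
    and j: "if c = 0 then single N \<and> hd2 C = 0 \<and> \<not> aux C 0 else (\<forall>C. ok C \<longrightarrow> hd2 C + 1 < c)"
  shows "reach (cstep cmach x) (\<lambda>_. True) n (conc s c C) (map_tree (conc s c) D)"
proof -
  define I where "I C \<longleftrightarrow> good_cfg Q UNIV C \<and> (c = 0 \<longrightarrow> single N \<and> hd2 C = 0 \<and> \<not> aux C 0)"
    for C :: "('q, bool) cfg"
  have sim: "cstep cmach x (conc s c C) = map_tree (conc s c) (mstep N x C)" if "I C" "ok C" for C
    by (rule cstep_conc) (use that h j in \<open>auto simp: I_def good_cfg_def split: if_splits\<close>)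
  have inv: "I C'" if I: "I C" "ok C" and C': "C' \<in> set_tree (mstep N x C)" for C C'
  proof -
    have "good_cfg Q UNIV C'"
      using good_cfg_mstep[OF fin _ C'] I(1) by (simp add: I_def)
    moreover have "hd2 C' = 0 \<and> \<not> aux C' 0" if "c = 0"
    proof (cases C)
      case C: (Cfg q i t h g j)
      have z: "single N" "j = 0" "\<not> g 0" using I(1) that C by (auto simp: I_def)
      show ?thesis
      proof (cases "out N q")
        case None
        then obtain r where r: "r \<in> set_tree (act N q (input_sym x i) (t h) False)" "C' = perform x C r"
          using C' z C by (auto simp: mstep.simps tree.set_map)
        obtain q' w' b' mi m1 m2 where "r = (q', w', b', mi, m1, m2)" by (cases r)
        with r singleD[OF z(1), of q' w' b' mi m1 m2 q "input_sym x i" "t h"] show ?thesis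
          using z C by simp
      qed (use C' C z in \<open>auto simp: mstep.simps\<close>)
    qed
    ultimately show ?thesis using I(1) by (simp add: I_def)
  qed
  have one: "reach (cstep cmach x) (\<lambda>_. True) 1 (conc s c C) (map_tree (conc s c) (mstep N x C))"
    if "I C" "ok C" for C
    unfolding sim[OF that, symmetric] One_nat_def by (rule reach_one) simp_all
  have "I C" using assms by (auto simp: I_def good_cfg_def split: if_splits)
  from reach_lift[where I = I, OF r this inv one] show ?thesis by simp
qed

lemma unfold_conc:
  assumes "reach (mstep N x) ok n C D" "st C \<in> Q" "\<And>C. ok C \<Longrightarrow> hd1 C + 1 < s"
    and "if c = 0 then single N \<and> hd2 C = 0 \<and> \<not> aux C 0 else (\<forall>C. ok C \<longrightarrow> hd2 C + 1 < c)"
    and "\<And>l. l \<in> set_tree D \<Longrightarrow> out N (st l) \<noteq> None" and "n \<le> T"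
  shows "unfold (cstep cmach x) T (conc s c C) = map_tree (conc s c) D"
  by (rule reach_unfold_eq[OF reach_mono[OF reach_conc[OF assms(1-4)] \<open>n \<le> T\<close>]])
     (use assms(5) in \<open>auto simp: tree.set_map cstep_def halted_conc\<close>)

lemma init_conc:
  "init_config cmach s \<tau> = conc s (length \<tau>) (Cfg (ini N) 0 (\<lambda>_. False) 0 (read_cell \<tau>) 0)"
  by (auto simp: init_config_def cmach_def read_cell_def map_replicate_const intro: nth_equalityI)

lemma conc_correct:
  assumes "out N (st l) \<noteq> None"
  shows "(cstate (conc s c l) = acc cmach) = (x \<in> L) \<longleftrightarrow> out N (st l) = Some (x \<in> L)"
  using assms by (cases l) (auto simp: cmach_def code_def split: option.splits bool.splits)

text \<open>One polynomial serves as time, space and number of random bits. The summand 2 in the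
  choice of \<open>k\<close> keeps the head off the last work cell.\<close>

lemma BPP_I:
  assumes sg: "single N" and sol: "solves N (\<lambda>_ _. False) T L (1/3)" and T: "poly T"
  shows "L \<in> BPP"
proof -
  have "poly (\<lambda>n. T n + 2)" by (intro poly_intros T)
  then obtain k where k: "\<And>n. T n + 2 \<le> (n + 2) ^ k" unfolding poly_def by blast
  have "(\<forall>r. length r = (length x + 2) ^ k \<longrightarrow>
           halts_within cmach x ((length x + 2) ^ k) [] r ((length x + 2) ^ k)) \<and>
       prob_rand ((length x + 2) ^ k) (\<lambda>r. (cstate (run cmach x ((length x + 2) ^ k) [] r ((length x + 2) ^ k)) = acc cmach) = (x \<in> L)) \<ge> 2/3" for x
  proof -
    define p where "p = (length x + 2) ^ k"
    define C0 where "C0 = Cfg (ini N) 0 (\<lambda>_. False) 0 (\<lambda>_. False) 0"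
    obtain D where D: "reach (mstep N x) (\<lambda>_. True) (T (length x)) C0 D"
      "\<forall>l\<in>set_tree D. out N (st l) \<noteq> None"
      "expect (\<lambda>l. of_bool (out N (st l) \<noteq> Some (x \<in> L))) D \<le> 1/3"
      using sol unfolding solves_def C0_def by blast
    have i0: "init_config cmach p [] = conc p 0 C0"
      by (simp add: init_conc C0_def read_cell_def)
    have D': "reach (mstep N x) (\<lambda>c. True \<and> hd1 c < T (length x) \<and> hd2 c < T (length x)) (T (length x)) C0 D"
      using reach_heads[OF D(1), of "T (length x)"] by (simp add: C0_def)
    have un: "unfold (cstep cmach x) p (init_config cmach p []) = map_tree (conc p 0) D"
      unfolding i0
      by (rule unfold_conc[OF D']) (use D(2) k[of "length x"] sg fin_machD(3)[OF fin] in \<open>auto simp: p_def C0_def\<close>)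
    have "\<forall>r. length r = p \<longrightarrow> halts_within cmach x p [] r p"
      using D(2) by (subst halts_within_all_iff) (auto simp: un tree.set_map halted_conc)
    moreover have "prob_rand p (\<lambda>r. (cstate (run cmach x p [] r p) = acc cmach) = (x \<in> L)) \<ge> 2/3"
    proof -
      have "prob_rand p (\<lambda>r. (cstate (run cmach x p [] r p) = acc cmach) = (x \<in> L)) =
         expect (\<lambda>c. of_bool ((cstate c = acc cmach) = (x \<in> L))) (map_tree (conc p 0) D)"
        using prob_rand_run[of p p "\<lambda>c. (cstate c = acc cmach) = (x \<in> L)" cmach x p "[]"] un by simp
      also have "\<dots> = expect (\<lambda>l. 1 - of_bool (out N (st l) \<noteq> Some (x \<in> L))) D"
        unfolding expect_map by (rule expect_cong) (use D(2) in \<open>simp add: conc_correct\<close>)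
      finally show ?thesis using D(3) unfolding expect_compl by simp
    qed
    ultimately show ?thesis by (simp add: p_def)
  qed
  then show ?thesis
    unfolding BPP_def Let_def using wf_cmach by blast
qed

text \<open>The work head needs the explicit bound \<open>B\<close>, since that tape is short; the
  catalytic head is bounded by the running time. The arbitrary tape \<open>g\<close> becomes the
  given content followed by \<open>False\<close> cells.\<close>

lemma BPCLP_I:
  assumes B: "\<And>n. B n + 2 \<le> k * floorlog 2 (n + 2)" and T: "\<And>n. T n + 2 \<le> (n + 2) ^ k"
    and run: "\<And>x g. \<exists>D. reach (mstep N x) (\<lambda>c. hd1 c \<le> B (length x)) (T (length x))
          (Cfg (ini N) 0 (\<lambda>_. False) 0 g 0) D \<and> (\<forall>l\<in>set_tree D. out N (st l) \<noteq> None) \<and>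
       expect (\<lambda>l. of_bool (out N (st l) \<noteq> Some (x \<in> L))) D \<le> 1/2 - \<epsilon> \<and>
       expect (\<lambda>l. of_bool (aux l \<noteq> g)) D \<le> \<delta>"
  shows "L \<in> BPCLP \<epsilon> \<delta>"
proof -
  have "(\<forall>r. length r = 2 ^ ((length x + 2) ^ k) \<longrightarrow>
           halts_within cmach x (k * floorlog 2 (length x + 2)) \<tau> r ((length x + 2) ^ k)) \<and>
       prob_rand (2 ^ ((length x + 2) ^ k)) (\<lambda>r. (cstate (run cmach x (k * floorlog 2 (length x + 2)) \<tau> r ((length x + 2) ^ k)) = acc cmach) = (x \<in> L)) \<ge> 1/2 + \<epsilon> \<and>
       prob_rand (2 ^ ((length x + 2) ^ k)) (\<lambda>r. ctape (run cmach x (k * floorlog 2 (length x + 2)) \<tau> r ((length x + 2) ^ k)) = \<tau>) \<ge> 1 - \<delta>"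
    if \<tau>: "length \<tau> = (length x + 2) ^ k" for x \<tau>
  proof -
    define c where "c = (length x + 2) ^ k"
    define s where "s = k * floorlog 2 (length x + 2)"
    define C0 where "C0 = Cfg (ini N) 0 (\<lambda>_. False) 0 (read_cell \<tau>) 0"
    have c0: "c \<noteq> 0" by (simp add: c_def)
    have m: "c \<le> 2 ^ c" by (simp add: less_imp_le)
    obtain D where D: "reach (mstep N x) (\<lambda>c. hd1 c \<le> B (length x)) (T (length x)) C0 D"
      "\<forall>l\<in>set_tree D. out N (st l) \<noteq> None"
      "expect (\<lambda>l. of_bool (out N (st l) \<noteq> Some (x \<in> L))) D \<le> 1/2 - \<epsilon>"
      "expect (\<lambda>l. of_bool (aux l \<noteq> read_cell \<tau>)) D \<le> \<delta>"
      using run[of x "read_cell \<tau>"] unfolding C0_def by blast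
    have i0: "init_config cmach s \<tau> = conc s c C0"
      using \<tau> by (simp add: init_conc C0_def c_def)
    have D': "reach (mstep N x) (\<lambda>c. hd1 c \<le> B (length x) \<and> hd1 c < T (length x) \<and> hd2 c < T (length x)) (T (length x)) C0 D"
      using reach_heads[OF D(1), of "T (length x)"] by (simp add: C0_def)
    have un: "unfold (cstep cmach x) c (init_config cmach s \<tau>) = map_tree (conc s c) D"
      unfolding i0
      by (rule unfold_conc[OF D'])
         (use D(2) B[of "length x"] T[of "length x"] fin_machD(3)[OF fin] c0 in \<open>auto simp: c_def s_def C0_def\<close>)
    have 1: "\<forall>r. length r = 2 ^ c \<longrightarrow> halts_within cmach x s \<tau> r c"
      using D(2) m by (subst halts_within_all_iff) (auto simp: un tree.set_map halted_conc)
    have 2: "prob_rand (2 ^ c) (\<lambda>r. (cstate (run cmach x s \<tau> r c) = acc cmach) = (x \<in> L)) \<ge> 1/2 + \<epsilon>"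
    proof -
      have "prob_rand (2 ^ c) (\<lambda>r. (cstate (run cmach x s \<tau> r c) = acc cmach) = (x \<in> L)) =
         expect (\<lambda>c. of_bool ((cstate c = acc cmach) = (x \<in> L))) (map_tree (conc s c) D)"
        using prob_rand_run[OF m, of "\<lambda>c. (cstate c = acc cmach) = (x \<in> L)" cmach x s \<tau>] un by simp
      also have "\<dots> = expect (\<lambda>l. 1 - of_bool (out N (st l) \<noteq> Some (x \<in> L))) D"
        unfolding expect_map by (rule expect_cong) (use D(2) in \<open>simp add: conc_correct\<close>)
      finally show ?thesis using D(3) unfolding expect_compl by simp
    qed
    have 3: "prob_rand (2 ^ c) (\<lambda>r. ctape (run cmach x s \<tau> r c) = \<tau>) \<ge> 1 - \<delta>"
    proof -
      have restored: "ctape (conc s c l) = \<tau>" if "aux l = read_cell \<tau>" for l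
        using that \<tau> by (cases l) (auto simp: c_def read_cell_def intro: nth_equalityI)
      have "1 - \<delta> \<le> expect (\<lambda>l. 1 - of_bool (aux l \<noteq> read_cell \<tau>)) D"
        using D(4) unfolding expect_compl by simp
      \<comment> \<open>Equality of the infinite tapes implies equality of their first
        \<open>c\<close> cells, so the concrete machine restores its tape at least as often.\<close>
      also have "\<dots> \<le> expect (\<lambda>l. of_bool (ctape (conc s c l) = \<tau>)) D"
        by (rule expect_mono) (auto simp: restored)
      also have "\<dots> = prob_rand (2 ^ c) (\<lambda>r. ctape (run cmach x s \<tau> r c) = \<tau>)"
        using prob_rand_run[OF m, of "\<lambda>c. ctape c = \<tau>" cmach x s \<tau>] un by (simp add: expect_map)
      finally show ?thesis .
    qed
    show ?thesis using 1 2 3 by (simp add: c_def s_def)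
  qed
  then show ?thesis
    unfolding BPCLP_def Let_def using wf_cmach by blast
qed

end

lemma ex_concretize:
  fixes N :: "('q, bool) mach"
  assumes "fin_mach N Q UNIV"
  shows "\<exists>f. concretize N Q f"
proof -
  obtain f :: "'q \<Rightarrow> nat" where "bij_betw f Q {0..<card Q}"
    using ex_bij_betw_finite_nat fin_machD(1)[OF assms] by blast
  then show ?thesis using assms by (auto simp: concretize_def)
qed

section \<open>Head movements\<close>

lemma seek_left:
  assumes "out M q = None"
    and "\<And>p. 0 < p \<Longrightarrow> p \<le> h \<Longrightarrow> act M q (input_sym x i) (f p) (g j) = Leaf (q, f p, g j, MStay, MLeft, MStay)"
    and "\<And>p. p \<le> h \<Longrightarrow> ok (Cfg q i f p g j)"
  shows "reach (mstep M x) ok h (Cfg q i f h g j) (Leaf (Cfg q i f 0 g j))"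
  using assms(2,3)
proof (induction h)
  case (Suc h)
  show ?case
    by (rule reach_act[OF assms(1) _ _ Suc.IH]) (use Suc.prems in auto)
qed (rule reach_stop)

lemma seek_right:
  assumes "out M q = None"
    and "\<And>p. h \<le> p \<Longrightarrow> p < h + n \<Longrightarrow> act M q (input_sym x i) (f p) (g j) = Leaf (q, f p, g j, MStay, MRight, MStay)"
    and "\<And>p. p \<le> h + n \<Longrightarrow> ok (Cfg q i f p g j)"
  shows "reach (mstep M x) ok n (Cfg q i f h g j) (Leaf (Cfg q i f (h + n) g j))"
  using assms(2,3)
proof (induction n arbitrary: h)
  case (Suc n)
  have "reach (mstep M x) ok n (Cfg q i f (Suc h) g j) (Leaf (Cfg q i f (Suc h + n) g j))"
    by (rule Suc.IH) (use Suc.prems in auto)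
  then show ?case
    by (intro reach_act[OF assms(1), where c' = "Cfg q i f (Suc h) g j"]) (use Suc.prems in auto)
qed (simp add: reach_stop)

lemma seek_input:
  assumes "out M q = None"
    and "\<And>s. act M q (Some s) (f h) (g j) = Leaf (q, f h, g j, MLeft, MStay, MStay)"
    and "\<And>i. ok (Cfg q i f h g j)" and "i \<le> length x"
  shows "reach (mstep M x) ok i (Cfg q i f h g j) (Leaf (Cfg q 0 f h g j))"
  using assms(4)
proof (induction i)
  case (Suc i)
  have "input_sym x (Suc i) = Some (x ! i)" using Suc.prems by (simp add: input_sym_def)
  then show ?case
    by (intro reach_act[OF assms(1), where c' = "Cfg q i f h g j"])
       (use Suc.prems assms Suc.IH in auto)
qed (rule reach_stop)

lemma input_sym_0 [simp]: "input_sym x 0 = None"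
  by (simp add: input_sym_def)

section \<open>Two tapes on one\<close>

text \<open>A cell holds the two simulated cells, the marks of the two simulated heads, and the mark of
  the left end.\<close>

type_synonym 'g cell2 = "'g \<times> bool \<times> bool \<times> bool \<times> bool"

text \<open>\<open>L\<close> and \<open>R\<close> are searches to the left and to the right,
  \<open>P\<close> places a head mark, and the digit names the simulated head. Each search passes
  through the left end because the order of the two heads is unknown. The stored symbol is the one
  read from, or to be written to, the first tape.\<close>

datatype ('q, 'g) sweep_st = SIni | SAt 'q | SL2 'q 'g | SR2 'q 'g | SP2 'q 'g move
  | SL1 'q 'g move | SR1 'q 'g move | SP1 'q

fun sweep_act :: "('q, 'g) mach \<Rightarrow> 'g \<Rightarrow> ('q, 'g) sweep_st \<Rightarrow> bool option \<Rightarrow> 'g cell2 \<Rightarrow> bool \<Rightarrow>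
   (('q, 'g) sweep_st, 'g cell2) action tree" where
  "sweep_act M blank SIni a z b = Leaf (SAt (ini M), (blank, False, True, True, True), b, MStay, MStay, MStay)"
| "sweep_act M blank (SAt q) a z b = Leaf (SL2 q (fst z), z, b, MStay, MStay, MStay)"
| "sweep_act M blank (SL2 q u) a (s, t, k1, k2, l) b =
     Leaf (if l then SR2 q u else SL2 q u, (s, t, k1, k2, l), b, MStay, if l then MStay else MLeft, MStay)"
| "sweep_act M blank (SR2 q u) a (s, t, k1, k2, l) b =
     (if k2 then map_tree (\<lambda>(q', u', t', mi, m1, m2). (SP2 q' u' m1, (s, t', k1, False, l), b, mi, m2, MStay))
        (act M q a u t)
      else Leaf (SR2 q u, (s, t, k1, k2, l), b, MStay, MRight, MStay))"
| "sweep_act M blank (SP2 q u m) a (s, t, k1, k2, l) b = Leaf (SL1 q u m, (s, t, k1, True, l), b, MStay, MStay, MStay)"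
| "sweep_act M blank (SL1 q u m) a (s, t, k1, k2, l) b =
     Leaf (if l then SR1 q u m else SL1 q u m, (s, t, k1, k2, l), b, MStay, if l then MStay else MLeft, MStay)"
| "sweep_act M blank (SR1 q u m) a (s, t, k1, k2, l) b =
     (if k1 then Leaf (SP1 q, (u, t, False, k2, l), b, MStay, m, MStay)
      else Leaf (SR1 q u m, (s, t, k1, k2, l), b, MStay, MRight, MStay))"
| "sweep_act M blank (SP1 q) a (s, t, k1, k2, l) b = Leaf (SAt q, (s, t, True, k2, l), b, MStay, MStay, MStay)"

fun sweep_out :: "('q, 'g) mach \<Rightarrow> ('q, 'g) sweep_st \<Rightarrow> bool option" where
  "sweep_out M (SAt q) = out M q"
| "sweep_out M _ = None"

definition sweep :: "('q, 'g) mach \<Rightarrow> 'g \<Rightarrow> (('q, 'g) sweep_st, 'g cell2) mach" where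
  "sweep M blank = \<lparr>ini = SIni, out = sweep_out M, act = sweep_act M blank\<rparr>"

lemma sweep_simps [simp]:
  "ini (sweep M blank) = SIni" "out (sweep M blank) = sweep_out M" "act (sweep M blank) = sweep_act M blank"
  by (auto simp: sweep_def)

text \<open>The marks are given by sets because a mark is absent while its head is on the way to a
  new position.\<close>

definition tracks :: "(nat \<Rightarrow> 'g) \<Rightarrow> (nat \<Rightarrow> bool) \<Rightarrow> nat set \<Rightarrow> nat set \<Rightarrow> nat \<Rightarrow> 'g cell2" where
  "tracks f g A B p = (f p, g p, p \<in> A, p \<in> B, p = 0)"

fun sweep_cfg :: "('q, 'g) cfg \<Rightarrow> (('q, 'g) sweep_st, 'g cell2) cfg" where
  "sweep_cfg (Cfg q i f h g j) = Cfg (SAt q) i (tracks f g {h} {j}) h (\<lambda>_. False) 0"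

lemma sweep_to_second:
  assumes "out M q = None"
  shows "reach (mstep (sweep M blank) x) (\<lambda>_. True) (h + j + 2)
    (Cfg (SAt q) i (tracks f g {h} {j}) h z y) (Leaf (Cfg (SR2 q (f h)) i (tracks f g {h} {j}) j z y))"
proof -
  let ?T = "tracks f g {h} {j}"
  have 1: "reach (mstep (sweep M blank) x) (\<lambda>_. True) 1 (Cfg (SAt q) i ?T h z y) (Leaf (Cfg (SL2 q (f h)) i ?T h z y))"
    unfolding One_nat_def by (rule reach_act1) (use assms in \<open>simp_all add: tracks_def fun_eq_iff\<close>)
  have 2: "reach (mstep (sweep M blank) x) (\<lambda>_. True) h (Cfg (SL2 q (f h)) i ?T h z y) (Leaf (Cfg (SL2 q (f h)) i ?T 0 z y))"
    by (rule seek_left) (simp_all add: tracks_def)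
  have 3: "reach (mstep (sweep M blank) x) (\<lambda>_. True) 1 (Cfg (SL2 q (f h)) i ?T 0 z y) (Leaf (Cfg (SR2 q (f h)) i ?T 0 z y))"
    unfolding One_nat_def by (rule reach_act1) (simp_all add: tracks_def fun_eq_iff)
  have 4: "reach (mstep (sweep M blank) x) (\<lambda>_. True) j (Cfg (SR2 q (f h)) i ?T 0 z y) (Leaf (Cfg (SR2 q (f h)) i ?T (0 + j) z y))"
    by (rule seek_right) (simp_all add: tracks_def)
  show ?thesis
    using reach_seq[OF reach_seq[OF reach_seq[OF 1 2] 3] 4] by (simp add: add.commute)
qed

lemma sweep_to_first:
  "reach (mstep (sweep M blank) x) (\<lambda>_. True) (h + j + 4)
    (Cfg (SP2 q u m) i (tracks f g {h} {}) j z y) (Leaf (Cfg (SAt q) i (tracks (f(h := u)) g {mv m h} {j}) (mv m h) z y))"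
proof -
  let ?T = "tracks f g {h} {j}" and ?U = "tracks (f(h := u)) g {} {j}"
  have 1: "reach (mstep (sweep M blank) x) (\<lambda>_. True) 1 (Cfg (SP2 q u m) i (tracks f g {h} {}) j z y) (Leaf (Cfg (SL1 q u m) i ?T j z y))"
    unfolding One_nat_def by (rule reach_act1) (auto simp: tracks_def fun_eq_iff)
  have 2: "reach (mstep (sweep M blank) x) (\<lambda>_. True) j (Cfg (SL1 q u m) i ?T j z y) (Leaf (Cfg (SL1 q u m) i ?T 0 z y))"
    by (rule seek_left) (simp_all add: tracks_def)
  have 3: "reach (mstep (sweep M blank) x) (\<lambda>_. True) 1 (Cfg (SL1 q u m) i ?T 0 z y) (Leaf (Cfg (SR1 q u m) i ?T 0 z y))"
    unfolding One_nat_def by (rule reach_act1) (simp_all add: tracks_def fun_eq_iff)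
  have 4: "reach (mstep (sweep M blank) x) (\<lambda>_. True) h (Cfg (SR1 q u m) i ?T 0 z y) (Leaf (Cfg (SR1 q u m) i ?T (0 + h) z y))"
    by (rule seek_right) (simp_all add: tracks_def)
  have 5: "reach (mstep (sweep M blank) x) (\<lambda>_. True) 1 (Cfg (SR1 q u m) i ?T (0 + h) z y) (Leaf (Cfg (SP1 q) i ?U (mv m h) z y))"
    unfolding One_nat_def by (rule reach_act1) (auto simp: tracks_def fun_eq_iff)
  have 6: "reach (mstep (sweep M blank) x) (\<lambda>_. True) 1 (Cfg (SP1 q) i ?U (mv m h) z y)
      (Leaf (Cfg (SAt q) i (tracks (f(h := u)) g {mv m h} {j}) (mv m h) z y))"
    unfolding One_nat_def by (rule reach_act1) (auto simp: tracks_def fun_eq_iff)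
  show ?thesis
    by (rule reach_mono[OF reach_seq[OF reach_seq[OF reach_seq[OF reach_seq[OF reach_seq[OF 1 2] 3] 4] 5] 6]]) simp
qed

text \<open>Going from one head to the other and back via the left end takes at most
  \<open>2 * h + 2 * j + 8\<close> steps. With both heads bounded by the running time the overhead
  is quadratic in total.\<close>

lemma sweep_sim:
  assumes fin: "fin_mach M Q G" and good: "good_cfg Q G c" and H: "hd1 c < H" "hd2 c < H"
  shows "reach (mstep (sweep M blank) x) (\<lambda>_. True) (4 * H + 8) (sweep_cfg c) (map_tree sweep_cfg (mstep M x c))"
proof (cases c)
  case c: (Cfg q i f h g j)
  show ?thesis
  proof (cases "out M q")
    case (Some b)
    then show ?thesis by (simp add: c mstep.simps reach_stop)
  next
    case None
    define t where "t = act M q (input_sym x i) (f h) (g j)"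
    define mid where "mid = Cfg (SR2 q (f h)) i (tracks f g {h} {j}) j (\<lambda>_. False) 0"
    have sh: "shallow t" unfolding t_def
      by (rule fin_machD(4)[OF fin]) (use None good c in \<open>auto simp: good_cfg_def\<close>)
    have mid: "mstep (sweep M blank) x mid = map_tree (perform x mid)
        (map_tree (\<lambda>(q', u', t', mi, m1, m2). (SP2 q' u' m1, (f j, t', j = h, False, j = 0), False, mi, m2, MStay)) t)"
      by (simp add: mid_def mstep.simps t_def tracks_def)
    have 1: "reach (mstep (sweep M blank) x) (\<lambda>_. True) (h + j + 2) (sweep_cfg c) (Leaf mid)"
      unfolding c sweep_cfg.simps mid_def by (rule sweep_to_second[OF None])
    have 2: "reach (mstep (sweep M blank) x) (\<lambda>_. True) 1 mid (mstep (sweep M blank) x mid)"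
      unfolding One_nat_def by (rule reach_one) (simp_all add: mid sh)
    have 3: "reach (mstep (sweep M blank) x) (\<lambda>_. True) (h + (j + 1) + 4)
       (perform x mid (case r of (q', u', t', mi, m1, m2) \<Rightarrow> (SP2 q' u' m1, (f j, t', j = h, False, j = 0), False, mi, m2, MStay)))
       (Leaf (sweep_cfg (perform x c r)))" for r
    proof -
      obtain q' u' t' mi m1 m2 where r: "r = (q', u', t', mi, m1, m2)" by (cases r)
      have "(tracks f g {h} {j})(j := (f j, t', j = h, False, j = 0)) = tracks f (g(j := t')) {h} {}"
        by (auto simp: tracks_def fun_eq_iff)
      then show ?thesis
        using reach_mono[OF sweep_to_first[of M blank x h "mv m2 j" q' u' m1 "do_move mi i (length x + 1)" f "g(j := t')" "\<lambda>_. False" 0],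
            of "h + (j + 1) + 4"] mv_le[of m2 j]
        by (simp add: r mid_def c fun_upd_idem)
    qed
    have "reach (mstep (sweep M blank) x) (\<lambda>_. True) (1 + (h + (j + 1) + 4)) mid (bindt t (\<lambda>r. Leaf (sweep_cfg (perform x c r))))"
      by (rule reach_bind_map[OF 2]) (use 3 in \<open>auto simp: mid tree.map_comp comp_def\<close>)
    moreover have "bindt t (\<lambda>r. Leaf (sweep_cfg (perform x c r))) = map_tree sweep_cfg (mstep M x c)"
      using None by (simp add: c mstep.simps t_def[symmetric] tree.map_comp bindt_Leaf_map comp_def)
    ultimately have "reach (mstep (sweep M blank) x) (\<lambda>_. True) (h + j + 2 + (1 + (h + (j + 1) + 4))) (sweep_cfg c) (map_tree sweep_cfg (mstep M x c))"
      using reach_seq[OF 1] by metis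
    then show ?thesis
      by (rule reach_mono) (use H c in simp)
  qed
qed

lemma single_sweep: "single (sweep M blank)"
proof (rule singleI)
  fix q a w q' w' b' mi m1 m2
  assume *: "(q', w', b', mi, m1, m2) \<in> set_tree (act (sweep M blank) q a w False)"
  show "\<not> b' \<and> m2 = MStay"
    by (cases q; cases w) (use * in \<open>auto simp: tree.set_map split: if_splits\<close>)
qed

lemma fin_sweep:
  assumes fin: "fin_mach M Q G" and blank: "blank \<in> G"
  shows "\<exists>Q'. fin_mach (sweep M blank) Q' (G \<times> UNIV)"
proof
  define Q' where "Q' = insert SIni (SAt ` Q \<union> (\<lambda>(q, u). SL2 q u) ` ({q \<in> Q. out M q = None} \<times> G)
     \<union> (\<lambda>(q, u). SR2 q u) ` ({q \<in> Q. out M q = None} \<times> G)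
     \<union> (\<lambda>(q, u, m). SP2 q u m) ` (Q \<times> G \<times> UNIV) \<union> (\<lambda>(q, u, m). SL1 q u m) ` (Q \<times> G \<times> UNIV)
     \<union> (\<lambda>(q, u, m). SR1 q u m) ` (Q \<times> G \<times> UNIV) \<union> SP1 ` Q)"
  have mem: "SIni \<in> Q'" "SAt q \<in> Q' \<longleftrightarrow> q \<in> Q" "SL2 q u \<in> Q' \<longleftrightarrow> q \<in> Q \<and> out M q = None \<and> u \<in> G"
    "SR2 q u \<in> Q' \<longleftrightarrow> q \<in> Q \<and> out M q = None \<and> u \<in> G" "SP2 q u m \<in> Q' \<longleftrightarrow> q \<in> Q \<and> u \<in> G"
    "SL1 q u m \<in> Q' \<longleftrightarrow> q \<in> Q \<and> u \<in> G" "SR1 q u m \<in> Q' \<longleftrightarrow> q \<in> Q \<and> u \<in> G" "SP1 q \<in> Q' \<longleftrightarrow> q \<in> Q"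
    for q u m
    unfolding Q'_def by (auto simp: image_iff)
  have "shallow (act (sweep M blank) q a z b) \<and>
     (\<forall>(q', g', _)\<in>set_tree (act (sweep M blank) q a z b). q' \<in> Q' \<and> g' \<in> G \<times> UNIV)"
    if "q \<in> Q'" "z \<in> G \<times> UNIV" "out (sweep M blank) q = None" for q a z b
  proof -
    obtain s t k1 k2 l where z: "z = (s, t, k1, k2, l)" by (cases z)
    show ?thesis
    proof (cases q)
      case (SR2 p u)
      then have p: "p \<in> Q" "u \<in> G" "out M p = None" using that mem by auto
      then show ?thesis
        using that SR2 z fin_machD(4)[OF fin p] fin_machD(5)[OF fin p]
        by (auto simp: mem tree.set_map)
    qed (use that z fin_machD(3)[OF fin] blank in \<open>auto simp: mem\<close>)
  qed
  moreover have "finite Q'"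
    using fin_machD(1,2)[OF fin] unfolding Q'_def
    by (intro finite_insert[THEN iffD2] finite_UnI finite_imageI finite_cartesian_product) auto
  moreover have "finite (G \<times> (UNIV :: (bool \<times> bool \<times> bool \<times> bool) set))"
    using fin_machD(2)[OF fin] by simp
  ultimately show "fin_mach (sweep M blank) Q' (G \<times> UNIV)"
    unfolding fin_mach_def using mem(1) by (simp only: sweep_simps) blast
qed

lemma solves_sweep:
  assumes fin: "fin_mach M Q G" and blank: "blank \<in> G" and sol: "solves M (\<lambda>_ _. blank) T L w"
  shows "solves (sweep M blank) (\<lambda>_ _. (blank, False, False, False, False)) (\<lambda>n. 1 + (4 * T n + 8) * T n) L w"
  unfolding solves_def
proof
  fix x :: "bool list"
  define c0 where "c0 = Cfg (ini M) 0 (\<lambda>_. blank) 0 (\<lambda>_. False) 0"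
  let ?S = "sweep M blank" and ?n = "length x"
  obtain D where D: "reach (mstep M x) (\<lambda>_. True) (T ?n) c0 D"
     "\<forall>l\<in>set_tree D. out M (st l) \<noteq> None" "expect (\<lambda>l. of_bool (out M (st l) \<noteq> Some (x \<in> L))) D \<le> w"
    using sol unfolding solves_def c0_def by blast
  have 1: "reach (mstep ?S x) (\<lambda>_. True) 1 (Cfg (ini ?S) 0 (\<lambda>_. (blank, False, False, False, False)) 0 (\<lambda>_. False) 0) (Leaf (sweep_cfg c0))"
    unfolding One_nat_def by (rule reach_act1) (auto simp: c0_def tracks_def fun_eq_iff)
  have D': "reach (mstep M x) (\<lambda>c. True \<and> hd1 c < T ?n \<and> hd2 c < T ?n) (T ?n) c0 D"
    using reach_heads[OF D(1), of "T ?n"] by (simp add: c0_def)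
  have "reach (mstep ?S x) (\<lambda>_. True) ((4 * T ?n + 8) * T ?n) (sweep_cfg c0) (map_tree sweep_cfg D)"
  proof (rule reach_lift[where I = "good_cfg Q G", OF D'])
    show "good_cfg Q G c0"
      using blank fin_machD(3)[OF fin] by (simp add: c0_def good_cfg_def)
  qed (auto intro: good_cfg_mstep[OF fin] sweep_sim[OF fin])
  from reach_seq[OF 1 this]
  have "reach (mstep ?S x) (\<lambda>_. True) (1 + (4 * T ?n + 8) * T ?n)
     (Cfg (ini ?S) 0 (\<lambda>_. (blank, False, False, False, False)) 0 (\<lambda>_. False) 0) (map_tree sweep_cfg D)" .
  moreover have "out ?S (st (sweep_cfg c)) = out M (st c)" for c by (cases c) simp
  ultimately show "\<exists>D. reach (mstep ?S x) (\<lambda>_. True) (1 + (4 * T ?n + 8) * T ?n)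
     (Cfg (ini ?S) 0 (\<lambda>_. (blank, False, False, False, False)) 0 (\<lambda>_. False) 0) D \<and>
     (\<forall>l\<in>set_tree D. out ?S (st l) \<noteq> None) \<and>
     expect (\<lambda>l. of_bool (out ?S (st l) \<noteq> Some (x \<in> L))) D \<le> w"
    using D by (intro exI[of _ "map_tree sweep_cfg D"]) (auto simp: tree.set_map expect_map)
qed

section \<open>Amplification by majority vote\<close>

text \<open>The \<open>N\<close> trials run on separate tracks, so that nothing has to be erased between them. The
  counter \<open>r\<close> of remaining trials is also the index of the current track.\<close>

datatype 'q amp_st = AIni | ASim 'q nat nat nat | ABack nat nat nat | ARw nat nat nat | AOut bool

text \<open>\<open>a\<close> and \<open>b\<close> count accepting and rejecting trials. After a
  trial the input head moves left once: it may stand on the right end marker, which reads as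
  \<open>None\<close> just like the left one, where \<open>ARw\<close> has to stop.\<close>

fun amp_act :: "('q, 'g) mach \<Rightarrow> 'g \<Rightarrow> nat \<Rightarrow> 'q amp_st \<Rightarrow> bool option \<Rightarrow> 'g list \<times> bool \<Rightarrow> bool \<Rightarrow>
   ('q amp_st, 'g list \<times> bool) action tree" where
  "amp_act M blank N AIni s z y = Leaf (ASim (ini M) (N - 1) 0 0, (replicate N blank, True), y, MStay, MStay, MStay)"
| "amp_act M blank N (ASim q r a b) s z y = (case out M q of
      None \<Rightarrow> map_tree (\<lambda>(q', u, t, ms). (ASim q' r a b, ((fst z)[r := u], snd z), t, ms)) (act M q s (fst z ! r) y)
    | Some v \<Rightarrow> Leaf (ABack r (if v then Suc a else a) (if v then b else Suc b), z, y, MLeft, MStay, MStay))"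
| "amp_act M blank N (ABack r a b) s z y =
     (if snd z then Leaf (ARw r a b, z, y, MStay, MStay, MStay) else Leaf (ABack r a b, z, y, MStay, MLeft, MStay))"
| "amp_act M blank N (ARw r a b) s z y =
     (if s = None then Leaf (if r = 0 then AOut (b < a) else ASim (ini M) (r - 1) a b, z, y, MStay, MStay, MStay)
      else Leaf (ARw r a b, z, y, MLeft, MStay, MStay))"
| "amp_act M blank N (AOut v) s z y = Leaf (AOut v, z, y, MStay, MStay, MStay)"

fun amp_out :: "'q amp_st \<Rightarrow> bool option" where
  "amp_out (AOut v) = Some v"
| "amp_out _ = None"

definition amp :: "('q, 'g) mach \<Rightarrow> 'g \<Rightarrow> nat \<Rightarrow> ('q amp_st, 'g list \<times> bool) mach" where
  "amp M blank N = \<lparr>ini = AIni, out = amp_out, act = amp_act M blank N\<rparr>"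

lemma amp_simps [simp]:
  "ini (amp M blank N) = AIni" "out (amp M blank N) = amp_out" "act (amp M blank N) = amp_act M blank N"
  by (auto simp: amp_def)

fun amp_cfg :: "(nat \<Rightarrow> 'g list) \<Rightarrow> nat \<Rightarrow> nat \<Rightarrow> nat \<Rightarrow> ('q, 'g) cfg \<Rightarrow> ('q amp_st, 'g list \<times> bool) cfg" where
  "amp_cfg F r a b (Cfg q i f h g j) = Cfg (ASim q r a b) i (\<lambda>p. ((F p)[r := f p], p = 0)) h g j"

lemma single_mstep:
  assumes "single M" "aux c = (\<lambda>_. False) \<and> hd2 c = 0" "c' \<in> set_tree (mstep M x c)"
  shows "aux c' = (\<lambda>_. False) \<and> hd2 c' = 0"
proof (cases c)
  case c: (Cfg q i f h g j)
  show ?thesis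
  proof (cases "out M q")
    case None
    then obtain r where r: "r \<in> set_tree (act M q (input_sym x i) (f h) False)" "c' = perform x c r"
      using assms(2,3) c by (auto simp: mstep.simps tree.set_map)
    obtain q' w' b' mi m1 m2 where "r = (q', w', b', mi, m1, m2)" by (cases r)
    with r singleD[OF assms(1), of q' w' b' mi m1 m2 q "input_sym x i" "f h"] show ?thesis
      using assms(2) c by (simp add: fun_upd_idem)
  qed (use assms(2,3) c in \<open>auto simp: mstep.simps\<close>)
qed

lemma single_amp: "single M \<Longrightarrow> single (amp M blank N)"
proof (rule singleI)
  fix q s z q' w' b' mi m1 m2
  assume *: "single M" "(q', w', b', mi, m1, m2) \<in> set_tree (act (amp M blank N) q s z False)"
  show "\<not> b' \<and> m2 = MStay"
    by (cases q) (use * in \<open>auto simp: tree.set_map split: if_splits option.splits dest: singleD\<close>)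
qed

lemma fin_amp:
  assumes fin: "fin_mach M Q G" and blank: "blank \<in> G" and N: "0 < N"
  shows "\<exists>Q'. fin_mach (amp M blank N) Q' ({us. set us \<subseteq> G \<and> length us = N} \<times> UNIV)"
proof
  \<comment> \<open>During a trial its own vote is still missing from \<open>a + b\<close>, which
    makes the inequality strict; after the vote it is weak, as in \<open>J\<close>.\<close>
  define I where "I = {(r, a, b). r < N \<and> a + b + r < N}"
  define J where "J = {(r, a, b). r < N \<and> a + b + r \<le> N}"
  have IJ: "finite I" "finite J"
    by (rule finite_subset[of _ "{..N} \<times> {..N} \<times> {..N}"]; auto simp: I_def J_def)+
  define Q' where "Q' = insert AIni ((\<lambda>(q, r, a, b). ASim q r a b) ` (Q \<times> I)
     \<union> (\<lambda>(r, a, b). ABack r a b) ` J \<union> (\<lambda>(r, a, b). ARw r a b) ` J \<union> range AOut)"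
  have mem: "AIni \<in> Q'" "ASim q r a b \<in> Q' \<longleftrightarrow> q \<in> Q \<and> r < N \<and> a + b + r < N"
    "ABack r a b \<in> Q' \<longleftrightarrow> r < N \<and> a + b + r \<le> N" "ARw r a b \<in> Q' \<longleftrightarrow> r < N \<and> a + b + r \<le> N" "AOut v \<in> Q'"
    for q r a b v
    unfolding Q'_def I_def J_def by (auto simp: image_iff)
  let ?G = "{us. set us \<subseteq> G \<and> length us = N} \<times> (UNIV :: bool set)"
  have "shallow (act (amp M blank N) q s z y) \<and>
     (\<forall>(q', g', _)\<in>set_tree (act (amp M blank N) q s z y). q' \<in> Q' \<and> g' \<in> ?G)"
    if "q \<in> Q'" "z \<in> ?G" for q s z y
  proof (cases q)
    case (ASim p r a b)
    then have p: "p \<in> Q" "r < N" "a + b + r < N" using that mem by auto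
    then have u: "fst z ! r \<in> G" using that(2) nth_mem[of r "fst z"] by auto
    show ?thesis
    proof (cases "out M p")
      case None
      have "(q', u', m) \<in> set_tree (act M p s (fst z ! r) y) \<Longrightarrow> q' \<in> Q \<and> u' \<in> G" for q' u' m
        by (rule fin_machD(5)[OF fin p(1) u None])
      then show ?thesis
        using fin_machD(4)[OF fin p(1) u None] that(2) ASim p None
        by (auto simp: mem tree.set_map dest!: set_update_subset_insert[THEN subsetD])
    qed (use that(2) ASim p in \<open>auto simp: mem\<close>)
  qed (use that fin_machD(3)[OF fin] blank N in \<open>auto simp: mem\<close>)
  moreover have "finite Q'"
    using fin_machD(1)[OF fin] IJ unfolding Q'_def
    by (intro finite_insert[THEN iffD2] finite_UnI finite_imageI finite_cartesian_product) auto
  moreover have "finite ?G"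
    using finite_lists_length_eq[OF fin_machD(2)[OF fin], of N] by simp
  ultimately show "fin_mach (amp M blank N) Q' ?G"
    unfolding fin_mach_def using mem(1) by (simp only: amp_simps) blast
qed

lemma amp_sim:
  assumes fin: "fin_mach M Q G" and good: "good_cfg Q G c" and F: "\<And>p. length (F p) = N" and r: "r < N"
  shows "reach (mstep (amp M blank N) x) (\<lambda>_. True) 1 (amp_cfg F r a b c) (map_tree (amp_cfg F r a b) (mstep M x c))"
proof (cases c)
  case c: (Cfg q i f h g j)
  show ?thesis
  proof (cases "out M q")
    case (Some v)
    then show ?thesis by (simp add: c mstep.simps reach_stop)
  next
    case None
    define t where "t = act M q (input_sym x i) (f h) (g j)"
    have sh: "shallow t" unfolding t_def
      by (rule fin_machD(4)[OF fin]) (use None good c in \<open>auto simp: good_cfg_def\<close>)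
    have "mstep (amp M blank N) x (amp_cfg F r a b c) = map_tree (amp_cfg F r a b) (mstep M x c)"
      using None r F
      by (auto simp: c mstep.simps t_def[symmetric] tree.map_comp fun_eq_iff intro!: tree.map_cong0)
    then show ?thesis
      unfolding One_nat_def by (metis reach_one shallow_map None c mstep.simps sh t_def)
  qed
qed

lemma amp_reset:
  assumes "out M (st l) = Some v" "ip l \<le> length x + 1" "hd1 l \<le> H"
    and "a' = (if v then Suc a else a)" "b' = (if v then b else Suc b)"
  shows "reach (mstep (amp M blank N) x) (\<lambda>_. True) (H + length x + 3) (amp_cfg F r a b l)
     (Leaf (Cfg (if r = 0 then AOut (b' < a') else ASim (ini M) (r - 1) a' b') 0
        (\<lambda>p. ((F p)[r := tp l p], p = 0)) 0 (aux l) (hd2 l)))"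
proof (cases l)
  case l: (Cfg q i f h g j)
  let ?F = "\<lambda>p. ((F p)[r := f p], p = 0)"
  have 1: "reach (mstep (amp M blank N) x) (\<lambda>_. True) 1 (Cfg (ASim q r a b) i ?F h g j) (Leaf (Cfg (ABack r a' b') (i - 1) ?F h g j))"
    unfolding One_nat_def by (rule reach_act1) (use assms l in \<open>auto simp: fun_eq_iff\<close>)
  have 2: "reach (mstep (amp M blank N) x) (\<lambda>_. True) h (Cfg (ABack r a' b') (i - 1) ?F h g j) (Leaf (Cfg (ABack r a' b') (i - 1) ?F 0 g j))"
    by (rule seek_left) auto
  have 3: "reach (mstep (amp M blank N) x) (\<lambda>_. True) 1 (Cfg (ABack r a' b') (i - 1) ?F 0 g j) (Leaf (Cfg (ARw r a' b') (i - 1) ?F 0 g j))"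
    unfolding One_nat_def by (rule reach_act1) (auto simp: fun_eq_iff)
  have 4: "reach (mstep (amp M blank N) x) (\<lambda>_. True) (i - 1) (Cfg (ARw r a' b') (i - 1) ?F 0 g j) (Leaf (Cfg (ARw r a' b') 0 ?F 0 g j))"
    by (rule seek_input) (use assms l in auto)
  have 5: "reach (mstep (amp M blank N) x) (\<lambda>_. True) 1 (Cfg (ARw r a' b') 0 ?F 0 g j)
     (Leaf (Cfg (if r = 0 then AOut (b' < a') else ASim (ini M) (r - 1) a' b') 0 ?F 0 g j))"
    unfolding One_nat_def by (rule reach_act1) (auto simp: fun_eq_iff)
  show ?thesis
    unfolding l amp_cfg.simps cfg.sel
    by (rule reach_mono[OF reach_seq[OF reach_seq[OF reach_seq[OF reach_seq[OF 1 2] 3] 4] 5]])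
       (use assms l in auto)
qed

text \<open>This is \<open>lam\<close> to the power of wrong votes minus right votes, where
  \<open>e\<close> is the correct answer.\<close>

definition amp_weight :: "real \<Rightarrow> bool \<Rightarrow> nat \<Rightarrow> nat \<Rightarrow> real" where
  "amp_weight lam e a b = (if e then lam ^ b / lam ^ a else lam ^ a / lam ^ b)"

text \<open>Exponential moments: a trial multiplies the weight by \<open>1 / lam\<close> or by \<open>lam\<close>, hence by at most
  \<open>rho\<close> in expectation, and a wrong majority has weight at least 1.\<close>

lemma amp_trials:
  fixes lam w :: real and x :: "bool list"
  assumes fin: "fin_mach M Q G" and blank: "blank \<in> G" and sg: "single M" and lam: "1 \<le> lam" and w: "0 \<le> w"
    and D: "reach (mstep M x) (\<lambda>_. True) T (Cfg (ini M) 0 (\<lambda>_. blank) 0 (\<lambda>_. False) 0) D"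
      "\<forall>l\<in>set_tree D. out M (st l) \<noteq> None" "expect (\<lambda>l. of_bool (out M (st l) \<noteq> Some e)) D \<le> w"
    and rho: "rho = 1 / lam + (lam - 1 / lam) * w"
    and F: "\<And>p. length (F p) = N" "\<And>p t. t \<le> r \<Longrightarrow> F p ! t = blank" and r: "r < N"
  shows "\<exists>E. reach (mstep (amp M blank N) x) (\<lambda>_. True) (Suc r * (2 * T + length x + 3))
       (Cfg (ASim (ini M) r a b) 0 (\<lambda>p. (F p, p = 0)) 0 (\<lambda>_. False) 0) E \<and>
     (\<forall>l\<in>set_tree E. amp_out (st l) \<noteq> None) \<and>
     expect (\<lambda>l. of_bool (amp_out (st l) \<noteq> Some e)) E \<le> amp_weight lam e a b * rho ^ Suc r"
  using F r
proof (induction r arbitrary: F a b rule: less_induct)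
  case (less r)
  let ?A = "mstep (amp M blank N) x" and ?n = "length x"
  define K where "K = 2 * T + ?n + 3"
  define c0 where "c0 = Cfg (ini M) 0 (\<lambda>_. blank) 0 (\<lambda>_. False) 0"
  define Good where "Good m C z \<longleftrightarrow> (\<exists>E. reach ?A (\<lambda>_. True) m C E \<and> (\<forall>l\<in>set_tree E. amp_out (st l) \<noteq> None) \<and>
     expect (\<lambda>l. of_bool (amp_out (st l) \<noteq> Some e)) E \<le> z)" for m C z
  have il: "1 / lam \<le> lam"
    using lam mult_mono[of 1 lam 1 lam] by (simp add: divide_le_eq)
  have rho0: "0 \<le> rho"
    unfolding rho using lam w il by (intro add_nonneg_nonneg mult_nonneg_nonneg) auto
  have nxt: "Good (r * K) (Cfg (if r = 0 then AOut (b' < a') else ASim (ini M) (r - 1) a' b') 0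
      (\<lambda>p. (F' p, p = 0)) 0 (\<lambda>_. False) 0) (amp_weight lam e a' b' * rho ^ r)"
    if F': "\<And>p. length (F' p) = N" "\<And>p t. t < r \<Longrightarrow> F' p ! t = blank" for F' a' b'
  proof (cases "r = 0")
    case True
    \<comment> \<open>A tie is a rejection. In any case a wrong verdict has at least as many wrong
      as right votes, so the exponent of \<open>lam\<close> is nonnegative.\<close>
    have "of_bool ((b' < a') \<noteq> e) \<le> amp_weight lam e a' b'"
      using lam by (auto simp: amp_weight_def power_increasing less_imp_le)
    then show ?thesis
      unfolding Good_def using True
      by (intro exI[of _ "Leaf (Cfg (AOut (b' < a')) 0 (\<lambda>p. (F' p, p = 0)) 0 (\<lambda>_. False) 0)"])
         (auto intro: reach_stop)
  next
    case False
    have "Good (Suc (r - 1) * K) (Cfg (ASim (ini M) (r - 1) a' b') 0 (\<lambda>p. (F' p, p = 0)) 0 (\<lambda>_. False) 0)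
        (amp_weight lam e a' b' * rho ^ Suc (r - 1))"
      unfolding Good_def K_def by (rule less.IH) (use False less.prems F' in auto)
    then show ?thesis using False by simp
  qed
  have leafb: "hd1 l \<le> T" "ip l \<le> ?n + 1" "aux l = (\<lambda>_. False)" "hd2 l = 0" if "l \<in> set_tree D" for l
  proof -
    show "hd1 l \<le> T" using reach_heads[OF D(1), of T] that by simp
    show "ip l \<le> ?n + 1"
      by (rule reach_inv[where I = "\<lambda>c. ip c \<le> ?n + 1", OF D(1) _ ip_mstep that]) simp_all
    have "aux l = (\<lambda>_. False) \<and> hd2 l = 0"
      by (rule reach_inv[where I = "\<lambda>c. aux c = (\<lambda>_. False) \<and> hd2 c = 0",
            OF D(1) _ single_mstep[OF sg] that]) simp_all
    then show "aux l = (\<lambda>_. False)" "hd2 l = 0" by auto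
  qed
  \<comment> \<open>The bound after a trial that ended in \<open>l\<close>: a right vote contributes
    \<open>1 / lam\<close>, a wrong one \<open>lam\<close>. It is affine in the error indicator, so
    its expectation is known by linearity.\<close>
  define g where "g l = amp_weight lam e a b * rho ^ r * (1 / lam + (lam - 1 / lam) * of_bool (out M (st l) \<noteq> Some e))"
    for l :: "('a, 'b) cfg"
  have "\<forall>l\<in>set_tree D. \<exists>E. reach ?A (\<lambda>_. True) (T + ?n + 3 + r * K) (amp_cfg F r a b l) E \<and>
      (\<forall>l\<in>set_tree E. amp_out (st l) \<noteq> None) \<and> expect (\<lambda>l. of_bool (amp_out (st l) \<noteq> Some e)) E \<le> g l"
  proof
    fix l assume l: "l \<in> set_tree D"
    then obtain v where v: "out M (st l) = Some v" using D(2) by blast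
    define a' where "a' = (if v then Suc a else a)"
    define b' where "b' = (if v then b else Suc b)"
    define F' where "F' p = (F p)[r := tp l p]" for p
    have "amp_weight lam e a' b' * rho ^ r = g l"
      using lam v by (auto simp: g_def amp_weight_def a'_def b'_def field_simps)
    moreover have "Good (r * K) (Cfg (if r = 0 then AOut (b' < a') else ASim (ini M) (r - 1) a' b') 0
      (\<lambda>p. (F' p, p = 0)) 0 (\<lambda>_. False) 0) (amp_weight lam e a' b' * rho ^ r)"
      by (rule nxt) (use less.prems in \<open>auto simp: F'_def\<close>)
    ultimately obtain E where E: "reach ?A (\<lambda>_. True) (r * K) (Cfg (if r = 0 then AOut (b' < a') else ASim (ini M) (r - 1) a' b') 0
      (\<lambda>p. (F' p, p = 0)) 0 (\<lambda>_. False) 0) E" "\<forall>l\<in>set_tree E. amp_out (st l) \<noteq> None"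
      "expect (\<lambda>l. of_bool (amp_out (st l) \<noteq> Some e)) E \<le> g l"
      unfolding Good_def by auto
    have "reach ?A (\<lambda>_. True) (T + ?n + 3) (amp_cfg F r a b l)
       (Leaf (Cfg (if r = 0 then AOut (b' < a') else ASim (ini M) (r - 1) a' b') 0 (\<lambda>p. (F' p, p = 0)) 0 (\<lambda>_. False) 0))"
      using amp_reset[OF v leafb(2,1)[OF l] a'_def b'_def, of blank N F r] leafb(3,4)[OF l] by (simp add: F'_def)
    from reach_seq[OF this E(1)] E(2,3) show "\<exists>E. reach ?A (\<lambda>_. True) (T + ?n + 3 + r * K) (amp_cfg F r a b l) E \<and>
      (\<forall>l\<in>set_tree E. amp_out (st l) \<noteq> None) \<and> expect (\<lambda>l. of_bool (amp_out (st l) \<noteq> Some e)) E \<le> g l" by blast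
  qed
  from bchoice[OF this] obtain E where E: "\<And>l. l \<in> set_tree D \<Longrightarrow> reach ?A (\<lambda>_. True) (T + ?n + 3 + r * K) (amp_cfg F r a b l) (E l)"
      "\<And>l l'. l \<in> set_tree D \<Longrightarrow> l' \<in> set_tree (E l) \<Longrightarrow> amp_out (st l') \<noteq> None"
      "\<And>l. l \<in> set_tree D \<Longrightarrow> expect (\<lambda>l. of_bool (amp_out (st l) \<noteq> Some e)) (E l) \<le> g l"
    by blast
  \<comment> \<open>Track \<open>r\<close> is still blank, so a fresh trial sees an empty tape
    although earlier trials left their traces on other tracks.\<close>
  have start: "amp_cfg F r a b c0 = Cfg (ASim (ini M) r a b) 0 (\<lambda>p. (F p, p = 0)) 0 (\<lambda>_. False) 0"
  proof -
    have "(F p)[r := blank] = F p" for p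
      using less.prems(2)[of r p] by (metis list_update_id order_refl)
    then show ?thesis by (simp add: c0_def)
  qed
  have "reach ?A (\<lambda>_. True) (1 * T) (amp_cfg F r a b c0) (map_tree (amp_cfg F r a b) D)"
    unfolding c0_def
  proof (rule reach_lift[where I = "good_cfg Q G", OF D(1)])
    show "good_cfg Q G (Cfg (ini M) 0 (\<lambda>_. blank) 0 (\<lambda>_. False) 0)"
      using blank fin_machD(3)[OF fin] by (simp add: good_cfg_def)
  qed (use less.prems in \<open>auto intro: good_cfg_mstep[OF fin] amp_sim[OF fin, unfolded One_nat_def]\<close>)
  from reach_bind_map[OF this refl E(1)]
  have rb: "reach ?A (\<lambda>_. True) (1 * T + (T + ?n + 3 + r * K)) (amp_cfg F r a b c0) (bindt D E)" .
  have "1 * T + (T + ?n + 3 + m) = K + m" for m by (simp add: K_def)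
  then have K: "1 * T + (T + ?n + 3 + r * K) = Suc r * K" by (simp only: mult_Suc)
  have "reach ?A (\<lambda>_. True) (Suc r * K) (Cfg (ASim (ini M) r a b) 0 (\<lambda>p. (F p, p = 0)) 0 (\<lambda>_. False) 0) (bindt D E)"
    using rb unfolding start K .
  moreover have "expect (\<lambda>l. of_bool (amp_out (st l) \<noteq> Some e)) (bindt D E) \<le> amp_weight lam e a b * rho ^ Suc r"
  proof -
    have "expect (\<lambda>l. of_bool (amp_out (st l) \<noteq> Some e)) (bindt D E) \<le> expect g D"
      unfolding expect_bindt by (rule expect_mono) (rule E(3))
    also have "\<dots> = amp_weight lam e a b * rho ^ r * ((lam - 1 / lam) * expect (\<lambda>l. of_bool (out M (st l) \<noteq> Some e)) D + 1 / lam)"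
    proof -
      define A where "A = amp_weight lam e a b * rho ^ r"
      have "g = (\<lambda>l. (A * (lam - 1 / lam)) * of_bool (out M (st l) \<noteq> Some e) + A * (1 / lam))"
        unfolding g_def A_def[symmetric] by (simp only: fun_eq_iff distrib_left mult.assoc add.commute) simp
      then have "expect g D = A * (lam - 1 / lam) * expect (\<lambda>l. of_bool (out M (st l) \<noteq> Some e)) D + A * (1 / lam)"
        by (simp only: expect_affine)
      then show ?thesis unfolding A_def[symmetric] by (simp only: distrib_left mult.assoc)
    qed
    also have "\<dots> \<le> amp_weight lam e a b * rho ^ r * rho"
    proof (rule mult_left_mono)
      show "(lam - 1 / lam) * expect (\<lambda>l. of_bool (out M (st l) \<noteq> Some e)) D + 1 / lam \<le> rho"
        unfolding rho using D(3) il by (simp add: mult_left_mono)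
      show "0 \<le> amp_weight lam e a b * rho ^ r"
        using lam rho0 by (simp add: amp_weight_def)
    qed
    finally show ?thesis by (simp add: algebra_simps)
  qed
  ultimately show ?case
    using E(2) unfolding K_def by (intro exI[of _ "bindt D E"]) auto
qed

text \<open>The number of trials is chosen from \<open>w\<close> and \<open>eta\<close> alone, not
  from the input, so the \<open>N\<close> tracks form a finite alphabet.\<close>

lemma solves_amp:
  assumes fin: "fin_mach M Q G" and blank: "blank \<in> G" and sg: "single M"
    and sol: "solves M (\<lambda>_ _. blank) T L w" and w: "0 \<le> w" "w < 1/2" and eta: "0 < eta"
  shows "\<exists>N>0. solves (amp M blank N) (\<lambda>_ _. (replicate N blank, False)) (\<lambda>n. 1 + N * (2 * T n + n + 3)) L eta"
proof -
  \<comment> \<open>\<open>rho < 1\<close> means that \<open>(lam - 1) * (1 - (lam + 1) * w)\<close>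
    is positive. For this value the second factor equals \<open>(1/2 - w) * (2 - w)\<close>, and the
    case \<open>w = 0\<close> is covered too.\<close>
  define lam where "lam = 3/2 - w"
  define rho where "rho = 1 / lam + (lam - 1 / lam) * w"
  have lam: "1 \<le> lam" "0 < lam" "lam \<le> 3/2" using w by (auto simp: lam_def)
  have rho0: "0 \<le> rho"
  proof -
    have "1 / lam * w \<le> 1 / lam" using w lam by (simp add: field_simps)
    moreover have "0 \<le> lam * w" using w lam by simp
    ultimately show ?thesis unfolding rho_def left_diff_distrib by linarith
  qed
  have "lam * rho = 1 + (lam\<^sup>2 - 1) * w"
    using lam by (simp add: rho_def field_simps power2_eq_square)
  moreover have "1 + (lam\<^sup>2 - 1) * w < lam"
  proof -
    have "lam - 1 - (lam\<^sup>2 - 1) * w = (lam - 1) * (1 - (lam + 1) * w)"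
      by (simp add: field_simps power2_eq_square)
    moreover have "(lam + 1) * w < 1"
    proof -
      have "1 - (lam + 1) * w = (1/2 - w) * (2 - w)"
        by (simp add: lam_def field_simps)
      moreover have "0 < (1/2 - w) * (2 - w)" using w by (intro mult_pos_pos) auto
      ultimately show ?thesis by linarith
    qed
    moreover have "1 < lam" using w by (simp add: lam_def)
    ultimately show ?thesis by (smt (verit) mult_pos_pos)
  qed
  ultimately have "lam * rho < lam * 1" by simp
  then have rho1: "rho < 1" using lam by (simp only: mult_less_cancel_left_pos)
  obtain N0 where N0: "rho ^ N0 < eta" using real_arch_pow_inv[OF eta rho1] by blast
  define N where "N = Suc N0"
  have N: "rho ^ N \<le> eta"
  proof -
    have "rho * rho ^ N0 \<le> 1 * rho ^ N0" using rho0 rho1 by (intro mult_right_mono) auto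
    then show ?thesis using N0 by (simp add: N_def)
  qed
  have "solves (amp M blank N) (\<lambda>_ _. (replicate N blank, False)) (\<lambda>n. 1 + N * (2 * T n + n + 3)) L eta"
    unfolding solves_def
  proof
    fix x :: "bool list"
    let ?A = "amp M blank N" and ?n = "length x"
    obtain D where D: "reach (mstep M x) (\<lambda>_. True) (T ?n) (Cfg (ini M) 0 (\<lambda>_. blank) 0 (\<lambda>_. False) 0) D"
      "\<forall>l\<in>set_tree D. out M (st l) \<noteq> None" "expect (\<lambda>l. of_bool (out M (st l) \<noteq> Some (x \<in> L))) D \<le> w"
      using sol unfolding solves_def by blast
    have "\<exists>E. reach (mstep ?A x) (\<lambda>_. True) (Suc N0 * (2 * T ?n + ?n + 3))
       (Cfg (ASim (ini M) N0 0 0) 0 (\<lambda>p. (replicate N blank, p = 0)) 0 (\<lambda>_. False) 0) E \<and>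
     (\<forall>l\<in>set_tree E. amp_out (st l) \<noteq> None) \<and>
     expect (\<lambda>l. of_bool (amp_out (st l) \<noteq> Some (x \<in> L))) E \<le> amp_weight lam (x \<in> L) 0 0 * rho ^ Suc N0"
      by (rule amp_trials[OF fin blank sg lam(1) w(1) D rho_def]) (simp_all add: N_def del: replicate_Suc)
    then obtain E where E: "reach (mstep ?A x) (\<lambda>_. True) (Suc N0 * (2 * T ?n + ?n + 3))
       (Cfg (ASim (ini M) N0 0 0) 0 (\<lambda>p. (replicate N blank, p = 0)) 0 (\<lambda>_. False) 0) E"
      "\<forall>l\<in>set_tree E. amp_out (st l) \<noteq> None"
      "expect (\<lambda>l. of_bool (amp_out (st l) \<noteq> Some (x \<in> L))) E \<le> amp_weight lam (x \<in> L) 0 0 * rho ^ Suc N0"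
      by blast
    have 1: "reach (mstep ?A x) (\<lambda>_. True) 1 (Cfg (ini ?A) 0 (\<lambda>_. (replicate N blank, False)) 0 (\<lambda>_. False) 0)
       (Leaf (Cfg (ASim (ini M) N0 0 0) 0 (\<lambda>p. (replicate N blank, p = 0)) 0 (\<lambda>_. False) 0))"
      unfolding One_nat_def by (rule reach_act1) (auto simp: fun_eq_iff N_def)
    from reach_seq[OF 1 E(1)] E(2,3) N
    show "\<exists>D. reach (mstep ?A x) (\<lambda>_. True) (1 + N * (2 * T ?n + ?n + 3))
       (Cfg (ini ?A) 0 (\<lambda>_. (replicate N blank, False)) 0 (\<lambda>_. False) 0) D \<and>
     (\<forall>l\<in>set_tree D. out ?A (st l) \<noteq> None) \<and>
     expect (\<lambda>l. of_bool (out ?A (st l) \<noteq> Some (x \<in> L))) D \<le> eta"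
      by (intro exI[of _ E]) (simp add: amp_weight_def N_def)
  qed
  then show ?thesis by (intro exI[of _ N]) (simp add: N_def)
qed

section \<open>Marking out a logarithmic number of cells\<close>

text \<open>Counting the \<open>n + 2\<close> cells of the input tape in binary makes exactly \<open>floorlog 2 (n + 2)\<close>
  cells nonblank.\<close>

fun binc :: "bool list \<Rightarrow> bool list" where
  "binc [] = [True]"
| "binc (False # xs) = True # xs"
| "binc (True # xs) = False # binc xs"

fun bval :: "bool list \<Rightarrow> nat" where
  "bval [] = 0"
| "bval (b # xs) = of_bool b + 2 * bval xs"

lemma bval_binc: "bval (binc xs) = Suc (bval xs)"
  by (induction xs rule: binc.induct) auto

lemma binc_not_Nil [simp]: "binc xs \<noteq> []"
  by (induction xs rule: binc.induct) auto

lemma last_binc: "(xs = [] \<or> last xs) \<Longrightarrow> last (binc xs)"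
  by (induction xs rule: binc.induct) (auto split: if_splits)

text \<open>The least significant bit comes first; the condition on \<open>last\<close> excludes
  leading zeros, so the length is the bit length of the value.\<close>

lemma length_eq_floorlog: "(xs = [] \<or> last xs) \<Longrightarrow> length xs = floorlog 2 (bval xs)"
proof (induction xs)
  case (Cons b xs)
  then have IH: "length xs = floorlog 2 (bval xs)" by (auto split: if_splits)
  have "0 < bval (b # xs)"
  proof (cases "xs = []")
    case False
    then have "0 < length xs" by simp
    then have "0 < bval xs" using IH by (metis floorlog_def less_numeral_extra(3))
    then show ?thesis by simp
  qed (use Cons.prems in auto)
  moreover have "bval (b # xs) div 2 = bval xs" by simp
  ultimately show ?case
    using IH by (subst compute_floorlog) simp
qed (simp add: floorlog_def)

definition count :: "nat \<Rightarrow> bool list" where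
  "count i = (binc ^^ i) []"

lemma count_Suc: "count (Suc i) = binc (count i)"
  by (simp add: count_def)

lemma length_count: "length (count i) = floorlog 2 i"
proof -
  have "(count i = [] \<or> last (count i)) \<and> bval (count i) = i"
    by (induction i) (auto simp: count_Suc last_binc bval_binc, simp_all add: count_def)
  then show ?thesis using length_eq_floorlog by metis
qed

text \<open>A blank cell is \<open>None\<close>; a measured one has a left end mark and a datum. Two
  data \<open>s0\<close> and \<open>s1\<close> act as binary digits during the measurement, which
  leaves \<open>s0\<close> everywhere.\<close>

type_synonym 'd mcell = "(bool \<times> 'd) option"

datatype 'q meas_st = MIni | MChk | MInc bool | MRet bool | MClr | MFin | MRw | MGo 'q

text \<open>Both end markers of the input read as \<open>None\<close>. \<open>MIni\<close> counts
  the left one and steps off it, so that \<open>MChk\<close> meets \<open>None\<close> only at the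
  right one; \<open>MFin\<close> steps off that before \<open>MRw\<close> rewinds. The Boolean in
  \<open>MInc\<close> and \<open>MRet\<close> tells whether this increment is the last.\<close>

fun meas_act :: "('q, 'd mcell) mach \<Rightarrow> 'd \<Rightarrow> 'd \<Rightarrow> 'q meas_st \<Rightarrow> bool option \<Rightarrow> 'd mcell \<Rightarrow> bool \<Rightarrow>
   ('q meas_st, 'd mcell) action tree" where
  "meas_act N s0 s1 MIni s z y = Leaf (MChk, Some (True, s1), y, MRight, MStay, MStay)"
| "meas_act N s0 s1 MChk s z y = Leaf (MInc (s = None), z, y, MRight, MStay, MStay)"
| "meas_act N s0 s1 (MInc b) s z y = (case z of None \<Rightarrow> Leaf (MRet b, Some (False, s1), y, MStay, MStay, MStay)
     | Some (l, d) \<Rightarrow> if d = s1 then Leaf (MInc b, Some (l, s0), y, MStay, MRight, MStay)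
                    else Leaf (MRet b, Some (l, s1), y, MStay, MStay, MStay))"
| "meas_act N s0 s1 (MRet b) s z y = (if z \<noteq> None \<and> fst (the z)
     then Leaf (if b then MClr else MChk, z, y, MStay, MStay, MStay)
     else Leaf (MRet b, z, y, MStay, MLeft, MStay))"
| "meas_act N s0 s1 MClr s z y = (case z of None \<Rightarrow> Leaf (MFin, None, y, MStay, MLeft, MStay)
     | Some (l, d) \<Rightarrow> Leaf (MClr, Some (l, s0), y, MStay, MRight, MStay))"
| "meas_act N s0 s1 MFin s z y = (if z \<noteq> None \<and> fst (the z)
     then Leaf (MRw, z, y, MLeft, MStay, MStay)
     else Leaf (MFin, z, y, MStay, MLeft, MStay))"
| "meas_act N s0 s1 MRw s z y = (if s = None then Leaf (MGo (ini N), z, y, MStay, MStay, MStay)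
     else Leaf (MRw, z, y, MLeft, MStay, MStay))"
| "meas_act N s0 s1 (MGo q) s z y = map_tree (\<lambda>(q', r). (MGo q', r)) (act N q s z y)"

fun meas_out :: "('q, 'd mcell) mach \<Rightarrow> 'q meas_st \<Rightarrow> bool option" where
  "meas_out N (MGo q) = out N q"
| "meas_out N _ = None"

definition meas :: "('q, 'd mcell) mach \<Rightarrow> 'd \<Rightarrow> 'd \<Rightarrow> ('q meas_st, 'd mcell) mach" where
  "meas N s0 s1 = \<lparr>ini = MIni, out = meas_out N, act = meas_act N s0 s1\<rparr>"

lemma meas_simps [simp]:
  "ini (meas N s0 s1) = MIni" "out (meas N s0 s1) = meas_out N" "act (meas N s0 s1) = meas_act N s0 s1"
  by (auto simp: meas_def)

definition mtape :: "'d \<Rightarrow> nat \<Rightarrow> nat \<Rightarrow> 'd mcell" where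
  "mtape d n p = (if p < floorlog 2 (n + 2) then Some (p = 0, d) else None)"

fun meas_cfg :: "('q, 'd mcell) cfg \<Rightarrow> ('q meas_st, 'd mcell) cfg" where
  "meas_cfg (Cfg q i f h g j) = Cfg (MGo q) i f h g j"

lemma meas_cfg_sel [simp]:
  "out (meas N s0 s1) (st (meas_cfg c)) = out N (st c)" "aux (meas_cfg c) = aux c" "hd1 (meas_cfg c) = hd1 c"
  by (cases c; simp)+

text \<open>The second tape \<open>g\<close> is arbitrary, because catalytic content has to survive
  the measurement. The head of the first tape goes no further than the first blank cell, which has
  number \<open>floorlog 2 (length x + 2)\<close>; this is what \<open>B\<close> has to
  admit.\<close>

locale measuring =
  fixes N :: "('q, 'd mcell) mach" and s0 s1 :: 'd and x :: "bool list" and B :: nat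
    and g :: "nat \<Rightarrow> bool" and j :: nat
  assumes s01: "s0 \<noteq> s1" and B: "floorlog 2 (length x + 2) \<le> B"
begin

abbreviation "rch \<equiv> reach (mstep (meas N s0 s1) x) (\<lambda>c. hd1 c \<le> B)"

definition btape :: "bool list \<Rightarrow> nat \<Rightarrow> 'd mcell" where
  "btape xs p = (if p < length xs then Some (p = 0, if xs ! p then s1 else s0) else None)"

lemma btape_update:
  "(btape (zs @ b # xs))(length zs := Some (zs = [], if c then s1 else s0)) = btape (zs @ c # xs)"
  by (auto simp: btape_def fun_eq_iff nth_append nth_Cons')

lemma btape_extend:
  "zs \<noteq> [] \<Longrightarrow> (btape zs)(length zs := Some (False, s1)) = btape (zs @ [True])"
  by (auto simp: btape_def fun_eq_iff nth_append)

lemma btape_at: "btape (zs @ b # xs) (length zs) = Some (zs = [], if b then s1 else s0)"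
  by (auto simp: btape_def)

lemma btape_end: "btape zs (length zs) = None"
  by (simp add: btape_def)

text \<open>\<open>zs\<close> are the digits that the carry has already passed. Where the carry
  stops is left open up to a bound, since \<open>MRet\<close> returns to the left mark from
  anywhere.\<close>

lemma inc_right:
  assumes "zs @ xs \<noteq> []" "length (zs @ xs) \<le> B"
  shows "\<exists>h\<le>length (zs @ xs). rch (Suc (length xs)) (Cfg (MInc b) i (btape (zs @ xs)) (length zs) g j)
    (Leaf (Cfg (MRet b) i (btape (zs @ binc xs)) h g j))"
  using assms
proof (induction xs arbitrary: zs rule: binc.induct)
  case 1
  then have "rch (Suc 0) (Cfg (MInc b) i (btape zs) (length zs) g j) (Leaf (Cfg (MRet b) i (btape (zs @ [True])) (length zs) g j))"
    by (intro reach_act1) (auto simp: btape_end btape_extend)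
  then show ?case by auto
next
  case (2 xs)
  then have "rch (Suc 0) (Cfg (MInc b) i (btape (zs @ False # xs)) (length zs) g j)
     (Leaf (Cfg (MRet b) i (btape (zs @ True # xs)) (length zs) g j))"
    using s01 btape_update[of zs False xs True] by (intro reach_act1) (auto simp: btape_at)
  then show ?case by (auto intro!: exI[of _ "length zs"] elim: reach_mono)
next
  case (3 xs)
  have "\<exists>h\<le>length ((zs @ [False]) @ xs). rch (Suc (length xs)) (Cfg (MInc b) i (btape ((zs @ [False]) @ xs)) (length (zs @ [False])) g j)
    (Leaf (Cfg (MRet b) i (btape ((zs @ [False]) @ binc xs)) h g j))"
    by (rule "3.IH") (use "3.prems" in auto)
  then obtain h where h: "h \<le> length (zs @ True # xs)"
    "rch (Suc (length xs)) (Cfg (MInc b) i (btape (zs @ False # xs)) (Suc (length zs)) g j)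
    (Leaf (Cfg (MRet b) i (btape (zs @ False # binc xs)) h g j))" by auto
  have "rch (Suc (Suc (length xs))) (Cfg (MInc b) i (btape (zs @ True # xs)) (length zs) g j)
    (Leaf (Cfg (MRet b) i (btape (zs @ False # binc xs)) h g j))"
    by (rule reach_act[OF _ _ _ h(2)])
       (use "3.prems" btape_update[of zs True xs False] in \<open>auto simp: btape_at\<close>)
  with h(1) show ?case by auto
qed

lemma inc_full:
  assumes "xs \<noteq> []" "length xs \<le> B"
  shows "rch (2 * length xs + 2) (Cfg (MInc b) i (btape xs) 0 g j)
    (Leaf (Cfg (if b then MClr else MChk) i (btape (binc xs)) 0 g j))"
proof -
  obtain h where h: "h \<le> length xs" and 1: "rch (Suc (length xs)) (Cfg (MInc b) i (btape xs) 0 g j)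
    (Leaf (Cfg (MRet b) i (btape (binc xs)) h g j))"
    using inc_right[of "[]" xs b i] assms by auto
  have 2: "rch h (Cfg (MRet b) i (btape (binc xs)) h g j) (Leaf (Cfg (MRet b) i (btape (binc xs)) 0 g j))"
    by (rule seek_left) (use h assms in \<open>auto simp: btape_def\<close>)
  have 3: "rch 1 (Cfg (MRet b) i (btape (binc xs)) 0 g j) (Leaf (Cfg (if b then MClr else MChk) i (btape (binc xs)) 0 g j))"
    unfolding One_nat_def by (rule reach_act1) (auto simp: btape_def fun_eq_iff)
  show ?thesis
    by (rule reach_mono[OF reach_seq[OF reach_seq[OF 1 2] 3]]) (use h in simp)
qed

text \<open>With the input head at cell \<open>i\<close>, the cells 0 to \<open>i - 1\<close> have
  been counted. The last increment happens on the right end marker \<open>length x + 1\<close> and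
  yields \<open>length x + 2\<close>.\<close>

lemma count_loop:
  assumes "i + k = length x + 1" "1 \<le> i"
  shows "rch (Suc k * (2 * B + 3)) (Cfg MChk i (btape (count i)) 0 g j)
    (Leaf (Cfg MClr (length x + 1) (btape (count (length x + 2))) 0 g j))"
  using assms
proof (induction k arbitrary: i)
  case 0
  have ne: "count i \<noteq> []" using 0 by (cases i) (auto simp: count_Suc)
  have le: "length (count i) \<le> B"
    using floorlog_mono[of i "length x + 2" 2] B 0 by (simp add: length_count)
  have "rch (Suc (2 * length (count i) + 2)) (Cfg MChk i (btape (count i)) 0 g j)
     (Leaf (Cfg MClr (length x + 1) (btape (binc (count i))) 0 g j))"
    by (rule reach_act[OF _ _ _ inc_full[OF ne le, where b = True and i = "length x + 1", unfolded if_True]])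
       (use 0 in \<open>auto simp: input_sym_def\<close>)
  then show ?case
    using 0 le by (auto simp: count_Suc elim!: reach_mono)
next
  case (Suc k)
  have ne: "count i \<noteq> []" using Suc.prems by (cases i) (auto simp: count_Suc)
  have le: "length (count i) \<le> B"
    using floorlog_mono[of i "length x + 2" 2] B Suc.prems by (simp add: length_count)
  have "rch (Suc (2 * length (count i) + 2)) (Cfg MChk i (btape (count i)) 0 g j)
     (Leaf (Cfg MChk (Suc i) (btape (count (Suc i))) 0 g j))"
    unfolding count_Suc
    by (rule reach_act[OF _ _ _ inc_full[OF ne le, where b = False and i = "Suc i", unfolded if_False]])
       (use Suc.prems in \<open>auto simp: input_sym_def\<close>)
  then have 1: "rch (2 * B + 3) (Cfg MChk i (btape (count i)) 0 g j)
     (Leaf (Cfg MChk (Suc i) (btape (count (Suc i))) 0 g j))"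
    by (rule reach_mono) (use le in simp)
  have 2: "rch (Suc k * (2 * B + 3)) (Cfg MChk (Suc i) (btape (count (Suc i))) 0 g j)
    (Leaf (Cfg MClr (length x + 1) (btape (count (length x + 2))) 0 g j))"
    by (rule Suc.IH) (use Suc.prems in auto)
  from reach_seq[OF 1 2] show ?case by simp
qed

lemma clear_right:
  assumes "length (zs @ xs) \<le> B"
  shows "rch (length xs) (Cfg MClr i (btape (zs @ xs)) (length zs) g j)
    (Leaf (Cfg MClr i (btape (zs @ replicate (length xs) False)) (length (zs @ xs)) g j))"
  using assms
proof (induction xs arbitrary: zs)
  case (Cons b xs)
  have IH: "rch (length xs) (Cfg MClr i (btape ((zs @ [False]) @ xs)) (length (zs @ [False])) g j)
    (Leaf (Cfg MClr i (btape ((zs @ [False]) @ replicate (length xs) False)) (length ((zs @ [False]) @ xs)) g j))"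
    by (rule Cons.IH) (use Cons.prems in auto)
  have "rch (Suc (length xs)) (Cfg MClr i (btape (zs @ b # xs)) (length zs) g j)
    (Leaf (Cfg MClr i (btape ((zs @ [False]) @ replicate (length xs) False)) (length ((zs @ [False]) @ xs)) g j))"
    by (rule reach_act[OF _ _ _ IH])
       (use Cons.prems btape_update[of zs b xs False] in \<open>auto simp: btape_at\<close>)
  then show ?case by simp
qed (simp add: reach_stop)

lemma meas_reach:
  "rch ((length x + 1) * (2 * B + 3) + 2 * B + length x + 4) (Cfg MIni 0 (\<lambda>_. None) 0 g j)
    (Leaf (Cfg (MGo (ini N)) 0 (mtape s0 (length x)) 0 g j))"
proof -
  let ?n = "length x"
  define F where "F = floorlog 2 (?n + 2)"
  have F: "F = length (count (?n + 2))" by (simp add: F_def length_count)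
  have F0: "0 < F" by (simp add: F_def floorlog_def)
  have FB: "F \<le> B" using B by (simp add: F_def)
  have 1: "rch 1 (Cfg MIni 0 (\<lambda>_. None) 0 g j) (Leaf (Cfg MChk 1 (btape (count 1)) 0 g j))"
    unfolding One_nat_def by (rule reach_act1) (auto simp: btape_def fun_eq_iff count_def)
  have 2: "rch (Suc ?n * (2 * B + 3)) (Cfg MChk 1 (btape (count 1)) 0 g j)
    (Leaf (Cfg MClr (?n + 1) (btape (count (?n + 2))) 0 g j))"
    by (rule count_loop) auto
  have 3: "rch F (Cfg MClr (?n + 1) (btape (count (?n + 2))) 0 g j)
     (Leaf (Cfg MClr (?n + 1) (btape (replicate F False)) F g j))"
    using clear_right[of "[]" "count (?n + 2)" "?n + 1"] FB by (simp add: F)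
  have m: "btape (replicate F False) = mtape s0 ?n"
    by (auto simp: btape_def mtape_def fun_eq_iff F_def)
  have 4: "rch 1 (Cfg MClr (?n + 1) (mtape s0 ?n) F g j) (Leaf (Cfg MFin (?n + 1) (mtape s0 ?n) (F - 1) g j))"
    unfolding One_nat_def by (rule reach_act1) (use FB in \<open>auto simp: mtape_def fun_eq_iff F_def\<close>)
  have 5: "rch (F - 1) (Cfg MFin (?n + 1) (mtape s0 ?n) (F - 1) g j) (Leaf (Cfg MFin (?n + 1) (mtape s0 ?n) 0 g j))"
    by (rule seek_left) (use FB in \<open>auto simp: mtape_def\<close>)
  have 6: "rch 1 (Cfg MFin (?n + 1) (mtape s0 ?n) 0 g j) (Leaf (Cfg MRw ?n (mtape s0 ?n) 0 g j))"
    unfolding One_nat_def by (rule reach_act1) (use F0 in \<open>auto simp: mtape_def F_def fun_eq_iff\<close>)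
  have 7: "rch ?n (Cfg MRw ?n (mtape s0 ?n) 0 g j) (Leaf (Cfg MRw 0 (mtape s0 ?n) 0 g j))"
    by (rule seek_input) auto
  have 8: "rch 1 (Cfg MRw 0 (mtape s0 ?n) 0 g j) (Leaf (Cfg (MGo (ini N)) 0 (mtape s0 ?n) 0 g j))"
    unfolding One_nat_def by (rule reach_act1) auto
  show ?thesis
    by (rule reach_mono[OF reach_seq[OF reach_seq[OF reach_seq[OF reach_seq[OF reach_seq[OF reach_seq[OF reach_seq[OF 1 2]
       3[unfolded m]] 4] 5] 6] 7] 8]]) (use F0 FB in simp)
qed

end

lemma fin_meas:
  assumes fin: "fin_mach N Q G" and G: "None \<in> G" "\<And>l. Some (l, s0) \<in> G" "\<And>l. Some (l, s1) \<in> G"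
  shows "\<exists>Q'. fin_mach (meas N s0 s1) Q' G"
proof
  define Q' where "Q' = {MIni, MChk, MClr, MFin, MRw} \<union> range MInc \<union> range MRet \<union> MGo ` Q"
  have mem: "MIni \<in> Q'" "MChk \<in> Q'" "MClr \<in> Q'" "MFin \<in> Q'" "MRw \<in> Q'" "MInc b \<in> Q'" "MRet b \<in> Q'"
    "MGo q \<in> Q' \<longleftrightarrow> q \<in> Q" for b q
    by (auto simp: Q'_def)
  have "shallow (act (meas N s0 s1) q a z b) \<and>
     (\<forall>(q', g', _)\<in>set_tree (act (meas N s0 s1) q a z b). q' \<in> Q' \<and> g' \<in> G)"
    if "q \<in> Q'" "z \<in> G" "out (meas N s0 s1) q = None" for q a z b
  proof (cases q)
    case (MGo p)
    then have p: "p \<in> Q" "z \<in> G" "out N p = None" using that mem by auto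
    then show ?thesis
      using MGo fin_machD(4)[OF fin p] fin_machD(5)[OF fin p] by (auto simp: mem tree.set_map)
  qed (use that G fin_machD(3)[OF fin] in \<open>auto simp: mem split: option.splits\<close>)
  moreover have "finite Q'"
    using fin_machD(1)[OF fin] unfolding Q'_def by simp
  ultimately show "fin_mach (meas N s0 s1) Q' G"
    unfolding fin_mach_def using mem(1) fin_machD(2)[OF fin] by (simp only: meas_simps) blast
qed

lemma meas_lift:
  assumes fin: "fin_mach N Q G" and "good_cfg Q G c" and r: "reach (mstep N x) (\<lambda>c. hd1 c \<le> B) n c D"
  shows "reach (mstep (meas N s0 s1) x) (\<lambda>c. hd1 c \<le> B) n (meas_cfg c) (map_tree meas_cfg D)"
proof -
  have "mstep (meas N s0 s1) x (meas_cfg c) = map_tree meas_cfg (mstep N x c)" for c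
    by (cases c) (auto simp: mstep.simps tree.map_comp intro!: tree.map_cong0)
  then have "reach (mstep (meas N s0 s1) x) (\<lambda>c. hd1 c \<le> B) 1 (meas_cfg c) (map_tree meas_cfg (mstep N x c))"
    if "good_cfg Q G c" "hd1 c \<le> B" for c
    using reach_one[of "\<lambda>c. hd1 c \<le> B" "meas_cfg c" "mstep (meas N s0 s1) x" 0]
      shallow_mstep[OF fin that(1)] that(2) by simp
  from reach_lift[where I = "good_cfg Q G", OF r assms(2) good_cfg_mstep[OF fin] this]
  show ?thesis by simp
qed

lemma solves_meas:
  fixes N :: "('q, 'd mcell) mach"
  assumes fin: "fin_mach N Q G" and G: "None \<in> G" "\<And>l. Some (l, s0) \<in> G" and s01: "s0 \<noteq> s1"
    and sol: "solves N (mtape s0) T L w"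
  shows "solves (meas N s0 s1) (\<lambda>_ _. None)
     (\<lambda>n. (n + 1) * (2 * (T n + (n + 2)) + 3) + 2 * (T n + (n + 2)) + n + 4 + T n) L w"
  unfolding solves_def
proof
  fix x :: "bool list"
  let ?n = "length x" and ?M = "meas N s0 s1"
  define c0 where "c0 = Cfg (ini N) 0 (mtape s0 ?n) 0 (\<lambda>_. False) 0"
  obtain D where D: "reach (mstep N x) (\<lambda>_. True) (T ?n) c0 D" "\<forall>l\<in>set_tree D. out N (st l) \<noteq> None"
    "expect (\<lambda>l. of_bool (out N (st l) \<noteq> Some (x \<in> L))) D \<le> w"
    using sol unfolding solves_def c0_def by blast
  \<comment> \<open>Space is not scarce here: the bound only has to dominate the running time and
    \<open>floorlog 2 (?n + 2)\<close>.\<close>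
  define B where "B = T ?n + (?n + 2)"
  have D': "reach (mstep N x) (\<lambda>c. hd1 c \<le> B) (T ?n) c0 D"
    using reach_heads[OF D(1), of "T ?n"] by (auto simp: c0_def B_def intro: reach_weaken)
  have good: "good_cfg Q G c0"
    using fin_machD(3)[OF fin] G by (auto simp: c0_def good_cfg_def mtape_def)
  have "floorlog 2 (?n + 2) \<le> ?n + 2"
    using floorlog_le_iff[of 2 "?n + 2" "?n + 2"] less_exp[of "?n + 2"] by simp
  then interpret measuring N s0 s1 x B "\<lambda>_. False" 0
    by unfold_locales (use s01 in \<open>auto simp: B_def\<close>)
  have "reach (mstep ?M x) (\<lambda>c. hd1 c \<le> B) ((?n + 1) * (2 * B + 3) + 2 * B + ?n + 4 + T ?n)
     (Cfg (ini ?M) 0 (\<lambda>_. None) 0 (\<lambda>_. False) 0) (map_tree meas_cfg D)"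
    using reach_seq[OF meas_reach meas_lift[OF fin good D', of s0 s1, unfolded c0_def meas_cfg.simps]] by simp
  then have "reach (mstep ?M x) (\<lambda>_. True) ((?n + 1) * (2 * B + 3) + 2 * B + ?n + 4 + T ?n)
     (Cfg (ini ?M) 0 (\<lambda>_. None) 0 (\<lambda>_. False) 0) (map_tree meas_cfg D)"
    by (rule reach_weaken) simp
  then show "\<exists>D. reach (mstep ?M x) (\<lambda>_. True) ((?n + 1) * (2 * (T ?n + (?n + 2)) + 3) + 2 * (T ?n + (?n + 2)) + ?n + 4 + T ?n)
     (Cfg (ini ?M) 0 (\<lambda>_. None) 0 (\<lambda>_. False) 0) D \<and>
     (\<forall>l\<in>set_tree D. out ?M (st l) \<noteq> None) \<and>
     expect (\<lambda>l. of_bool (out ?M (st l) \<noteq> Some (x \<in> L))) D \<le> w"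
    using D(2,3) unfolding B_def by (intro exI[of _ "map_tree meas_cfg D"])
      (auto simp: tree.set_map expect_map simp del: meas_simps)
qed

section \<open>Machines with one bounded and one unbounded binary tape\<close>

text \<open>Both kinds of concrete machines have one tape \<open>A\<close> whose right end can be felt and one tape that
  is too long for that: for catalytic machines \<open>A\<close> is the work tape, for the machines defining BPP
  it is the (empty) catalytic tape. The flag \<open>sw\<close> exchanges the roles of the two tapes.\<close>

definition swap_act :: "bool \<Rightarrow> nat \<times> bool \<times> bool \<times> move \<times> move \<times> move \<Rightarrow> nat \<times> bool \<times> bool \<times> move \<times> move \<times> move" where
  "swap_act sw = (\<lambda>(q, w, c, mi, mw, mc). if sw then (q, c, w, mi, mc, mw) else (q, w, c, mi, mw, mc))"

definition semi_act :: "rmachine \<Rightarrow> bool \<Rightarrow> nat \<Rightarrow> bool option \<Rightarrow> bool \<Rightarrow> bool \<Rightarrow>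
   (nat \<times> bool \<times> bool \<times> move \<times> move \<times> move) tree" where
  "semi_act M sw q s a b = (let w = (if sw then b else a); c = (if sw then a else b) in
     if coin M q s w c
     then Flip (Leaf (swap_act sw (delta M q s w c True))) (Leaf (swap_act sw (delta M q s w c False)))
     else Leaf (swap_act sw (delta M q s w c False)))"

definition semi_out :: "rmachine \<Rightarrow> nat \<Rightarrow> bool option" where
  "semi_out M q = (if q = acc M then Some True else if q = rej M then Some False else None)"

datatype scfg = SCfg (sst: nat) (sip: nat) (stape: "bool list") (shead: nat) (sinf: "nat \<Rightarrow> bool") (sihd: nat)

fun semi_perform :: "bool list \<Rightarrow> scfg \<Rightarrow> nat \<times> bool \<times> bool \<times> move \<times> move \<times> move \<Rightarrow> scfg" where
  "semi_perform x (SCfg q i A h g j) (q', a, b, mi, mA, mB) =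
     SCfg q' (do_move mi i (length x + 1)) (A[h := a]) (do_move mA h (length A - 1)) (g(j := b)) (mv mB j)"

fun semi_step :: "rmachine \<Rightarrow> bool \<Rightarrow> bool list \<Rightarrow> scfg \<Rightarrow> scfg tree" where
  "semi_step M sw x (SCfg q i A h g j) = (if semi_out M q \<noteq> None then Leaf (SCfg q i A h g j)
     else map_tree (semi_perform x (SCfg q i A h g j)) (semi_act M sw q (input_sym x i) (read_cell A h) (g j)))"

declare semi_step.simps [simp del]

lemma shallow_semi_act [simp]: "shallow (semi_act M sw q s a b)"
  by (simp add: semi_act_def Let_def)

lemma shallow_semi_step: "shallow (semi_step M sw x c)"
  by (cases c) (simp add: semi_step.simps)

lemma semi_out_halted: "semi_out M (cstate cf) = None \<longleftrightarrow> \<not> halted M cf"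
  by (simp add: semi_out_def halted_def)

text \<open>With \<open>t\<close> steps to go, the head of the long tape is at least \<open>t\<close> cells away from the right end;
  after the last step only the state matters.\<close>

definition long_tape :: "bool list \<Rightarrow> nat \<Rightarrow> (nat \<Rightarrow> bool) \<Rightarrow> nat \<Rightarrow> nat \<Rightarrow> bool" where
  "long_tape ts h g j t \<longleftrightarrow> g = read_cell ts \<and> j = h \<and> h + t \<le> length ts"

definition semi_rel :: "bool \<Rightarrow> nat \<Rightarrow> config \<Rightarrow> scfg \<Rightarrow> bool" where
  "semi_rel sw t cf c \<longleftrightarrow> cstate cf = sst c \<and> (0 < t \<longrightarrow> ihead cf = sip c \<and>
     (if sw then ctape cf = stape c \<and> chead cf = shead c \<and> long_tape (wtape cf) (whead cf) (sinf c) (sihd c) t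
      else wtape cf = stape c \<and> whead cf = shead c \<and> long_tape (ctape cf) (chead cf) (sinf c) (sihd c) t))"

text \<open>If \<open>t = 0\<close>, the head may be on the last cell, where a right move is clamped
  on the finite tape but not on the infinite one. This is the last step, after which
  \<open>semi_rel\<close> no longer compares tapes.\<close>

lemma long_tape_step:
  assumes "long_tape ts h g j (Suc t)" "0 < t"
  shows "long_tape (ts[h := b]) (do_move m h (length ts - 1)) (g(j := b)) (mv m j) t"
proof -
  have h: "h + Suc t \<le> length ts" "g = read_cell ts" "j = h" using assms by (auto simp: long_tape_def)
  have "read_cell (ts[h := b]) = (read_cell ts)(h := b)"
    using h by (auto simp: read_cell_def fun_eq_iff)
  moreover have "do_move m h (length ts - 1) = mv m h" using h assms(2) by (cases m) auto
  moreover have "mv m h \<le> Suc h" by (rule mv_le)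
  ultimately show ?thesis using h by (auto simp: long_tape_def)
qed

lemma semi_rel_step:
  assumes r: "semi_rel sw (Suc t) cf c"
  shows "rel_tree (semi_rel sw t) (cstep M x cf) (semi_step M sw x c)"
proof (cases c)
  case c: (SCfg q i A h g j)
  have q: "cstate cf = q" "ihead cf = i" using r c by (auto simp: semi_rel_def)
  show ?thesis
  proof (cases "semi_out M q = None")
    case False
    then have "halted M cf" using semi_out_halted[of M cf] q by metis
    with False r show ?thesis by (auto simp: cstep_def c semi_step.simps semi_rel_def long_tape_def split: if_splits)
  next
    case True
    then have nh: "\<not> halted M cf" using semi_out_halted[of M cf] q by simp
    define w where "w = read_cell (wtape cf) (whead cf)"
    define d where "d = read_cell (ctape cf) (chead cf)"
    have rd: "w = (if sw then g j else read_cell A h)" "d = (if sw then read_cell A h else g j)"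
      using r c by (auto simp: semi_rel_def long_tape_def w_def d_def split: if_splits)
    have nx: "semi_rel sw t (apply_act x cf v) (semi_perform x c (swap_act sw v))" for v
    proof -
      obtain q' ww cw mi mw mc where v: "v = (q', ww, cw, mi, mw, mc)" by (cases v)
      show ?thesis
        using r q long_tape_step[of "wtape cf" "whead cf" g j t ww mw] long_tape_step[of "ctape cf" "chead cf" g j t cw mc]
        by (auto simp: v c semi_rel_def apply_act_def swap_act_def)
    qed
    have coin: "cur_coin M x cf = coin M q (input_sym x i) w d"
      by (simp add: cur_coin_def q w_def d_def)
    have nxt: "cnext M x cf rb = apply_act x cf (delta M q (input_sym x i) w d rb)" for rb
      by (simp add: cnext_def q w_def d_def)
    show ?thesis
      using nx True nh by (auto simp: cstep_def coin nxt c semi_step.simps semi_act_def Let_def rd)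
  qed
qed

lemma semi_rel_unfold:
  "semi_rel sw t cf c \<Longrightarrow> rel_tree (semi_rel sw 0) (unfold (cstep M x) t cf) (unfold (semi_step M sw x) t c)"
  by (induction t arbitrary: cf c) (auto intro: rel_tree_bindt[OF semi_rel_step])

definition semi_solves :: "rmachine \<Rightarrow> bool \<Rightarrow> nat \<Rightarrow> (nat \<Rightarrow> nat) \<Rightarrow> bool list set \<Rightarrow> real \<Rightarrow> bool" where
  "semi_solves M sw k T L w \<longleftrightarrow> (\<forall>x. \<exists>D.
     reach (semi_step M sw x) (\<lambda>_. True) (T (length x))
       (SCfg (start M) 0 (replicate (k * floorlog 2 (length x + 2)) False) 0 (\<lambda>_. False) 0) D \<and>
     (\<forall>l\<in>set_tree D. semi_out M (sst l) \<noteq> None) \<and>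
     expect (\<lambda>l. of_bool (semi_out M (sst l) \<noteq> Some (x \<in> L))) D \<le> w)"

lemma rel_tree_leaf: "rel_tree R s t \<Longrightarrow> b \<in> set_tree t \<Longrightarrow> \<exists>a\<in>set_tree s. R a b"
  by (induction rule: tree.rel_induct) auto

lemma semi_solves_unfold:
  fixes x :: "bool list"
  assumes rel: "semi_rel sw T (init_config M s \<tau>) c"
    and halt: "\<forall>r. length r = m \<longrightarrow> halts_within M x s \<tau> r T" and T: "T \<le> m"
    and pr: "prob_rand m (\<lambda>r. (cstate (run M x s \<tau> r T) = acc M) = (x \<in> L)) \<ge> p"
    and wf: "wf_machine M"
  shows "\<exists>D. reach (semi_step M sw x) (\<lambda>_. True) T c D \<and> (\<forall>l\<in>set_tree D. semi_out M (sst l) \<noteq> None) \<and>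
     expect (\<lambda>l. of_bool (semi_out M (sst l) \<noteq> Some (x \<in> L))) D \<le> 1 - p"
proof (intro exI conjI)
  let ?C = "unfold (cstep M x) T (init_config M s \<tau>)" and ?D = "unfold (semi_step M sw x) T c"
  show "reach (semi_step M sw x) (\<lambda>_. True) T c ?D"
    by (rule reach_unfold) (rule shallow_semi_step)
  have rt: "rel_tree (semi_rel sw 0) ?C ?D" by (rule semi_rel_unfold[OF rel])
  then have rs: "rel_tree (\<lambda>a b. cstate a = sst b) ?C ?D"
    by (rule tree.rel_mono_strong) (simp add: semi_rel_def)
  have hl: "\<forall>l\<in>set_tree ?C. halted M l" using halt halts_within_all_iff[OF T] by blast
  show hs: "\<forall>l\<in>set_tree ?D. semi_out M (sst l) \<noteq> None"
  proof
    fix l assume "l \<in> set_tree ?D"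
    then obtain a where "a \<in> set_tree ?C" "cstate a = sst l"
      using rel_tree_leaf[OF rs] by blast
    then show "semi_out M (sst l) \<noteq> None" using hl semi_out_halted[of M a] by auto
  qed
  have "p \<le> expect (\<lambda>a. of_bool ((cstate a = acc M) = (x \<in> L))) ?C"
    using pr prob_rand_run[OF T, of "\<lambda>c. (cstate c = acc M) = (x \<in> L)" M x s \<tau>] by simp
  also have "\<dots> = expect (\<lambda>b. of_bool ((sst b = acc M) = (x \<in> L))) ?D"
    by (rule expect_rel, rule tree.rel_mono_strong[OF rs]) simp
  also have "\<dots> = expect (\<lambda>l. 1 - of_bool (semi_out M (sst l) \<noteq> Some (x \<in> L))) ?D"
    by (rule expect_cong) (use hs wf in \<open>auto simp: semi_out_def wf_machine_def split: if_splits\<close>)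
  finally show "expect (\<lambda>l. of_bool (semi_out M (sst l) \<noteq> Some (x \<in> L))) ?D \<le> 1 - p"
    unfolding expect_compl by simp
qed

lemma read_cell_replicate: "read_cell (replicate m False) = (\<lambda>_. False)"
  by (auto simp: read_cell_def fun_eq_iff)

text \<open>The error bound holds for every initial content, in particular for zeros, which an empty
  tape provides. The catalytic tape has as many cells as there are steps, so it is long enough for
  \<open>long_tape\<close>.\<close>

lemma BPCLP_semi:
  assumes "L \<in> BPCLP \<epsilon> \<delta>"
  shows "\<exists>M k. wf_machine M \<and> semi_solves M False k (\<lambda>n. (n + 2) ^ k) L (1/2 - \<epsilon>)"
proof -
  obtain M k where wf: "wf_machine M" and M: "\<And>x \<tau>. length \<tau> = (length x + 2) ^ k \<Longrightarrow>
      (\<forall>r. length r = 2 ^ ((length x + 2) ^ k) \<longrightarrow>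
         halts_within M x (k * floorlog 2 (length x + 2)) \<tau> r ((length x + 2) ^ k)) \<and>
       prob_rand (2 ^ ((length x + 2) ^ k)) (\<lambda>r. (cstate (run M x (k * floorlog 2 (length x + 2)) \<tau> r ((length x + 2) ^ k)) = acc M) = (x \<in> L)) \<ge> 1/2 + \<epsilon>"
    using assms unfolding BPCLP_def Let_def by blast
  have "semi_solves M False k (\<lambda>n. (n + 2) ^ k) L (1/2 - \<epsilon>)"
    unfolding semi_solves_def
  proof
    fix x :: "bool list"
    define T where "T = (length x + 2) ^ k"
    define s where "s = k * floorlog 2 (length x + 2)"
    have rel: "semi_rel False T (init_config M s (replicate T False)) (SCfg (start M) 0 (replicate s False) 0 (\<lambda>_. False) 0)"
      by (simp add: semi_rel_def init_config_def long_tape_def read_cell_replicate)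
    have "T \<le> 2 ^ T" by (simp add: less_imp_le)
    moreover have M': "(\<forall>r. length r = 2 ^ T \<longrightarrow> halts_within M x s (replicate T False) r T) \<and>
       prob_rand (2 ^ T) (\<lambda>r. (cstate (run M x s (replicate T False) r T) = acc M) = (x \<in> L)) \<ge> 1/2 + \<epsilon>"
      unfolding T_def s_def by (rule M) simp
    moreover have e: "1 - (1/2 + \<epsilon>) = 1/2 - \<epsilon>" by simp
    ultimately show "\<exists>D. reach (semi_step M False x) (\<lambda>_. True) ((length x + 2) ^ k)
       (SCfg (start M) 0 (replicate (k * floorlog 2 (length x + 2)) False) 0 (\<lambda>_. False) 0) D \<and>
     (\<forall>l\<in>set_tree D. semi_out M (sst l) \<noteq> None) \<and>
     expect (\<lambda>l. of_bool (semi_out M (sst l) \<noteq> Some (x \<in> L))) D \<le> 1/2 - \<epsilon>"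
      unfolding T_def[symmetric] s_def[symmetric] e[symmetric]
      by (intro semi_solves_unfold[OF rel conjunct1[OF M'] _ conjunct2[OF M'] wf])
  qed
  then show ?thesis using wf by blast
qed

text \<open>Here the work tape is the long one, with one cell per step, and the bounded tape is the
  empty catalytic tape: hence \<open>True\<close> for the exchange and 0 for
  \<open>k\<close>.\<close>

lemma BPP_semi:
  assumes "L \<in> BPP"
  shows "\<exists>M k. wf_machine M \<and> semi_solves M True 0 (\<lambda>n. (n + 2) ^ k) L (1/3)"
proof -
  obtain M k where wf: "wf_machine M" and M: "\<And>x.
      (\<forall>r. length r = (length x + 2) ^ k \<longrightarrow>
         halts_within M x ((length x + 2) ^ k) [] r ((length x + 2) ^ k)) \<and>
       prob_rand ((length x + 2) ^ k) (\<lambda>r. (cstate (run M x ((length x + 2) ^ k) [] r ((length x + 2) ^ k)) = acc M) = (x \<in> L)) \<ge> 2/3"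
    using assms unfolding BPP_def Let_def by blast
  have "semi_solves M True 0 (\<lambda>n. (n + 2) ^ k) L (1/3)"
    unfolding semi_solves_def
  proof
    fix x :: "bool list"
    define T where "T = (length x + 2) ^ k"
    have rel: "semi_rel True T (init_config M T []) (SCfg (start M) 0 [] 0 (\<lambda>_. False) 0)"
      by (simp add: semi_rel_def init_config_def long_tape_def read_cell_replicate)
    have M': "(\<forall>r. length r = T \<longrightarrow> halts_within M x T [] r T) \<and>
       prob_rand T (\<lambda>r. (cstate (run M x T [] r T) = acc M) = (x \<in> L)) \<ge> 2/3"
      unfolding T_def by (rule M)
    have e: "(1/3 :: real) = 1 - 2/3" by simp
    show "\<exists>D. reach (semi_step M True x) (\<lambda>_. True) ((length x + 2) ^ k)
       (SCfg (start M) 0 (replicate (0 * floorlog 2 (length x + 2)) False) 0 (\<lambda>_. False) 0) D \<and>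
     (\<forall>l\<in>set_tree D. semi_out M (sst l) \<noteq> None) \<and>
     expect (\<lambda>l. of_bool (semi_out M (sst l) \<noteq> Some (x \<in> L))) D \<le> 1/3"
      unfolding T_def[symmetric] e mult_0 replicate_0
      by (rule semi_solves_unfold[OF rel conjunct1[OF M'] order_refl conjunct2[OF M'] wf])
  qed
  then show ?thesis using wf by blast
qed

text \<open>Tape \<open>A\<close> has \<open>k * floorlog 2 (n + 2)\<close> cells; it is stored in the measured cells, \<open>k\<close> bits
  per cell, and the first blank cell shows where its right end is.\<close>

datatype group_st = GSim nat nat | GCk nat

text \<open>A move out of a group to the right may enter a blank cell; \<open>GCk\<close> then steps
  back to offset \<open>k - 1\<close>, which imitates clamping at the last cell of \<open>A\<close>.
  At the left end the mark \<open>l\<close> does this. For \<open>k = 0\<close> the tape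
  \<open>A\<close> has no cells and the head rests.\<close>

definition group_move :: "nat \<Rightarrow> bool \<Rightarrow> nat \<Rightarrow> nat \<Rightarrow> move \<Rightarrow> group_st \<times> move" where
  "group_move k l o' q m = (if k = 0 then (GSim q o', MStay) else case m of
      MStay \<Rightarrow> (GSim q o', MStay)
    | MLeft \<Rightarrow> if 0 < o' then (GSim q (o' - 1), MStay) else if l then (GSim q 0, MStay) else (GSim q (k - 1), MLeft)
    | MRight \<Rightarrow> if Suc o' < k then (GSim q (Suc o'), MStay) else (GCk q, MRight))"

fun group_act :: "rmachine \<Rightarrow> bool \<Rightarrow> nat \<Rightarrow> group_st \<Rightarrow> bool option \<Rightarrow> bool list mcell \<Rightarrow> bool \<Rightarrow>
   (group_st, bool list mcell) action tree" where
  "group_act M sw k (GSim q o') s z y = (case z of None \<Rightarrow> Leaf (GSim q o', z, y, MStay, MStay, MStay)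
     | Some (l, bs) \<Rightarrow> map_tree (\<lambda>(q', a, b, mi, mA, mB).
           (fst (group_move k l o' q' mA), Some (l, bs[o' := a]), b, mi, snd (group_move k l o' q' mA), mB))
         (semi_act M sw q s (read_cell bs o') y))"
| "group_act M sw k (GCk q) s z y = (if z = None then Leaf (GSim q (k - 1), z, y, MStay, MLeft, MStay)
     else Leaf (GSim q 0, z, y, MStay, MStay, MStay))"

fun group_out :: "rmachine \<Rightarrow> group_st \<Rightarrow> bool option" where
  "group_out M (GSim q _) = semi_out M q"
| "group_out M (GCk q) = None"

definition group_mach :: "rmachine \<Rightarrow> bool \<Rightarrow> nat \<Rightarrow> (group_st, bool list mcell) mach" where
  "group_mach M sw k = \<lparr>ini = GSim (start M) 0, out = group_out M, act = group_act M sw k\<rparr>"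

lemma group_mach_simps [simp]:
  "ini (group_mach M sw k) = GSim (start M) 0" "out (group_mach M sw k) = group_out M"
  "act (group_mach M sw k) = group_act M sw k"
  by (auto simp: group_mach_def)

definition chunk :: "nat \<Rightarrow> bool list \<Rightarrow> nat \<Rightarrow> bool list" where
  "chunk k A p = map (\<lambda>i. A ! (k * p + i)) [0..<k]"

definition gtape :: "nat \<Rightarrow> nat \<Rightarrow> bool list \<Rightarrow> nat \<Rightarrow> bool list mcell" where
  "gtape k F A p = (if p < F then Some (p = 0, chunk k A p) else None)"

fun group_cfg :: "nat \<Rightarrow> nat \<Rightarrow> scfg \<Rightarrow> (group_st, bool list mcell) cfg" where
  "group_cfg k F (SCfg q i A h g j) = Cfg (GSim q (h mod k)) i (gtape k F A) (h div k) g j"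

lemma chunk_update:
  assumes "u < k" "k * p + u < length A"
  shows "chunk k (A[k * p + u := a]) p' = (if p' = p then (chunk k A p)[u := a] else chunk k A p')"
proof (rule nth_equalityI)
  fix i assume "i < length (chunk k (A[k * p + u := a]) p')"
  then have i: "i < k" by (simp add: chunk_def)
  have "k * p' + i = k * p + u \<longleftrightarrow> p' = p \<and> i = u"
  proof
    assume e: "k * p' + i = k * p + u"
    have "(k * p' + i) div k = p'" "(k * p + u) div k = p" using i assms by auto
    with e have "p' = p" by simp
    with e show "p' = p \<and> i = u" by simp
  qed simp
  then show "chunk k (A[k * p + u := a]) p' ! i = (if p' = p then (chunk k A p)[u := a] else chunk k A p') ! i"
    using i assms by (auto simp: chunk_def nth_list_update)
qed (simp add: chunk_def)

lemma gtape_update: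
  assumes "u < k" "p < F" "length A = k * F"
  shows "(gtape k F A)(p := Some (p = 0, (chunk k A p)[u := a])) = gtape k F (A[k * p + u := a])"
proof -
  have "k * p + u < k * Suc p" using assms by simp
  also have "\<dots> \<le> k * F" using assms by (intro mult_le_mono) auto
  finally have "k * p + u < length A" using assms by simp
  from chunk_update[OF assms(1) this] show ?thesis using assms(2) by (auto simp: gtape_def fun_eq_iff)
qed

text \<open>Only leaving a group to the right costs a further step, the inspection of the cell
  entered; in the other cases the target is already reached.\<close>

lemma group_move_reach:
  assumes k: "0 < k" "u < k" "p < F" and h: "h' = do_move m (k * p + u) (k * F - 1)"
  shows "reach (mstep (group_mach M sw k) x) (\<lambda>_. True) 1
    (Cfg (fst (group_move k (p = 0) u q m)) i (gtape k F A) (mv (snd (group_move k (p = 0) u q m)) p) g j)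
    (Leaf (Cfg (GSim q (h' mod k)) i (gtape k F A) (h' div k) g j))"
proof -
  have pF: "k * Suc p \<le> k * F" using k by (intro mult_le_mono) auto
  have dm: "(k * r + v) mod k = v" "(k * r + v) div k = r" if "v < k" for v r
    using that by auto
  have d: "m = MStay \<or> m = MLeft \<or> m = MRight" "u = 0 \<or> 0 < u" "p = 0 \<or> 0 < p"
    "Suc u < k \<or> Suc u = k" "Suc p < F \<or> Suc p = F"
    by (meson move.exhaust) (use k in linarith)+
  consider "m = MStay" | "m = MLeft" "0 < u" | "m = MLeft" "u = 0" "p = 0" | "m = MLeft" "u = 0" "0 < p"
    | "m = MRight" "Suc u < k" | "m = MRight" "Suc u = k" "Suc p < F" | "m = MRight" "Suc u = k" "Suc p = F"
    using d by blast
  then show ?thesis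
  proof cases
    case 1
    then show ?thesis using k h by (simp add: group_move_def reach_stop)
  next
    case 2
    then have "h' = k * p + (u - 1)" using h by simp
    then have "h' mod k = u - 1" "h' div k = p" using dm[of "u - 1" p] k by auto
    then show ?thesis using 2 k by (simp add: group_move_def reach_stop)
  next
    case 3
    then show ?thesis using k h by (simp add: group_move_def reach_stop)
  next
    case 4
    then obtain p' where p': "p = Suc p'" by (cases p) auto
    have "h' = k * p' + (k - 1)" using h 4 p' k by simp
    then have "h' mod k = k - 1" "h' div k = p'" using dm[of "k - 1" p'] k by auto
    then show ?thesis using 4 k p' by (simp add: group_move_def reach_stop)
  next
    case 5
    then have "h' = k * p + Suc u" using h pF by simp
    then have "h' mod k = Suc u" "h' div k = p" using dm[of "Suc u" p] 5 by auto
    then show ?thesis using 5 k by (simp add: group_move_def reach_stop)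
  next
    case 6
    have "k * Suc (Suc p) \<le> k * F" using 6 by (intro mult_le_mono) auto
    then have "h' = k * Suc p" using h 6 k by auto
    then have "h' mod k = 0" "h' div k = Suc p" using k by auto
    then show ?thesis
      unfolding One_nat_def
      by (simp add: group_move_def 6) (use 6 k in \<open>auto intro!: reach_act1 simp: gtape_def fun_eq_iff\<close>)
  next
    case 7
    then have "k * F = k * p + k" by (metis mult_Suc_right add.commute)
    then have "h' = k * p + (k - 1)" using h 7 k by auto
    then have "h' mod k = k - 1" "h' div k = p" using dm[of "k - 1" p] k by auto
    then show ?thesis
      unfolding One_nat_def
      by (simp add: group_move_def 7) (use 7 k in \<open>auto intro!: reach_act1 simp: gtape_def fun_eq_iff\<close>)
  qed
qed

text \<open>For \<open>k = 0\<close> truncated subtraction forces the head to 0, and by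
  \<open>0 div 0 = 0\<close> and \<open>0 mod 0 = 0\<close> it is represented in the first cell at
  offset 0.\<close>

definition semi_ok :: "nat \<Rightarrow> nat \<Rightarrow> scfg \<Rightarrow> bool" where
  "semi_ok k F c \<longleftrightarrow> length (stape c) = k * F \<and> shead c \<le> k * F - 1"

lemma semi_ok_step: "semi_ok k F c \<Longrightarrow> c' \<in> set_tree (semi_step M sw x c) \<Longrightarrow> semi_ok k F c'"
  by (cases c) (auto simp: semi_step.simps semi_ok_def tree.set_map do_move_def split: if_splits move.splits)

lemma group_sim:
  assumes ok: "semi_ok k F c" and F: "0 < F"
  shows "reach (mstep (group_mach M sw k) x) (\<lambda>_. True) 2 (group_cfg k F c)
     (map_tree (group_cfg k F) (semi_step M sw x c))"
proof (cases c)
  case c: (SCfg q i A h g j)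
  show ?thesis
  proof (cases "semi_out M q")
    case (Some v)
    then show ?thesis by (simp add: c semi_step.simps reach_stop)
  next
    case None
    have A: "length A = k * F" "h \<le> k * F - 1" using ok c by (auto simp: semi_ok_def)
    define p where "p = h div k"
    define u where "u = h mod k"
    have h: "h = k * p + u" by (simp add: p_def u_def)
    have uk: "u < k" if "0 < k" using that by (simp add: u_def)
    have pF: "p < F"
    proof (cases "k = 0")
      case False
      then have "0 < k * F" using F by simp
      then have "h < k * F" using A(2) by linarith
      then show ?thesis unfolding p_def by (simp add: less_mult_imp_div_less mult.commute)
    qed (use F in \<open>simp add: p_def\<close>)
    have rd: "read_cell (chunk k A p) u = read_cell A h"
    proof (cases "k = 0")
      case False
      have "k * p + u < k * Suc p" using uk False by simp
      also have "\<dots> \<le> k * F" using pF by (intro mult_le_mono) auto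
      finally show ?thesis using uk False A(1) by (simp add: read_cell_def chunk_def h)
    qed (use A in \<open>simp add: read_cell_def chunk_def\<close>)
    define t where "t = semi_act M sw q (input_sym x i) (read_cell A h) (g j)"
    define f :: "nat \<times> bool \<times> bool \<times> move \<times> move \<times> move \<Rightarrow> (group_st, bool list mcell) action"
      where "f = (\<lambda>(q', a, b, mi, mA, mB). (fst (group_move k (p = 0) u q' mA),
       Some (p = 0, (chunk k A p)[u := a]), b, mi, snd (group_move k (p = 0) u q' mA), mB))"
    have ms: "mstep (group_mach M sw k) x (group_cfg k F c) = map_tree (perform x (group_cfg k F c)) (map_tree f t)"
      using None pF rd by (simp add: c mstep.simps t_def f_def gtape_def p_def[symmetric] u_def[symmetric])
    have 1: "reach (mstep (group_mach M sw k) x) (\<lambda>_. True) 1 (group_cfg k F c) (mstep (group_mach M sw k) x (group_cfg k F c))"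
      unfolding One_nat_def by (rule reach_one) (simp_all add: ms t_def)
    have 2: "reach (mstep (group_mach M sw k) x) (\<lambda>_. True) 1 (perform x (group_cfg k F c) (f v))
       (Leaf (group_cfg k F (semi_perform x c v)))" for v
    proof -
      obtain q' a b mi mA mB where v: "v = (q', a, b, mi, mA, mB)" by (cases v)
      show ?thesis
      proof (cases "k = 0")
        case True
        then have "h = 0" "A = []" using A by auto
        moreover from this have "do_move mA 0 0 = (0 :: nat)" by (cases mA) auto
        moreover have "(gtape 0 F [])(0 := Some (True, [])) = gtape 0 F []"
          using F by (auto simp: gtape_def chunk_def fun_eq_iff)
        ultimately show ?thesis
          using True by (simp add: v c f_def p_def u_def group_move_def chunk_def reach_stop)
      next
        case False
        show ?thesis
          using group_move_reach[OF _ uk pF refl, of M sw x q' mA "do_move mi i (length x + 1)" "A[h := a]" "g(j := b)" "mv mB j"]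
            False gtape_update[OF uk pF A(1), of a] A(1)
          by (simp add: v c f_def p_def[symmetric] u_def[symmetric] h[symmetric])
      qed
    qed
    have "reach (mstep (group_mach M sw k) x) (\<lambda>_. True) (1 + 1) (group_cfg k F c) (bindt t (\<lambda>v. Leaf (group_cfg k F (semi_perform x c v))))"
      by (rule reach_bind_map[OF 1]) (use 2 in \<open>auto simp: ms tree.map_comp comp_def\<close>)
    moreover have "bindt t (\<lambda>v. Leaf (group_cfg k F (semi_perform x c v))) = map_tree (group_cfg k F) (semi_step M sw x c)"
      using None by (simp add: c semi_step.simps t_def[symmetric] tree.map_comp bindt_Leaf_map comp_def)
    ultimately show ?thesis by (simp add: numeral_2_eq_2)
  qed
qed

lemma fin_machI:
  assumes "finite Q" "finite G" "ini M \<in> Q"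
    and "\<And>q a g b. q \<in> Q \<Longrightarrow> g \<in> G \<Longrightarrow> out M q = None \<Longrightarrow> shallow (act M q a g b) \<and>
        (\<forall>(q', g', _)\<in>set_tree (act M q a g b). q' \<in> Q \<and> g' \<in> G)"
  shows "fin_mach M Q G"
  unfolding fin_mach_def by (intro conjI ballI allI impI assms)

lemma fin_group:
  assumes wf: "wf_machine M"
  shows "\<exists>Q. fin_mach (group_mach M sw k) Q (insert None (Some ` (UNIV \<times> {bs. length bs \<le> Suc k})))"
proof
  let ?G = "insert None (Some ` (UNIV \<times> {bs. length bs \<le> Suc k})) :: bool list mcell set"
  define Q where "Q = (\<lambda>(q, u). GSim q u) ` ({..<nstates M} \<times> {..k}) \<union> GCk ` {..<nstates M}"
  have mem: "GSim q u \<in> Q \<longleftrightarrow> q < nstates M \<and> u \<le> k" "GCk q \<in> Q \<longleftrightarrow> q < nstates M" for q u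
    by (auto simp: Q_def)
  have q': "q' < nstates M" if "q < nstates M" "(q', r) \<in> set_tree (semi_act M sw q s a b)" for q q' r s a b
  proof -
    have "fst (swap_act sw v) = fst v" for v by (cases v) (simp add: swap_act_def)
    moreover have "\<exists>a c b. (q', r) = swap_act sw (delta M q s a c b)"
      using that(2) by (auto simp: semi_act_def Let_def split: if_splits)
    ultimately show ?thesis using wf that(1) unfolding wf_machine_def by (metis fst_conv)
  qed
  have gm: "fst (group_move k l u q m) \<in> Q" if "q < nstates M" "u \<le> k" for l u q m
    using that by (auto simp: group_move_def mem split: move.splits)
  have A: "shallow (act (group_mach M sw k) q a z b) \<and>
     (\<forall>(q', g', _)\<in>set_tree (act (group_mach M sw k) q a z b). q' \<in> Q \<and> g' \<in> ?G)"
    if "q \<in> Q" "z \<in> ?G" for q a z b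
  proof (cases q)
    case (GSim p u)
    then have p: "p < nstates M" "u \<le> k" using that mem by auto
    show ?thesis
    proof (cases z)
      case (Some lb)
      obtain l bs where lb: "lb = (l, bs)" by (cases lb)
      show ?thesis
        using that(2) GSim p Some lb by (auto simp: tree.set_map intro!: gm dest: q'[OF p(1)])
    qed (use that GSim in auto)
  qed (use that mem in auto)
  have Q: "finite Q" by (simp add: Q_def)
  have G: "finite ?G"
    using finite_lists_length_le[of "UNIV :: bool set" "Suc k"] by simp
  have I: "ini (group_mach M sw k) \<in> Q" using wf by (simp add: mem wf_machine_def)
  show "fin_mach (group_mach M sw k) Q ?G"
    by (rule fin_machI[OF Q G I]) (rule A)
qed

lemma solves_group:
  assumes "semi_solves M sw k T L w"
  shows "solves (group_mach M sw k) (mtape (replicate k False)) (\<lambda>n. 2 * T n) L w"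
  unfolding solves_def
proof
  fix x :: "bool list"
  let ?n = "length x" and ?M = "group_mach M sw k"
  define F where "F = floorlog 2 (?n + 2)"
  define c0 where "c0 = SCfg (start M) 0 (replicate (k * F) False) 0 (\<lambda>_. False) 0"
  have F: "0 < F" by (simp add: F_def floorlog_def)
  obtain D where D: "reach (semi_step M sw x) (\<lambda>_. True) (T ?n) c0 D"
    "\<forall>l\<in>set_tree D. semi_out M (sst l) \<noteq> None" "expect (\<lambda>l. of_bool (semi_out M (sst l) \<noteq> Some (x \<in> L))) D \<le> w"
    using assms unfolding semi_solves_def c0_def F_def by blast
  have "chunk k (replicate (k * F) False) p = replicate k False" if "p < F" for p
  proof (rule nth_equalityI)
    fix i assume "i < length (chunk k (replicate (k * F) False) p)"
    then have i: "i < k" by (simp add: chunk_def)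
    then have "k * p + i < k * Suc p" by simp
    also have "\<dots> \<le> k * F" using that by (intro mult_le_mono) auto
    finally show "chunk k (replicate (k * F) False) p ! i = replicate k False ! i"
      using i by (simp add: chunk_def)
  qed (simp add: chunk_def)
  then have c0: "group_cfg k F c0 = Cfg (ini ?M) 0 (mtape (replicate k False) ?n) 0 (\<lambda>_. False) 0"
    by (auto simp: c0_def gtape_def mtape_def F_def fun_eq_iff)
  have "reach (mstep ?M x) (\<lambda>_. True) (2 * T ?n) (group_cfg k F c0) (map_tree (group_cfg k F) D)"
  proof (rule reach_lift[where I = "semi_ok k F", OF D(1)])
    show "semi_ok k F c0" by (simp add: semi_ok_def c0_def)
  qed (auto intro: semi_ok_step group_sim[OF _ F])
  moreover have "group_out M (st (group_cfg k F c)) = semi_out M (sst c)" for c by (cases c) simp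
  ultimately show "\<exists>D. reach (mstep ?M x) (\<lambda>_. True) (2 * T ?n) (Cfg (ini ?M) 0 (mtape (replicate k False) ?n) 0 (\<lambda>_. False) 0) D \<and>
     (\<forall>l\<in>set_tree D. out ?M (st l) \<noteq> None) \<and> expect (\<lambda>l. of_bool (out ?M (st l) \<noteq> Some (x \<in> L))) D \<le> w"
    using D(2,3) unfolding c0 by (intro exI[of _ "map_tree (group_cfg k F) D"]) (auto simp: tree.set_map expect_map)
qed

section \<open>Simulation on one binary tape, with small error\<close>

lemma (in encoding) solves_emach:
  assumes sol: "solves M (\<lambda>_ _. blank) T L w"
  shows "solves emach (\<lambda>_ _. False) (\<lambda>n. 3 * D * T n) L w"
  unfolding solves_def
proof
  fix x :: "bool list"
  let ?n = "length x"
  define c0 where "c0 = Cfg (ini M) 0 (\<lambda>_. blank) 0 (\<lambda>_. False) 0"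
  obtain E where E: "reach (mstep M x) (\<lambda>_. True) (T ?n) c0 E"
    "\<forall>l\<in>set_tree E. out M (st l) \<noteq> None" "expect (\<lambda>l. of_bool (out M (st l) \<noteq> Some (x \<in> L))) E \<le> w"
    using sol unfolding solves_def c0_def by blast
  have E': "reach (mstep M x) (\<lambda>c. True \<and> hd1 c < T ?n \<and> hd2 c < T ?n) (T ?n) c0 E"
    using reach_heads[OF E(1), of "T ?n"] by (simp add: c0_def)
  have "good_cfg Q G c0" using blank fin_machD(3)[OF fin] by (simp add: good_cfg_def c0_def)
  moreover have "D * (hd1 c + 1) \<le> D * T ?n" if "True \<and> hd1 c < T ?n \<and> hd2 c < T ?n" for c :: "('q, 'g) cfg"
    using that by (intro mult_le_mono) auto
  ultimately have "reach (mstep emach x) (\<lambda>c. hd1 c \<le> D * T ?n) (3 * D * T ?n) (enc_cfg c0) (map_tree enc_cfg E)"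
    by (rule enc_reach[OF E'])
  then have "reach (mstep emach x) (\<lambda>_. True) (3 * D * T ?n) (Cfg (ini emach) 0 (\<lambda>_. False) 0 (\<lambda>_. False) 0) (map_tree enc_cfg E)"
    unfolding c0_def enc_init by (rule reach_weaken) simp
  then show "\<exists>E. reach (mstep emach x) (\<lambda>_. True) (3 * D * T ?n) (Cfg (ini emach) 0 (\<lambda>_. False) 0 (\<lambda>_. False) 0) E \<and>
     (\<forall>l\<in>set_tree E. out emach (st l) \<noteq> None) \<and>
     expect (\<lambda>l. of_bool (out emach (st l) \<noteq> Some (x \<in> L))) E \<le> w"
    using E(2,3) by (intro exI[of _ "map_tree enc_cfg E"]) (auto simp: tree.set_map expect_map simp del: emach_simps)
qed

text \<open>Amplification needs a machine with one tape, so the sweep precedes it; the binary code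
  comes last, as the stages before it use larger alphabets. The state type is spelled out because an
  existential statement cannot range over types.\<close>

lemma semi_to_binary:
  assumes wf: "wf_machine M" and sol: "semi_solves M sw k T L w" and T: "poly T"
    and w: "0 \<le> w" "w < 1/2" and eta: "0 < eta"
  shows "\<exists>(N :: ((group_st meas_st, bool list mcell) sweep_st amp_st enc_st, bool) mach) Q U.
     fin_mach N Q UNIV \<and> single N \<and> poly U \<and> solves N (\<lambda>_ _. False) U L eta"
proof -
  let ?G1 = "insert None (Some ` (UNIV \<times> {bs. length bs \<le> Suc k})) :: bool list mcell set"
  \<comment> \<open>\<open>?s0\<close> is the blank group of \<open>k\<close> bits with which the
    simulation starts. The greater length makes \<open>?s1\<close> distinct even for
    \<open>k = 0\<close>.\<close>
  let ?s0 = "replicate k False" and ?s1 = "replicate (Suc k) False"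
  have "length ?s0 \<noteq> length ?s1" by simp
  then have s01: "?s0 \<noteq> ?s1" by metis
  obtain Q1 where f1: "fin_mach (group_mach M sw k) Q1 ?G1" using fin_group[OF wf] by blast
  define M2 where "M2 = meas (group_mach M sw k) ?s0 ?s1"
  obtain Q2 where f2: "fin_mach M2 Q2 ?G1"
    using fin_meas[OF f1, of ?s0 ?s1] unfolding M2_def by auto
  define T2 where "T2 n = (n + 1) * (2 * (2 * T n + (n + 2)) + 3) + 2 * (2 * T n + (n + 2)) + n + 4 + 2 * T n" for n
  have s2: "solves M2 (\<lambda>_ _. None) T2 L w"
    unfolding M2_def T2_def by (rule solves_meas[OF f1 _ _ s01 solves_group[OF sol]]) auto
  have p2: "poly T2" unfolding T2_def by (intro poly_intros T)
  define M3 where "M3 = sweep M2 None"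
  obtain Q3 where f3: "fin_mach M3 Q3 (?G1 \<times> UNIV)"
    using fin_sweep[OF f2, of None] unfolding M3_def by auto
  define b3 :: "bool list mcell cell2" where "b3 = (None, False, False, False, False)"
  define T3 where "T3 n = 1 + (4 * T2 n + 8) * T2 n" for n
  have s3: "solves M3 (\<lambda>_ _. b3) T3 L w"
    unfolding M3_def T3_def b3_def by (rule solves_sweep[OF f2 _ s2]) simp
  have b3: "b3 \<in> ?G1 \<times> UNIV" by (simp add: b3_def)
  have g3: "single M3" by (simp add: M3_def single_sweep)
  obtain N where N: "0 < N" and s4: "solves (amp M3 b3 N) (\<lambda>_ _. (replicate N b3, False)) (\<lambda>n. 1 + N * (2 * T3 n + n + 3)) L eta"
    using solves_amp[OF f3 b3 g3 s3 w eta] by blast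
  obtain Q4 where f4: "fin_mach (amp M3 b3 N) Q4 ({us. set us \<subseteq> ?G1 \<times> UNIV \<and> length us = N} \<times> UNIV)"
    using fin_amp[OF f3 b3 N] by blast
  have "(replicate N b3, False) \<in> {us. set us \<subseteq> ?G1 \<times> UNIV \<and> length us = N} \<times> UNIV"
    using b3 by auto
  from ex_encoding[OF f4 this] obtain D e where
    enc: "encoding (amp M3 b3 N) Q4 ({us. set us \<subseteq> ?G1 \<times> UNIV \<and> length us = N} \<times> UNIV) (replicate N b3, False) D e"
    by blast
  interpret encoding "amp M3 b3 N" Q4 "{us. set us \<subseteq> ?G1 \<times> UNIV \<and> length us = N} \<times> UNIV" "(replicate N b3, False)" D e
    by (rule enc)
  obtain Q5 where "fin_mach emach Q5 UNIV" using fin_emach by blast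
  moreover have "single emach" by (rule single_emach[OF single_amp[OF g3]])
  moreover have "poly (\<lambda>n. 3 * D * (1 + N * (2 * T3 n + n + 3)))"
    unfolding T3_def by (intro poly_intros p2)
  moreover note solves_emach[OF s4]
  ultimately show ?thesis by blast
qed

lemma BPCLP_subset_BPP:
  assumes "0 < \<epsilon>" "\<epsilon> \<le> 1/2"
  shows "BPCLP \<epsilon> \<delta> \<subseteq> BPP"
proof
  fix L assume "L \<in> BPCLP \<epsilon> \<delta>"
  then obtain M k where M: "wf_machine M" "semi_solves M False k (\<lambda>n. (n + 2) ^ k) L (1/2 - \<epsilon>)"
    using BPCLP_semi by blast
  have p: "poly (\<lambda>n. (n + 2) ^ k)" by (intro poly_intros)
  have w: "0 \<le> 1/2 - \<epsilon>" "1/2 - \<epsilon> < 1/2" using assms by auto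
  obtain N :: "((group_st meas_st, bool list mcell) sweep_st amp_st enc_st, bool) mach" and Q U
    where N: "fin_mach N Q UNIV" "single N" "poly U" "solves N (\<lambda>_ _. False) U L (1/3)"
    using semi_to_binary[OF M p w, of "1/3"] by auto
  obtain f where "concretize N Q f" using ex_concretize[OF N(1)] by blast
  then show "L \<in> BPP" using concretize.BPP_I N(2-4) by blast
qed

section \<open>Running a machine on a dirty tape\<close>

text \<open>With probability \<open>a / 2 ^ m\<close> the machine wipes the catalytic tape and runs \<open>N\<close> on it;
  otherwise it leaves the tape alone and answers at random. A counter in base \<open>b\<close> on the measured
  cells serves as a clock: in its first period the head of the catalytic tape moves right, writing
  zeros, in its second period it returns.\<close>

datatype 'q clk_st = KBr nat nat | KRnd | KTk bool | KIc bool | KRt bool | KRo bool | KSim 'q | KOut bool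

text \<open>In \<open>KBr m u\<close>, \<open>m\<close> flips remain and \<open>u\<close> is the
  binary number formed so far. A carry that arrives at a blank cell ends a period and leads to
  \<open>KRo\<close>. In \<open>KSim\<close> the catalytic tape is the first tape of
  \<open>N\<close>, and the second tape of \<open>N\<close> is replaced by the constant
  \<open>False\<close>.\<close>

fun clk_act :: "('q, bool) mach \<Rightarrow> nat \<Rightarrow> nat \<Rightarrow> 'q clk_st \<Rightarrow> bool option \<Rightarrow> nat mcell \<Rightarrow> bool \<Rightarrow>
   ('q clk_st, nat mcell) action tree" where
  "clk_act N b a (KBr m u) s z y = (if m = 0 then Leaf (if u < a then KTk False else KRnd, z, y, MStay, MStay, MStay)
     else Flip (Leaf (KBr (m - 1) (2 * u + 1), z, y, MStay, MStay, MStay)) (Leaf (KBr (m - 1) (2 * u), z, y, MStay, MStay, MStay)))"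
| "clk_act N b a KRnd s z y = Flip (Leaf (KOut True, z, y, MStay, MStay, MStay)) (Leaf (KOut False, z, y, MStay, MStay, MStay))"
| "clk_act N b a (KTk ph) s z y = Leaf (KIc ph, z, ph \<and> y, MStay, MStay, if ph then MLeft else MRight)"
| "clk_act N b a (KIc ph) s z y = (case z of None \<Rightarrow> Leaf (KRo ph, z, y, MStay, MLeft, MStay)
     | Some (l, d) \<Rightarrow> if Suc d < b then Leaf (KRt ph, Some (l, Suc d), y, MStay, MStay, MStay)
                    else Leaf (KIc ph, Some (l, 0), y, MStay, MRight, MStay))"
| "clk_act N b a (KRt ph) s z y = (if z \<noteq> None \<and> fst (the z) then Leaf (KTk ph, z, y, MStay, MStay, MStay)
     else Leaf (KRt ph, z, y, MStay, MLeft, MStay))"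
| "clk_act N b a (KRo ph) s z y = (if z \<noteq> None \<and> fst (the z)
     then Leaf (if ph then KSim (ini N) else KTk True, z, y, MStay, MStay, MStay)
     else Leaf (KRo ph, z, y, MStay, MLeft, MStay))"
| "clk_act N b a (KSim q) s z y = map_tree (\<lambda>(q', w, _, mi, m1, _). (KSim q', z, w, mi, MStay, m1)) (act N q s y False)"
| "clk_act N b a (KOut v) s z y = Leaf (KOut v, z, y, MStay, MStay, MStay)"

fun clk_out :: "('q, bool) mach \<Rightarrow> 'q clk_st \<Rightarrow> bool option" where
  "clk_out N (KSim q) = out N q"
| "clk_out N (KOut v) = Some v"
| "clk_out N _ = None"

definition clk :: "('q, bool) mach \<Rightarrow> nat \<Rightarrow> nat \<Rightarrow> nat \<Rightarrow> ('q clk_st, nat mcell) mach" where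
  "clk N b a m = \<lparr>ini = KBr m 0, out = clk_out N, act = clk_act N b a\<rparr>"

lemma clk_simps [simp]:
  "ini (clk N b a m) = KBr m 0" "out (clk N b a m) = clk_out N" "act (clk N b a m) = clk_act N b a"
  by (auto simp: clk_def)

lemma fin_clk:
  assumes fin: "fin_mach N Q UNIV" and b: "2 \<le> b"
  shows "\<exists>Q'. fin_mach (clk N b a m) Q' (insert None (Some ` (UNIV \<times> {..<b})))"
proof
  let ?G = "insert None (Some ` (UNIV \<times> {..<b})) :: nat mcell set"
  \<comment> \<open>After \<open>m - i\<close> flips \<open>u\<close> has at most
    \<open>m - i\<close> binary digits, which bounds the numbers kept in the states.\<close>
  define I where "I = {(i, u). i \<le> m \<and> u < (2::nat) ^ (m - i)}"
  have finI: "finite I"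
  proof (rule finite_subset)
    have "u < 2 ^ m" if "u < (2::nat) ^ (m - i)" for u i
      by (rule less_le_trans[OF that power_increasing]) auto
    then show "I \<subseteq> {..m} \<times> {..2 ^ m}" by (auto simp: I_def less_imp_le)
  qed simp
  define Q' where "Q' = (\<lambda>(i, u). KBr i u) ` I \<union> {KRnd} \<union> range KTk \<union> range KIc \<union> range KRt \<union> range KRo
     \<union> range KOut \<union> KSim ` Q"
  have mem: "KBr i u \<in> Q' \<longleftrightarrow> i \<le> m \<and> u < 2 ^ (m - i)" "KRnd \<in> Q'" "KTk v \<in> Q'" "KIc v \<in> Q'" "KRt v \<in> Q'" "KRo v \<in> Q'"
    "KOut v \<in> Q'" "KSim q \<in> Q' \<longleftrightarrow> q \<in> Q" for i u v q
    unfolding Q'_def I_def by auto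
  have A: "shallow (act (clk N b a m) q s z y) \<and>
     (\<forall>(q', g', _)\<in>set_tree (act (clk N b a m) q s z y). q' \<in> Q' \<and> g' \<in> ?G)"
    if "q \<in> Q'" "z \<in> ?G" "out (clk N b a m) q = None" for q s z y
  proof (cases q)
    case (KSim p)
    then have p: "p \<in> Q" "y \<in> UNIV" "out N p = None" using that mem by auto
    then show ?thesis
      using KSim that(2) fin_machD(4)[OF fin p] fin_machD(5)[OF fin p] by (auto simp: mem tree.set_map)
  next
    case (KBr i u)
    show ?thesis
    proof (cases i)
      case (Suc i')
      have "m - i' = Suc (m - i)" using that KBr Suc by (auto simp: mem)
      then have "(2::nat) ^ (m - i') = 2 * 2 ^ (m - i)" by simp
      then show ?thesis using that KBr Suc by (auto simp: mem)
    qed (use that KBr in \<open>auto simp: mem\<close>)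
  qed (use that fin_machD(3)[OF fin] b in \<open>auto simp: mem split: option.splits\<close>)
  have Q: "finite Q'"
    using fin_machD(1)[OF fin] finI unfolding Q'_def by simp
  have I: "ini (clk N b a m) \<in> Q'" by (simp add: mem)
  have G: "finite ?G" by simp
  show "fin_mach (clk N b a m) Q' ?G"
    by (rule fin_machI[OF Q G I]) (rule A)
qed

section \<open>A clock with a fixed number of digits\<close>

fun digs :: "nat \<Rightarrow> nat \<Rightarrow> nat \<Rightarrow> nat list" where
  "digs b 0 v = []"
| "digs b (Suc F) v = v mod b # digs b F (v div b)"

lemma length_digs [simp]: "length (digs b F v) = F"
  by (induction F arbitrary: v) auto

lemma digs_0: "digs b F 0 = replicate F 0"
  by (induction F) auto

text \<open>Digits are kept modulo \<open>b ^ F\<close>, so after a full period the clock shows zero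
  and the next period starts without a reset.\<close>

lemma digs_overflow: "0 < b \<Longrightarrow> digs b F (b ^ F) = digs b F 0"
  by (induction F) auto

locale clocked =
  fixes N :: "('q, bool) mach" and b a m :: nat and x :: "bool list" and B F :: nat
  assumes b: "2 \<le> b" and F: "0 < F" "F \<le> B"
begin

abbreviation "rch \<equiv> reach (mstep (clk N b a m) x) (\<lambda>c. hd1 c \<le> B)"

definition dtape :: "nat list \<Rightarrow> nat \<Rightarrow> nat mcell" where
  "dtape ds p = (if p < length ds then Some (p = 0, ds ! p) else None)"

lemma dtape_update: "(dtape (zs @ d # ds))(length zs := Some (zs = [], d')) = dtape (zs @ d' # ds)"
  by (auto simp: dtape_def fun_eq_iff nth_append nth_Cons')

lemma dtape_at: "dtape (zs @ d # ds) (length zs) = Some (zs = [], d)"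
  by (auto simp: dtape_def)

text \<open>\<open>zs\<close> are the digits already passed by the carry. With no digit left
  (\<open>f = 0\<close>) the carry has run off the clock, which is the overflow
  \<open>KRo\<close>.\<close>

lemma clk_carry:
  assumes "v < b ^ f" "length zs + f \<le> B"
  shows "\<exists>h\<le>length zs + f. rch (Suc f) (Cfg (KIc ph) i (dtape (zs @ digs b f v)) (length zs) g j)
     (Leaf (Cfg (if Suc v < b ^ f then KRt ph else KRo ph) i (dtape (zs @ digs b f (Suc v))) h g j))"
  using assms
proof (induction f arbitrary: v zs)
  case 0
  have "rch (Suc 0) (Cfg (KIc ph) i (dtape zs) (length zs) g j) (Leaf (Cfg (KRo ph) i (dtape zs) (length zs - 1) g j))"
    by (rule reach_act1) (use 0 in \<open>auto simp: dtape_def fun_eq_iff\<close>)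
  then show ?case by (auto intro!: exI[of _ "length zs - 1"])
next
  case (Suc f)
  have b0: "0 < b" using b by simp
  have vd: "v div b < b ^ f" using Suc.prems(1) by (simp add: less_mult_imp_div_less mult.commute)
  show ?case
  proof (cases "Suc (v mod b) < b")
    case True
    then have e: "Suc v mod b = Suc (v mod b)" "Suc v div b = v div b"
      by (auto simp: mod_Suc div_Suc)
    have "b * (v div b) + Suc (v mod b) < b * Suc (v div b)"
      using True unfolding mult_Suc_right by linarith
    also have "\<dots> \<le> b * b ^ f" using vd by (intro mult_le_mono) auto
    finally have "Suc v < b ^ Suc f" by simp
    moreover have "rch (Suc 0) (Cfg (KIc ph) i (dtape (zs @ digs b (Suc f) v)) (length zs) g j)
       (Leaf (Cfg (KRt ph) i (dtape (zs @ digs b (Suc f) (Suc v))) (length zs) g j))"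
      by (rule reach_act1) (use True Suc.prems in \<open>auto simp: dtape_at dtape_update e\<close>)
    ultimately show ?thesis
      by (intro exI[of _ "length zs"]) (auto elim: reach_mono)
  next
    case False
    then have "Suc (v mod b) = b" using b0 mod_less_divisor[of b v] by linarith
    then have e: "Suc v mod b = 0" "Suc v div b = Suc (v div b)"
      by (auto simp: mod_Suc div_Suc)
    have sv: "Suc v = b * Suc (v div b)"
      using mult_div_mod_eq[of b "Suc v"] e by simp
    have "Suc v < b ^ Suc f \<longleftrightarrow> b * Suc (v div b) < b * b ^ f"
      unfolding power_Suc sv[symmetric] by (rule refl)
    then have lt: "Suc v < b ^ Suc f \<longleftrightarrow> Suc (v div b) < b ^ f"
      using b0 by (simp only: mult_less_cancel1 simp_thms)
    have "\<exists>h\<le>length (zs @ [0]) + f. rch (Suc f) (Cfg (KIc ph) i (dtape ((zs @ [0]) @ digs b f (v div b))) (length (zs @ [0])) g j)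
     (Leaf (Cfg (if Suc (v div b) < b ^ f then KRt ph else KRo ph) i (dtape ((zs @ [0]) @ digs b f (Suc (v div b)))) h g j))"
      by (rule Suc.IH[OF vd]) (use Suc.prems in simp)
    then obtain h where h: "h \<le> length zs + Suc f" and r: "rch (Suc f) (Cfg (KIc ph) i (dtape (zs @ 0 # digs b f (v div b))) (Suc (length zs)) g j)
     (Leaf (Cfg (if Suc (v div b) < b ^ f then KRt ph else KRo ph) i (dtape (zs @ 0 # digs b f (Suc (v div b)))) h g j))"
      by auto
    have "rch (Suc (Suc f)) (Cfg (KIc ph) i (dtape (zs @ digs b (Suc f) v)) (length zs) g j)
      (Leaf (Cfg (if Suc v < b ^ Suc f then KRt ph else KRo ph) i (dtape (zs @ digs b (Suc f) (Suc v))) h g j))"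
      unfolding lt digs.simps e
      by (rule reach_act[OF _ _ _ r]) (use False Suc.prems in \<open>auto simp: dtape_at dtape_update\<close>)
    with h show ?thesis by blast
  qed
qed

lemma clk_tick:
  assumes v: "v < b ^ F"
  shows "rch (2 * F + 3) (Cfg (KTk ph) i (dtape (digs b F v)) 0 g j)
    (Leaf (Cfg (if Suc v < b ^ F then KTk ph else if ph then KSim (ini N) else KTk True) i
       (dtape (digs b F (Suc v))) 0 (if ph then g else g(j := False)) (if ph then j - 1 else Suc j)))"
proof -
  define g' where "g' = (if ph then g else g(j := False))"
  define j' where "j' = (if ph then j - 1 else Suc j)"
  define q where "q = (if Suc v < b ^ F then KRt ph else KRo ph :: 'q clk_st)"
  have 1: "rch 1 (Cfg (KTk ph) i (dtape (digs b F v)) 0 g j) (Leaf (Cfg (KIc ph) i (dtape (digs b F v)) 0 g' j'))"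
    unfolding One_nat_def by (rule reach_act1) (auto simp: g'_def j'_def)
  obtain h where h: "h \<le> F" and 2: "rch (Suc F) (Cfg (KIc ph) i (dtape (digs b F v)) 0 g' j') (Leaf (Cfg q i (dtape (digs b F (Suc v))) h g' j'))"
    using clk_carry[OF v, of "[]" ph i g' j'] F unfolding q_def by auto
  have 3: "rch h (Cfg q i (dtape (digs b F (Suc v))) h g' j') (Leaf (Cfg q i (dtape (digs b F (Suc v))) 0 g' j'))"
    by (rule seek_left) (use h F in \<open>auto simp: dtape_def q_def\<close>)
  have 4: "rch 1 (Cfg q i (dtape (digs b F (Suc v))) 0 g' j')
    (Leaf (Cfg (if Suc v < b ^ F then KTk ph else if ph then KSim (ini N) else KTk True) i (dtape (digs b F (Suc v))) 0 g' j'))"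
    unfolding One_nat_def by (rule reach_act1) (use F in \<open>auto simp: q_def dtape_def fun_eq_iff\<close>)
  show ?thesis
    unfolding g'_def[symmetric] j'_def[symmetric]
    by (rule reach_mono[OF reach_seq[OF reach_seq[OF reach_seq[OF 1 2] 3] 4]]) (use h in simp)
qed

definition zeroed :: "nat \<Rightarrow> (nat \<Rightarrow> bool) \<Rightarrow> nat \<Rightarrow> bool" where
  "zeroed v g p = (p \<ge> v \<and> g p)"

lemma clk_wipe:
  assumes "v + Suc r = b ^ F"
  shows "rch (Suc r * (2 * F + 3)) (Cfg (KTk False) i (dtape (digs b F v)) 0 (zeroed v g) v)
    (Leaf (Cfg (KTk True) i (dtape (digs b F 0)) 0 (zeroed (b ^ F) g) (b ^ F)))"
  using assms
proof (induction r arbitrary: v)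
  case 0
  have z: "(zeroed v g)(v := False) = zeroed (Suc v) g" by (auto simp: zeroed_def fun_eq_iff)
  have "digs b F (Suc v) = digs b F 0" using 0 digs_overflow[of b F] b by simp
  then show ?case using clk_tick[of v False i "zeroed v g" v] 0 by (simp add: z)
next
  case (Suc r)
  have z: "(zeroed v g)(v := False) = zeroed (Suc v) g" by (auto simp: zeroed_def fun_eq_iff)
  have "rch (2 * F + 3) (Cfg (KTk False) i (dtape (digs b F v)) 0 (zeroed v g) v)
     (Leaf (Cfg (KTk False) i (dtape (digs b F (Suc v))) 0 (zeroed (Suc v) g) (Suc v)))"
    using clk_tick[of v False i "zeroed v g" v] Suc.prems by (simp add: z)
  from reach_seq[OF this Suc.IH] Suc.prems show ?case by simp
qed

text \<open>The distance of the head from cell 0 equals the number of ticks left in the period. The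
  clock thus tells when the left end is reached, which nothing on the tape shows.\<close>

lemma clk_return:
  assumes "v + Suc r = b ^ F"
  shows "rch (Suc r * (2 * F + 3)) (Cfg (KTk True) i (dtape (digs b F v)) 0 g (Suc r))
    (Leaf (Cfg (KSim (ini N)) i (dtape (digs b F 0)) 0 g 0))"
  using assms
proof (induction r arbitrary: v)
  case 0
  have "digs b F (Suc v) = digs b F 0" using 0 digs_overflow[of b F] b by simp
  then show ?case using clk_tick[of v True i g "Suc 0"] 0 by simp
next
  case (Suc r)
  have "rch (2 * F + 3) (Cfg (KTk True) i (dtape (digs b F v)) 0 g (Suc (Suc r)))
     (Leaf (Cfg (KTk True) i (dtape (digs b F (Suc v))) 0 g (Suc r)))"
    using clk_tick[of v True i g "Suc (Suc r)"] Suc.prems by simp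
  from reach_seq[OF this Suc.IH] Suc.prems show ?case by simp
qed

fun sim_cfg :: "(nat \<Rightarrow> bool) \<Rightarrow> ('q, bool) cfg \<Rightarrow> ('q clk_st, nat mcell) cfg" where
  "sim_cfg g (Cfg q i f h _ _) = Cfg (KSim q) i (dtape (digs b F 0)) 0 (\<lambda>p. if p < b ^ F then f p else g p) h"

text \<open>Within \<open>T \<le> b ^ F\<close> steps \<open>N\<close> reads only wiped cells; the
  old content beyond them stays unseen and unchanged.\<close>

lemma clk_sim:
  assumes fin: "fin_mach N Q UNIV" and sg: "single N"
    and r: "reach (mstep N x) (\<lambda>_. True) T (Cfg (ini N) 0 (\<lambda>_. False) 0 (\<lambda>_. False) 0) D" and T: "T \<le> b ^ F"
  shows "rch T (Cfg (KSim (ini N)) 0 (dtape (digs b F 0)) 0 (zeroed (b ^ F) g) 0) (map_tree (sim_cfg g) D)"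
proof -
  define c0 where "c0 = Cfg (ini N) 0 (\<lambda>_. False) 0 (\<lambda>_. False) 0"
  define I where "I c \<longleftrightarrow> good_cfg Q UNIV c \<and> aux c = (\<lambda>_. False) \<and> hd2 c = 0" for c :: "('q, bool) cfg"
  have r': "reach (mstep N x) (\<lambda>c. True \<and> hd1 c < b ^ F \<and> hd2 c < b ^ F) T c0 D"
    using reach_heads[OF r, of "b ^ F"] T by (simp add: c0_def)
  have "rch 1 (sim_cfg g c) (map_tree (sim_cfg g) (mstep N x c))" if "I c" "True \<and> hd1 c < b ^ F \<and> hd2 c < b ^ F" for c
  proof (cases c)
    case c: (Cfg q i f h g' j')
    have g': "g' = (\<lambda>_. False)" "j' = 0" "h < b ^ F" using that c by (auto simp: I_def)
    have up: "(\<lambda>p. if p < b ^ F then f p else g p)(h := w) = (\<lambda>p. if p < b ^ F then (f(h := w)) p else g p)" for w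
      using g' by (auto simp: fun_eq_iff)
    have "mstep (clk N b a m) x (sim_cfg g c) = map_tree (sim_cfg g) (mstep N x c)"
    proof (cases "out N q")
      case None
      have "perform x (sim_cfg g c) (case v of (q', w, _, mi, m1, _) \<Rightarrow> (KSim q', dtape (digs b F 0) 0, w, mi, MStay, m1)) =
         sim_cfg g (perform x c v)" for v
        by (cases v) (use up in \<open>simp add: c\<close>)
      then show ?thesis using None g' by (simp add: c mstep.simps tree.map_comp comp_def)
    qed (simp add: c mstep.simps)
    moreover have "shallow (mstep N x c)"
      using that(1) shallow_mstep[OF fin] by (simp add: I_def)
    ultimately show ?thesis
      using reach_one[of "\<lambda>c. hd1 c \<le> B" "sim_cfg g c" "mstep (clk N b a m) x" 0] by (simp add: c)
  qed
  moreover have "I c'" if "I c" "c' \<in> set_tree (mstep N x c)" for c c'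
    using that single_mstep[OF sg, of c c' x] good_cfg_mstep[OF fin, of c c' x] by (simp add: I_def)
  moreover have "I c0" using fin_machD(3)[OF fin] by (simp add: I_def c0_def good_cfg_def)
  ultimately have "rch (1 * T) (sim_cfg g c0) (map_tree (sim_cfg g) D)"
    by (intro reach_lift[where I = I, OF r']) auto
  moreover have "sim_cfg g c0 = Cfg (KSim (ini N)) 0 (dtape (digs b F 0)) 0 (zeroed (b ^ F) g) 0"
    by (auto simp: c0_def zeroed_def fun_eq_iff)
  ultimately show ?thesis by simp
qed

lemma clk_work:
  assumes fin: "fin_mach N Q UNIV" and sg: "single N"
    and r: "reach (mstep N x) (\<lambda>_. True) T (Cfg (ini N) 0 (\<lambda>_. False) 0 (\<lambda>_. False) 0) D" and T: "T \<le> b ^ F"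
  shows "rch (2 * (b ^ F * (2 * F + 3)) + T) (Cfg (KTk False) 0 (dtape (digs b F 0)) 0 g 0) (map_tree (sim_cfg g) D)"
proof -
  obtain r where r': "Suc r = b ^ F" using b by (metis Suc_pred' zero_less_power less_le_trans zero_less_numeral)
  have "zeroed 0 g = g" by (simp add: zeroed_def fun_eq_iff)
  then have 1: "rch (b ^ F * (2 * F + 3)) (Cfg (KTk False) 0 (dtape (digs b F 0)) 0 g 0)
    (Leaf (Cfg (KTk True) 0 (dtape (digs b F 0)) 0 (zeroed (b ^ F) g) (b ^ F)))"
    using clk_wipe[of 0 r 0 g] r' by simp
  have 2: "rch (b ^ F * (2 * F + 3)) (Cfg (KTk True) 0 (dtape (digs b F 0)) 0 (zeroed (b ^ F) g) (b ^ F))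
    (Leaf (Cfg (KSim (ini N)) 0 (dtape (digs b F 0)) 0 (zeroed (b ^ F) g) 0))"
    using clk_return[of 0 r 0 "zeroed (b ^ F) g"] r' by simp
  show ?thesis
    by (rule reach_mono[OF reach_seq[OF reach_seq[OF 1 2] clk_sim[OF assms]]]) simp
qed

section \<open>Branching with a dyadic probability\<close>

primrec branch :: "nat \<Rightarrow> nat \<Rightarrow> 'c tree \<Rightarrow> 'c tree \<Rightarrow> 'c tree" where
  "branch 0 u W R = (if u < a then W else R)"
| "branch (Suc k) u W R = Flip (branch k (2 * u + 1) W R) (branch k (2 * u) W R)"

lemma set_branch: "set_tree (branch k u W R) \<subseteq> set_tree W \<union> set_tree R"
  by (induction k arbitrary: u) auto

text \<open>Exactly \<open>min (2 ^ k) (a - u * 2 ^ k)\<close> of the \<open>2 ^ k\<close> leaves below \<open>u\<close> lead to \<open>W\<close>.\<close>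

lemma expect_branch:
  "2 ^ k * expect f (branch k u W R) = real (min (2 ^ k) (a - u * 2 ^ k)) * expect f W
     + (2 ^ k - real (min (2 ^ k) (a - u * 2 ^ k))) * expect f R"
proof (induction k arbitrary: u)
  case (Suc k)
  define X where "X = (2::nat) ^ k"
  \<comment> \<open>The subtree of \<open>2 * u\<close> holds the lower \<open>X\<close> leaf
    numbers and receives \<open>min X Y\<close> leaves of \<open>W\<close>; the subtree of
    \<open>2 * u + 1\<close> receives \<open>min X (Y - X)\<close>. Together these are
    \<open>min (2 * X) Y\<close>.\<close>
  define Y where "Y = a - 2 * u * X"
  have y: "min X (a - (2 * u + 1) * X) + min X (a - 2 * u * X) = min (2 * X) (a - u * (2 * X))"
  proof -
    have "a - (2 * u + 1) * X = Y - X" by (simp add: Y_def algebra_simps)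
    moreover have "a - u * (2 * X) = Y" by (simp add: Y_def algebra_simps)
    ultimately show ?thesis unfolding Y_def[symmetric] by simp
  qed
  have "2 ^ Suc k * expect f (branch (Suc k) u W R) =
     2 ^ k * expect f (branch k (2 * u + 1) W R) + 2 ^ k * expect f (branch k (2 * u) W R)"
    by (simp add: algebra_simps)
  also have "\<dots> = real (min X (a - (2 * u + 1) * X) + min X (a - 2 * u * X)) * expect f W
      + (2 * 2 ^ k - real (min X (a - (2 * u + 1) * X) + min X (a - 2 * u * X))) * expect f R"
    unfolding Suc.IH X_def[symmetric] of_nat_add by (simp only: algebra_simps)
  finally show ?case unfolding y by (simp add: X_def)
qed auto

text \<open>After \<open>k\<close> flips and one comparison there remain at most \<open>t\<close>
  steps of work or the single flip of the guess; \<open>0 < t\<close> pays for the latter.\<close>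

lemma clk_branch:
  assumes W: "rch t (Cfg (KTk False) i f 0 g j) W" and t: "0 < t"
  shows "rch (k + 1 + t) (Cfg (KBr k u) i f 0 g j)
     (branch k u W (Flip (Leaf (Cfg (KOut True) i f 0 g j)) (Leaf (Cfg (KOut False) i f 0 g j))))"
proof (induction k arbitrary: u)
  case 0
  show ?case
  proof (cases "u < a")
    case True
    then show ?thesis using W by (auto intro!: reach_act[OF _ _ _ W])
  next
    case False
    obtain t' where t': "t = Suc t'" using t by (cases t) auto
    have "rch (Suc t') (Cfg KRnd i f 0 g j) (Flip (Leaf (Cfg (KOut True) i f 0 g j)) (Leaf (Cfg (KOut False) i f 0 g j)))"
      by (rule reach_flip[where a = "Cfg (KOut True) i f 0 g j" and b = "Cfg (KOut False) i f 0 g j"])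
         (auto simp: mstep.simps intro: reach_stop)
    then show ?thesis
      using False t' by (auto intro!: reach_act[where c' = "Cfg KRnd i f 0 g j"])
  qed
next
  case (Suc k)
  show ?case
    unfolding branch.simps add_Suc
    by (rule reach_flip[OF _ _ Suc.IH Suc.IH]) (simp_all add: mstep.simps)
qed

lemma clk_reach:
  assumes fin: "fin_mach N Q UNIV" and sg: "single N"
    and r: "reach (mstep N x) (\<lambda>_. True) T (Cfg (ini N) 0 (\<lambda>_. False) 0 (\<lambda>_. False) 0) D" and T: "T \<le> b ^ F"
    and D: "\<forall>l\<in>set_tree D. out N (st l) \<noteq> None" "expect (\<lambda>l. of_bool (out N (st l) \<noteq> Some e)) D \<le> eta"
    and q: "a \<le> 2 ^ m" "q = real a / 2 ^ m"
  shows "\<exists>E. rch (m + 1 + (2 * (b ^ F * (2 * F + 3)) + T)) (Cfg (KBr m 0) 0 (dtape (digs b F 0)) 0 g 0) E \<and>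
     (\<forall>l\<in>set_tree E. clk_out N (st l) \<noteq> None) \<and>
     expect (\<lambda>l. of_bool (clk_out N (st l) \<noteq> Some e)) E \<le> q * eta + (1 - q) / 2 \<and>
     expect (\<lambda>l. of_bool (aux l \<noteq> g)) E \<le> q"
proof -
  define W where "W = map_tree (sim_cfg g) D"
  define R :: "('q clk_st, nat mcell) cfg tree" where "R = Flip (Leaf (Cfg (KOut True) 0 (dtape (digs b F 0)) 0 g 0)) (Leaf (Cfg (KOut False) 0 (dtape (digs b F 0)) 0 g 0))"
  define E where "E = branch m 0 W R"
  have "0 < b ^ F" using b by simp
  then have t: "0 < 2 * (b ^ F * (2 * F + 3)) + T" by simp
  have 1: "rch (m + 1 + (2 * (b ^ F * (2 * F + 3)) + T)) (Cfg (KBr m 0) 0 (dtape (digs b F 0)) 0 g 0) E"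
    unfolding E_def R_def W_def by (rule clk_branch[OF clk_work[OF fin sg r T] t])
  have so: "clk_out N (st (sim_cfg g c)) = out N (st c)" for c by (cases c) simp
  have 2: "\<forall>l\<in>set_tree E. clk_out N (st l) \<noteq> None"
  proof
    fix l assume "l \<in> set_tree E"
    then have "l \<in> set_tree W \<or> l \<in> set_tree R" using set_branch[of m 0 W R] unfolding E_def by blast
    then show "clk_out N (st l) \<noteq> None" using D(1) so by (auto simp: W_def R_def tree.set_map)
  qed
  have ex: "expect f E = q * expect f W + (1 - q) * expect f R" for f
  proof -
    have "2 ^ m * expect f E = real a * expect f W + (2 ^ m - real a) * expect f R"
      using expect_branch[of m f 0 W R] q(1) unfolding E_def by (simp add: min_absorb2)
    then have "expect f E = (real a * expect f W + (2 ^ m - real a) * expect f R) / 2 ^ m"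
      by (simp add: field_simps)
    then show ?thesis by (simp add: q(2) field_simps)
  qed
  have q01: "0 \<le> q" "q \<le> 1" using q by auto
  have w3: "expect (\<lambda>l. of_bool (clk_out N (st l) \<noteq> Some e)) W \<le> eta"
    using D(2) by (simp add: W_def expect_map so)
  have r3: "expect (\<lambda>l. of_bool (clk_out N (st l) \<noteq> Some e)) R = 1/2"
    by (cases e) (auto simp: R_def)
  have 3: "expect (\<lambda>l. of_bool (clk_out N (st l) \<noteq> Some e)) E \<le> q * eta + (1 - q) / 2"
    unfolding ex r3 using mult_left_mono[OF w3 q01(1)] by simp
  \<comment> \<open>A working run is counted as destroying the tape, whatever it leaves behind; only
    the guess restores with certainty.\<close>
  have w4: "expect (\<lambda>l. of_bool (aux l \<noteq> g)) W \<le> 1"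
    using expect_mono[of W "\<lambda>l. of_bool (aux l \<noteq> g)" "\<lambda>_. 1"] by simp
  have r4: "expect (\<lambda>l. of_bool (aux l \<noteq> g)) R = 0" by (simp add: R_def)
  have 4: "expect (\<lambda>l. of_bool (aux l \<noteq> g)) E \<le> q"
    unfolding ex r4 using mult_left_mono[OF w4 q01(1)] by simp
  from 1 2 3 4 show ?thesis by blast
qed

end

section \<open>The main theorem\<close>

text \<open>Rounding \<open>v\<close> down to a multiple of \<open>1 / 2 ^ m\<close> loses less than
  \<open>1 / 2 ^ m\<close>, which is below \<open>v - u\<close> for large \<open>m\<close>.\<close>

lemma dyadic_between:
  fixes u v :: real
  assumes "0 \<le> u" "u < v" "v < 1"
  shows "\<exists>a m. a \<le> 2 ^ m \<and> u < real a / 2 ^ m \<and> real a / 2 ^ m \<le> v"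
proof -
  obtain m where m: "(1/2) ^ m < v - u"
    using real_arch_pow_inv[of "v - u" "1/2"] assms by auto
  define a where "a = nat \<lfloor>v * 2 ^ m\<rfloor>"
  have a: "real a \<le> v * 2 ^ m" "v * 2 ^ m < real a + 1"
    using assms by (auto simp: a_def)
  have le: "real a / 2 ^ m \<le> v" using a(1) by (simp add: field_simps)
  have "v < real a / 2 ^ m + (1/2) ^ m" using a(2) by (simp add: field_simps)
  then have "u < real a / 2 ^ m" using m by linarith
  moreover have "a \<le> 2 ^ m"
  proof -
    have "v * 2 ^ m \<le> 2 ^ m" using mult_right_mono[of v 1 "2 ^ m"] assms by simp
    from order_trans[OF a(1) this] show ?thesis by simp
  qed
  ultimately show ?thesis using le by blast
qed

text \<open>The period of the clock is polynomial: \<open>floorlog 2 (n + 2)\<close> is the bit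
  length of \<open>n + 2\<close>, so two to this power is at most
  \<open>2 * (n + 2)\<close>.\<close>

lemma poly_power_floorlog: "poly (\<lambda>n. (2 ^ e) ^ floorlog 2 (n + 2))"
proof (rule poly_le)
  show "poly (\<lambda>n. (2 * (n + 2)) ^ e)" by (intro poly_intros)
  fix n :: nat
  have "(2::nat) ^ floorlog 2 (n + 2) = 2 * 2 ^ (floorlog 2 (n + 2) - 1)"
    by (simp add: floorlog_def)
  also have "\<dots> \<le> 2 * (n + 2)"
    using floorlog_bounds[of "n + 2" 2] by (intro mult_le_mono2) simp
  finally show "(2 ^ e) ^ floorlog 2 (n + 2) \<le> (2 * (n + 2)) ^ e"
    by (metis power_mono power_mult mult.commute zero_le)
qed

lemma poly_floorlog: "poly (\<lambda>n. floorlog 2 (n + 2))"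
  by (rule poly_le[OF poly_power_floorlog[of 1]]) (simp add: less_imp_le less_exp)

lemma BPP_subset_BPCLP:
  assumes "0 < \<epsilon>" "2 * \<epsilon> < \<delta>" "\<delta> < 1"
  shows "BPP \<subseteq> BPCLP \<epsilon> \<delta>"
proof
  fix L assume "L \<in> BPP"
  then obtain M k where M: "wf_machine M" "semi_solves M True 0 (\<lambda>n. (n + 2) ^ k) L (1/3)"
    using BPP_semi by blast
  obtain a m where a: "a \<le> 2 ^ m" "2 * \<epsilon> < real a / 2 ^ m" "real a / 2 ^ m \<le> \<delta>"
    using dyadic_between[of "2 * \<epsilon>" \<delta>] assms by auto
  define q where "q = real a / 2 ^ m"
  define eta where "eta = 1/2 - \<epsilon> / q"
  have q: "2 * \<epsilon> < q" "q \<le> \<delta>" "0 < q" using a assms by (auto simp: q_def)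
  then have eta: "0 < eta" by (simp add: eta_def field_simps)
  have err: "q * eta + (1 - q) / 2 = 1/2 - \<epsilon>" using q by (simp add: eta_def field_simps)
  have p: "poly (\<lambda>n. (n + 2) ^ k)" by (intro poly_intros)
  have w: "(0::real) \<le> 1/3" "(1/3::real) < 1/2" by auto
  obtain N :: "((group_st meas_st, bool list mcell) sweep_st amp_st enc_st, bool) mach" and Q U
    where N: "fin_mach N Q UNIV" "single N" "poly U" "solves N (\<lambda>_ _. False) U L eta"
    using semi_to_binary[OF M p w eta] by auto
  obtain e0 where e0: "\<And>n. U n \<le> (n + 2) ^ e0" using N(3) by (auto simp: poly_def)
  \<comment> \<open>The successor makes the base \<open>b\<close> at least 2 even if
    \<open>e0 = 0\<close>.\<close>
  define e where "e = Suc e0"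
  define b where "b = (2::nat) ^ e"
  define F where "F n = floorlog 2 (n + 2)" for n
  have b: "2 \<le> b" by (simp add: b_def e_def)
  have F: "0 < F n" for n by (simp add: F_def floorlog_def)
  \<comment> \<open>Since \<open>n + 2 < 2 ^ F n\<close>, base \<open>2 ^ e\<close> turns
    \<open>F n\<close> digits into a bound for \<open>(n + 2) ^ e\<close>.\<close>
  have U: "U n \<le> b ^ F n" for n
  proof -
    have "U n \<le> (n + 2) ^ e" using e0[of n] power_increasing[of e0 e "n + 2"] by (simp add: e_def)
    also have "\<dots> \<le> (2 ^ F n) ^ e"
      using floorlog_bounds[of "n + 2" 2] by (intro power_mono) (auto simp: F_def)
    also have "\<dots> = b ^ F n" by (simp add: b_def power_mult[symmetric] mult.commute)
    finally show ?thesis .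
  qed
  let ?G = "insert None (Some ` (UNIV \<times> {..<b})) :: nat mcell set"
  define K where "K = clk N b a m"
  obtain Q1 where f1: "fin_mach K Q1 ?G" using fin_clk[OF N(1) b] unfolding K_def by blast
  \<comment> \<open>The measurement uses the clock digits 0 and 1, so its alphabet is that of the
    clock.\<close>
  obtain Q2 where f2: "fin_mach (meas K 0 1) Q2 ?G" using fin_meas[OF f1, of 0 1] b by auto
  obtain D en where enc: "encoding (meas K 0 1) Q2 ?G None D en" using ex_encoding[OF f2, of None] by auto
  interpret encoding "meas K 0 1" Q2 ?G None D en by (rule enc)
  obtain Q3 where f3: "fin_mach emach Q3 UNIV" using fin_emach by blast
  obtain f where "concretize emach Q3 f" using ex_concretize[OF f3] by blast
  then interpret concretize emach Q3 f .
  define TK where "TK n = m + 1 + (2 * (b ^ F n * (2 * F n + 3)) + U n)" for n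
  define T where "T n = 3 * D * ((n + 1) * (2 * F n + 3) + 2 * F n + n + 4 + TK n)" for n
  have "poly (\<lambda>n. T n + 2)"
    unfolding T_def TK_def F_def b_def
    by (intro poly_intros N(3) poly_floorlog poly_power_floorlog)
  then obtain k0 where k0: "\<And>n. T n + 2 \<le> (n + 2) ^ k0" unfolding poly_def by blast
  \<comment> \<open>One constant governs time and space: \<open>k0\<close> pays for the time,
    \<open>2 * D + 2\<close> for the work cells, where \<open>1 \<le> F n\<close> absorbs the
    constant terms.\<close>
  define k' where "k' = k0 + 2 * D + 2"
  show "L \<in> BPCLP \<epsilon> \<delta>"
  proof (rule BPCLP_I[where B = "\<lambda>n. D * (F n + 1)" and T = T and k = k'])
    fix n
    have "D * (F n + 1) + 2 \<le> (2 * D + 2) * F n"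
    proof -
      have "D * 1 \<le> D * F n" using F[of n] by (intro mult_le_mono) auto
      moreover have "(2 * D + 2) * F n = D * F n + D * F n + 2 * F n" by (simp add: algebra_simps)
      moreover have "D * (F n + 1) = D * F n + D" by simp
      ultimately show ?thesis using F[of n] by linarith
    qed
    also have "\<dots> \<le> k' * F n" by (intro mult_le_mono) (auto simp: k'_def)
    finally show "D * (F n + 1) + 2 \<le> k' * floorlog 2 (n + 2)" by (simp add: F_def)
    show "T n + 2 \<le> (n + 2) ^ k'"
      by (rule le_trans[OF k0 power_increasing]) (auto simp: k'_def)
  next
    fix x :: "bool list" and g :: "nat \<Rightarrow> bool"
    let ?n = "length x"
    obtain E1 where E1: "reach (mstep N x) (\<lambda>_. True) (U ?n) (Cfg (ini N) 0 (\<lambda>_. False) 0 (\<lambda>_. False) 0) E1"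
      "\<forall>l\<in>set_tree E1. out N (st l) \<noteq> None" "expect (\<lambda>l. of_bool (out N (st l) \<noteq> Some (x \<in> L))) E1 \<le> eta"
      using N(4) unfolding solves_def by blast
    \<comment> \<open>The digits occupy the cells below \<open>F ?n\<close> and the head also visits
      the blank cell \<open>F ?n\<close>, which accounts for \<open>F ?n + 1\<close> blocks of
      \<open>D\<close> bits.\<close>
    interpret clocked N b a m x "F ?n" "F ?n"
      by unfold_locales (use b F in auto)
    \<comment> \<open>The measured tape is already the clock showing zero.\<close>
    have dt: "dtape (digs b (F ?n) 0) = mtape 0 ?n"
      by (auto simp: dtape_def mtape_def digs_0 F_def fun_eq_iff)
    obtain E where E: "reach (mstep K x) (\<lambda>c. hd1 c \<le> F ?n) (TK ?n) (Cfg (ini K) 0 (mtape 0 ?n) 0 g 0) E"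
      "\<forall>l\<in>set_tree E. out K (st l) \<noteq> None"
      "expect (\<lambda>l. of_bool (out K (st l) \<noteq> Some (x \<in> L))) E \<le> 1/2 - \<epsilon>" "expect (\<lambda>l. of_bool (aux l \<noteq> g)) E \<le> \<delta>"
      using clk_reach[OF N(1,2) E1(1) U E1(2,3) a(1) q_def, of g] q(2)
      unfolding dt err K_def TK_def by fastforce
    interpret ms: measuring K 0 1 x "F ?n" g 0
      by unfold_locales (auto simp: F_def)
    have good: "good_cfg Q1 ?G (Cfg (ini K) 0 (mtape 0 ?n) 0 g 0)"
      using fin_machD(3)[OF f1] b by (auto simp: good_cfg_def mtape_def)
    have 1: "reach (mstep (meas K 0 1) x) (\<lambda>c. hd1 c \<le> F ?n) ((?n + 1) * (2 * F ?n + 3) + 2 * F ?n + ?n + 4 + TK ?n)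
       (Cfg (ini (meas K 0 1)) 0 (\<lambda>_. None) 0 g 0) (map_tree meas_cfg E)"
      using reach_seq[OF ms.meas_reach meas_lift[OF f1 good E(1), of 0 1, unfolded meas_cfg.simps]] by simp
    have good': "good_cfg Q2 ?G (Cfg (ini (meas K 0 1)) 0 (\<lambda>_. None) 0 g 0)"
      using fin_machD(3)[OF f2] by (auto simp: good_cfg_def)
    have 2: "reach (mstep emach x) (\<lambda>c. hd1 c \<le> D * (F ?n + 1)) (T ?n) (Cfg (ini emach) 0 (\<lambda>_. False) 0 g 0)
       (map_tree enc_cfg (map_tree meas_cfg E))"
      unfolding T_def enc_init[symmetric]
      by (rule enc_reach[OF 1 good']) (intro mult_le_mono; simp)
    show "\<exists>E. reach (mstep emach x) (\<lambda>c. hd1 c \<le> D * (F ?n + 1)) (T ?n) (Cfg (ini emach) 0 (\<lambda>_. False) 0 g 0) E \<and>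
       (\<forall>l\<in>set_tree E. out emach (st l) \<noteq> None) \<and>
       expect (\<lambda>l. of_bool (out emach (st l) \<noteq> Some (x \<in> L))) E \<le> 1/2 - \<epsilon> \<and>
       expect (\<lambda>l. of_bool (aux l \<noteq> g)) E \<le> \<delta>"
      using 2 E(2-4) by (intro exI[of _ "map_tree enc_cfg (map_tree meas_cfg E)"])
        (auto simp: tree.set_map expect_map simp del: One_nat_def emach_simps meas_simps)
  qed
qed

theorem theorem4p3:
  fixes \<epsilon> \<delta> :: real
  assumes "0 \<le> \<delta>" and "\<delta> < 1" and "0 < \<epsilon>" and "\<epsilon> \<le> 1/2" and "\<delta> > 2 * \<epsilon>"
  shows "BPCLP \<epsilon> \<delta> = BPP"
  using BPCLP_subset_BPP[of \<epsilon> \<delta>] BPP_subset_BPCLP[of \<epsilon> \<delta>] assms by auto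

end
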